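(* Let $0 < \beta \leq \alpha < 1$ and $\kappa > 0$. Then, for every $\gamma \in \left(\frac{\alpha - \beta}{1 - \beta},1\right]$, there exist $\epsilon,\epsilon_{0},\epsilon_{B},\delta_{0},\rho \in (0,\tfrac{1}{2}]$, depending only on $\alpha,\beta,\gamma,\kappa$, such that the following holds. Let $\delta \in 2^{-\mathbb{N}}$ with $\delta \in (0,\delta_{0}]$, and let $A,B \subset (\delta \cdot \mathbb{Z}) \cap [0,1]$ satisfy: (A) $|A| \leq \delta^{-\alpha}$; (B) $|B| \geq \delta^{-\beta}$, $|B \cap B(x,r)| \leq r^{\kappa}|B|$ for all $x \in \mathbb{R}$ and $\delta \leq r \leq \delta^{\epsilon_{0}}$, and moreover $|B + B| \leq \delta^{-\epsilon_{B}}|B|$. Further, let $\nu$ be a Borel probability measure with $\operatorname{spt}(\nu) \subset [-1,1]$ satisfying $\nu(B(x,r)) \leq 20 r^{\gamma}$ for all $x \in \mathbb{R}$ and all $r \geq \delta$. Then there exists $c \in \operatorname{spt}(\nu)$ such that \[ |A' + cB|_{\delta} \geq \delta^{-\epsilon}|A'| \] for all subsets $A' \subset A$ with $|A'| \geq (1 - \rho)|A|$.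
   Context: $|\cdot|$ denotes cardinality, $B(x,r)$ the open interval of radius $r$ centred at $x$, and for a bounded $E \subset \mathbb{R}$, $|E|_{\delta}$ is the least number of dyadic intervals $[k\delta,(k+1)\delta)$, $k \in \mathbb{Z}$, needed to cover $E$. Sumsets are $X + Y = \{x+y : x \in X, y \in Y\}$ and $cB = \{cb : b \in B\}$. *)

theory Defs
  imports "HOL-Probability.Probability" "HOL-Library.Set_Algebras"
begin

definition dyadic_intervals :: "real \<Rightarrow> real set set" where
  "dyadic_intervals \<delta> = {{of_int k * \<delta> ..< (of_int k + 1) * \<delta>} | k :: int. True}"

(* Meaningful for bounded E and \<delta> > 0, when a finite cover exists. *)
definition dyadic_covering_number :: "real \<Rightarrow> real set \<Rightarrow> nat" where
  "dyadic_covering_number \<delta> E =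
     (LEAST n. \<exists>\<I>. \<I> \<subseteq> dyadic_intervals \<delta> \<and> finite \<I> \<and> card \<I> = n \<and> E \<subseteq> \<Union>\<I>)"

definition spt :: "'a::topological_space measure \<Rightarrow> 'a set" where
  "spt \<nu> = {x. \<forall>U. open U \<longrightarrow> x \<in> U \<longrightarrow> emeasure \<nu> U > 0}"

end

theory Submission
  imports Defs
begin

text \<open>
  If every \<open>c\<close> in the support of \<open>\<nu>\<close> had a bad subset \<open>A'\<close>, then for any boundedly many \<open>e\<^sub>i \<in> spt \<nu>\<close>
  the Pluennecke inequality, applied to the intersection of their bad subsets, would bound the
  \<open>\<delta>\<close>-covering number of the long sum \<open>e\<^sub>1 B + \<dots> + e\<^sub>h B\<close> by essentially \<open>|A| \<le> \<delta> powr (-\<alpha>)\<close>.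
  It therefore suffices to find a bounded \<open>h\<close> and \<open>e\<^sub>i\<close> for which the long sum has dimension almost
  \<open>\<beta> + \<gamma> (1 - \<beta>) > \<alpha>\<close>.

  A shattering argument in the \<open>D\<close>-adic tree of \<open>B\<close> yields a binary Cantor set inside \<open>B\<close> that
  branches exactly at a set \<open>S\<close> of scales, where \<open>S\<close> has density about \<open>\<beta>\<close>. The scales are cut into
  windows starting at points of \<open>S\<close> from which \<open>S\<close> stays dense. In each window, \<open>D ^ K\<close> copies of \<open>B\<close>
  with one fixed coefficient fill the first \<open>K\<close> scales completely, and a few more copies with
  \<open>\<nu>\<close>-random coefficients contribute dimension \<open>\<gamma>\<close> on the remaining scales by transversality.
  The average over the coefficients is taken on the number of near-coincidences in each window, so
  that one choice of coefficients serves all windows at once.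
\<close>

section \<open>The Pluennecke inequality\<close>

text \<open>Why the windows give the exponent \<open>\<beta> + \<gamma> * (1 - \<beta>)\<close>: the
  \<open>D ^ K\<close> copies with one coefficient fill the top \<open>K\<close> scales of a window,
  but the same copies in the following windows blur the sum by about \<open>D ^ K\<close> times the
  length at which the next window starts. So the last \<open>K\<close> scales of each window cannot
  be resolved, and the random copies gain \<gamma> on \<open>width - K\<close> scales. A window is
  thus worth \<open>K + \<gamma> * (width - K) = (1 - \<gamma>) * K + \<gamma> * width\<close>, and
  \<open>K\<close> is nearly an upper bound for the number of elements of \<open>S\<close> in it;
  summing gives \<open>(1 - \<gamma>) * card S + \<gamma> * l\<close> for \<open>l\<close> scales,
  up to small errors. Every window also costs a constant factor. Since \<open>K\<close> is chosen
  after the constants, this costs at most \<open>s * K\<close> scales, a proportion \<open>s\<close>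
  of the window. The non-concentration of \<open>B\<close> forces branching at coarse levels.
  Without it the first admissible window could start far down the tree, and all scales above it
  would be lost.\<close>

lemma card_add_singleton_set: "card (A + {c}) = card (A :: 'a :: ab_group_add set)"
proof -
  have "A + {c} = (\<lambda>a. a + c) ` A" by (auto simp: set_plus_def)
  thus ?thesis by (simp add: card_image)
qed

text \<open>Petridis' induction on \<open>C\<close>. If \<open>X'\<close> consists of the
  \<open>x\<close> for which \<open>x + c\<close> is already in \<open>X + C\<close>, then
  \<open>X' + B + {c}\<close> is already in \<open>X + B + C\<close>. So \<open>c\<close> adds at
  most \<open>card (X + B) - card (X' + B)\<close> points, which minimality bounds by
  \<open>K * (card X - card X')\<close>, and this is exactly \<open>K\<close> times the growth of
  \<open>X + C\<close>.\<close>

lemma petridis: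
  fixes X B C :: "'a :: ab_group_add set" and K :: real
  assumes fin: "finite X" "finite B" "finite C"
    and eq: "real (card (X + B)) = K * card X"
    and min: "\<And>Z. Z \<subseteq> X \<Longrightarrow> K * card Z \<le> card (Z + B)" and K: "K \<ge> 0"
  shows "card (X + B + C) \<le> K * card (X + C)"
  using fin(3)
proof (induction C)
  case empty
  then show ?case by simp
next
  case (insert c C)
  define X' where "X' = {x\<in>X. x + c \<in> X + C}"
  have X'X: "X' \<subseteq> X" by (auto simp: X'_def)
  have finX': "finite X'" using X'X fin(1) finite_subset by blast
  have fXC: "finite (X + C)" "finite (X + B)" "finite (X' + B)" "finite (X + B + C)"
    using fin insert.hyps finX' by (auto intro!: finite_set_plus)
  have X'B: "X' + B \<subseteq> X + B" using X'X by (auto simp: set_plus_def)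
  have "X + insert c C = (X + C) \<union> ((X - X') + {c})"
  proof (intro equalityI subsetI)
    fix z assume "z \<in> X + insert c C"
    then obtain x e where z: "z = x + e" "x \<in> X" "e \<in> insert c C" by (auto simp: set_plus_def)
    thus "z \<in> (X + C) \<union> ((X - X') + {c})"
      by (cases "e = c"; cases "z \<in> X + C") (auto simp: X'_def)
  qed (auto simp: set_plus_def X'_def)
  moreover have "(X + C) \<inter> ((X - X') + {c}) = {}"
    by (auto simp: set_plus_def X'_def) metis
  ultimately have "card (X + insert c C) = card (X + C) + card ((X - X') + {c})"
    using fXC fin by (auto intro!: card_Un_disjoint finite_set_plus)
  hence c1: "real (card (X + insert c C)) = card (X + C) + (real (card X) - card X')"
    using X'X finX' fin card_mono[OF fin(1) X'X] by (simp add: card_add_singleton_set card_Diff_subset)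
  have sub: "X + B + insert c C \<subseteq> (X + B + C) \<union> (((X + B) - (X' + B)) + {c})"
  proof
    fix z assume "z \<in> X + B + insert c C"
    then obtain x b e where z: "z = x + b + e" "x \<in> X" "b \<in> B" "e \<in> insert c C"
      by (auto simp: set_plus_def)
    show "z \<in> (X + B + C) \<union> (((X + B) - (X' + B)) + {c})"
    proof (cases "e \<in> C")
      case True
      then show ?thesis using z by (auto simp: set_plus_def)
    next
      case False
      hence e: "e = c" using z by auto
      show ?thesis
      proof (cases "x + b \<in> X' + B")
        case True
        then obtain x' b' where x': "x + b = x' + b'" "x' \<in> X'" "b' \<in> B" by (auto simp: set_plus_def)
        then obtain x'' c'' where x'': "x' + c = x'' + c''" "x'' \<in> X" "c'' \<in> C"
          by (auto simp: X'_def set_plus_def)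
        have "z = (x'' + b') + c''" using z(1) e x'(1) x''(1) by (metis (no_types) add.assoc add.commute)
        thus ?thesis using x' x'' by (auto simp: set_plus_def)
      next
        case False
        then show ?thesis using z e by (auto simp: set_plus_def)
      qed
    qed
  qed
  have "card (X + B + insert c C) \<le> card (X + B + C) + card (((X + B) - (X' + B)) + {c})"
    using sub fXC by (intro order.trans[OF card_mono card_Un_le]) (auto intro!: finite_set_plus)
  also have "card (((X + B) - (X' + B)) + {c}) = card (X + B) - card (X' + B)"
    using X'B fXC by (simp add: card_add_singleton_set card_Diff_subset)
  finally have "real (card (X + B + insert c C)) \<le> card (X + B + C) + (real (card (X + B)) - card (X' + B))"
    using card_mono[OF fXC(2) X'B] by (simp add: of_nat_diff)
  also have "\<dots> \<le> K * card (X + C) + (K * card X - K * card X')"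
    using insert.IH eq min[OF X'X] by linarith
  also have "\<dots> = K * card (X + insert c C)" by (simp add: c1 algebra_simps)
  finally show ?case .
qed

lemma exists_minimal_expansion:
  fixes A B :: "'a :: ab_group_add set"
  assumes "finite A" "finite B" "A \<noteq> {}"
  obtains X where "X \<subseteq> A" "X \<noteq> {}"
    "\<And>Z. Z \<subseteq> X \<Longrightarrow> card (X + B) / card X * card Z \<le> card (Z + B)"
    "card (X + B) / card X \<le> card (A + B) / card A"
proof -
  define F where "F = {Z. Z \<subseteq> A \<and> Z \<noteq> {}}"
  have "finite F" "F \<noteq> {}" using assms by (auto simp: F_def)
  define q where "q Z = real (card (Z + B)) / card Z" for Z
  obtain X where X: "X \<in> F" "\<And>Z. Z \<in> F \<Longrightarrow> q X \<le> q Z"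
    using \<open>finite F\<close> \<open>F \<noteq> {}\<close> by (metis arg_min_if_finite(1) arg_min_least)
  show ?thesis
  proof
    show "X \<subseteq> A" "X \<noteq> {}" using X by (auto simp: F_def)
    show "card (X + B) / card X \<le> card (A + B) / card A"
      using X(2)[of A] assms by (auto simp: F_def q_def)
    fix Z assume Z: "Z \<subseteq> X"
    show "card (X + B) / card X * card Z \<le> card (Z + B)"
    proof (cases "Z = {}")
      case False
      hence "Z \<in> F" using Z X by (auto simp: F_def)
      hence "q X \<le> q Z" by (rule X)
      moreover have "card Z > 0" using False Z \<open>X \<subseteq> A\<close> assms(1)
        by (meson card_gt_0_iff finite_subset)
      ultimately show ?thesis by (simp add: q_def field_simps)
    qed simp
  qed
qed

text \<open>One minimiser \<open>X\<close> serves for all summands: each further summand costs one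
  factor \<open>K\<close> by \<open>petridis\<close>, with the partial sum in the role of its
  \<open>C\<close>. The \<open>C i\<close> may differ because the long sum adds different dilates;
  \<open>B\<close> will be the union of their discretisations.\<close>

lemma plunnecke_sum:
  fixes A B :: "'a :: ab_group_add set" and K :: real
  assumes fin: "finite A" "finite B" and A: "A \<noteq> {}" and K: "card (A + B) \<le> K * card A"
    and C: "\<And>i::nat. i < h \<Longrightarrow> C i \<subseteq> B"
  shows "card (\<Sum>i<h. C i) \<le> K ^ h * card A"
proof -
  obtain X where X: "X \<subseteq> A" "X \<noteq> {}"
    "\<And>Z. Z \<subseteq> X \<Longrightarrow> card (X + B) / card X * card Z \<le> card (Z + B)"
    "card (X + B) / card X \<le> card (A + B) / card A"
    using exists_minimal_expansion[OF fin A] by blast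
  have finX: "finite X" using X fin finite_subset by blast
  have cX: "card X > 0" "card A > 0" using X finX A fin by (auto simp: card_gt_0_iff)
  have qK: "card (X + B) / card X \<le> K"
    using X(4) K cX by (meson divide_le_eq of_nat_0_less_iff order_trans)
  have "0 \<le> card (X + B) / card X" by simp
  hence K0: "K \<ge> 0" using qK by linarith
  have "h' \<le> h \<Longrightarrow> finite (\<Sum>i<h'. C i) \<and> card (X + (\<Sum>i<h'. C i)) \<le> K ^ h' * card X" for h'
  proof (induction h')
    case 0
    then show ?case by (simp add: set_zero card_add_singleton_set)
  next
    case (Suc h')
    define S where "S = (\<Sum>i<h'. C i)"
    have S: "finite S" "card (X + S) \<le> K ^ h' * card X" using Suc by (auto simp: S_def)
    have Ch: "C h' \<subseteq> B" "finite (C h')" using C[of h'] Suc.prems fin finite_subset by auto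
    have "X + (S + C h') \<subseteq> X + B + S" using Ch(1) 
    proof -
      have "X + (S + C h') \<subseteq> X + (S + B)" using Ch(1) by (intro set_plus_mono2) auto
      also have "\<dots> = X + B + S" by (simp add: ac_simps)
      finally show ?thesis .
    qed
    hence "real (card (X + (S + C h'))) \<le> card (X + B + S)"
      using S finX fin by (auto intro!: card_mono finite_set_plus)
    also have "\<dots> \<le> card (X + B) / card X * card (X + S)"
      using X(3) finX fin S cX by (intro petridis) auto
    also have "\<dots> \<le> K * (K ^ h' * card X)"
      using qK S(2) K0 by (intro mult_mono) auto
    finally show ?case using S Ch by (auto simp: S_def[symmetric] intro!: finite_set_plus)
  qed
  from this[of h] have *: "finite (\<Sum>i<h. C i)" "card (X + (\<Sum>i<h. C i)) \<le> K ^ h * card X" by auto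
  obtain x where x: "x \<in> X" using X by auto
  have "(\<Sum>i<h. C i) + {x} \<subseteq> X + (\<Sum>i<h. C i)" using x by (subst add.commute) (intro set_plus_mono2, auto)
  hence "card (\<Sum>i<h. C i) \<le> card (X + (\<Sum>i<h. C i))"
    using * finX by (metis card_add_singleton_set card_mono finite_set_plus)
  also have "real \<dots> \<le> K ^ h * card X" by (rule *)
  also have "\<dots> \<le> K ^ h * card A"
    using X(1) fin K0 by (intro mult_left_mono) (auto simp: card_mono)
  finally show ?thesis by simp
qed

lemma sum_in_sumset: "(\<And>i. i \<in> I \<Longrightarrow> z i \<in> C i) \<Longrightarrow> finite I \<Longrightarrow> (\<Sum>i\<in>I. z i) \<in> (\<Sum>i\<in>I. C i)"
  by (auto simp: set_sum_alt)

lemma sum_PiE_insert: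
  assumes "i \<notin> I"
  shows "(\<Sum>f\<in>PiE (insert i I) \<Omega>. F f) = (\<Sum>f\<in>PiE I \<Omega>. \<Sum>a\<in>\<Omega> i. F (f(i := a)))"
proof -
  have bij: "bij_betw (\<lambda>(f,a). f(i := a)) (PiE I \<Omega> \<times> \<Omega> i) (PiE (insert i I) \<Omega>)"
    unfolding bij_betw_def
  proof
    show "inj_on (\<lambda>(f,a). f(i := a)) (PiE I \<Omega> \<times> \<Omega> i)"
    proof (rule inj_onI, clarify)
      fix f g a b assume f: "f \<in> PiE I \<Omega>" and g: "g \<in> PiE I \<Omega>" and eq: "f(i := a) = g(i := b)"
      have "f k = g k" for k
        using fun_cong[OF eq, of k] PiE_arb[OF f assms] PiE_arb[OF g assms] by (cases "k = i") auto
      thus "f = g \<and> a = b" using fun_cong[OF eq, of i] by auto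
    qed
    show "(\<lambda>(f,a). f(i := a)) ` (PiE I \<Omega> \<times> \<Omega> i) = PiE (insert i I) \<Omega>"
      unfolding PiE_insert_eq by force
  qed
  have "(\<Sum>f\<in>PiE (insert i I) \<Omega>. F f) = (\<Sum>x\<in>PiE I \<Omega> \<times> \<Omega> i. F (case x of (f, a) \<Rightarrow> f(i := a)))"
    by (rule sum.reindex_bij_betw[OF bij, symmetric])
  also have "\<dots> = (\<Sum>f\<in>PiE I \<Omega>. \<Sum>a\<in>\<Omega> i. F (f(i := a)))"
    by (simp add: sum.cartesian_product case_prod_unfold)
  finally show ?thesis .
qed

section \<open>Counting cells along a filtration\<close>

text \<open>The number of competitors of the choice \<open>f p\<close> when the earlier choices are
  fixed. The radius is doubled because two choices that are both within \<open>R (Suc p)\<close> of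
  one target are within \<open>2 * R (Suc p)\<close> of each other.\<close>

definition near_count :: "(nat \<Rightarrow> 'a set) \<Rightarrow> (nat \<Rightarrow> (nat \<Rightarrow> 'a) \<Rightarrow> real) \<Rightarrow> (nat \<Rightarrow> real) \<Rightarrow> nat \<Rightarrow> (nat \<Rightarrow> 'a) \<Rightarrow> nat"
  where "near_count \<Omega> Y R p f =
    card {a\<in>\<Omega> p. \<bar>Y (Suc p) (f(p := a)) - Y (Suc p) f\<bar> \<le> 2 * R (Suc p)}"

text \<open>Follow the target \<open>y\<close> down the tree of choices. The balls of radius
  \<open>R p\<close> about the partial sums are nested, so a choice near \<open>y\<close> at the end
  was near \<open>y\<close> at every stage. The children that stay near \<open>y\<close> are
  pairwise near, hence each has a near count at least their number, and their inverse near counts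
  sum to at most 1 at every node.\<close>

lemma sum_inverse_near_count_le_1:
  fixes Y :: "nat \<Rightarrow> (nat \<Rightarrow> 'a) \<Rightarrow> real"
  assumes fin: "\<And>p. p < P \<Longrightarrow> finite (\<Omega> p)"
    and loc: "\<And>p f g. (\<And>i. i < p \<Longrightarrow> f i = g i) \<Longrightarrow> Y p f = Y p g"
    and Y: "\<And>p f. p < P \<Longrightarrow> f \<in> PiE {..<Suc p} \<Omega> \<Longrightarrow>
              \<bar>Y (Suc p) f - Y p f\<bar> \<le> R p - R (Suc p)"
  shows "(\<Sum>f\<in>{f\<in>PiE {..<P} \<Omega>. \<bar>Y P f - y\<bar> \<le> R P}. \<Prod>p<P. 1 / near_count \<Omega> Y R p f) \<le> 1"
proof -
  have "p \<le> P \<Longrightarrow> (\<Sum>f\<in>PiE {..<p} \<Omega>. if \<bar>Y p f - y\<bar> \<le> R p then \<Prod>q<p. 1 / near_count \<Omega> Y R q f else 0) \<le> 1" for p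
  proof (induction p)
    case 0
    have "(\<Sum>f\<in>PiE {..<0::nat} \<Omega>. if \<bar>Y 0 f - y\<bar> \<le> R 0 then \<Prod>q<0. 1 / real (near_count \<Omega> Y R q f) else 0)
       = (if \<bar>Y 0 (\<lambda>_. undefined) - y\<bar> \<le> R 0 then 1 else 0)"
      by simp
    also have "\<dots> \<le> 1" by simp
    finally show ?case .
  next
    case (Suc p)
    hence p: "p < P" by simp
    define w where "w f = (\<Prod>q<p. 1 / real (near_count \<Omega> Y R q f))" for f
    have w0: "w f \<ge> 0" for f by (auto simp: w_def intro!: prod_nonneg)
    have wupd: "w (f(p := a)) = w f" for f a
      unfolding w_def near_count_def
    proof (intro prod.cong refl)
      fix q assume q: "q \<in> {..<p}"
      have "Y (Suc q) (f(p := a, q := b)) = Y (Suc q) (f(q := b))" for b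
        using q by (intro loc) auto
      moreover have "Y (Suc q) (f(p := a)) = Y (Suc q) f" using q by (intro loc) auto
      ultimately show "1 / real (card {aa \<in> \<Omega> q. \<bar>Y (Suc q) (f(p := a, q := aa)) - Y (Suc q) (f(p := a))\<bar> \<le> 2 * R (Suc q)}) =
          1 / real (card {a \<in> \<Omega> q. \<bar>Y (Suc q) (f(q := a)) - Y (Suc q) f\<bar> \<le> 2 * R (Suc q)})" by simp
    qed
    have "(\<Sum>f\<in>PiE {..<Suc p} \<Omega>. if \<bar>Y (Suc p) f - y\<bar> \<le> R (Suc p) then \<Prod>q<Suc p. 1 / near_count \<Omega> Y R q f else 0)
       = (\<Sum>f\<in>PiE {..<p} \<Omega>. w f * (\<Sum>a\<in>\<Omega> p. if \<bar>Y (Suc p) (f(p := a)) - y\<bar> \<le> R (Suc p) then 1 / near_count \<Omega> Y R p (f(p := a)) else 0))"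
      unfolding lessThan_Suc sum_PiE_insert[of p "{..<p}", simplified] sum_distrib_left
      by (intro sum.cong refl) (auto simp: w_def[symmetric] wupd)
    also have "\<dots> \<le> (\<Sum>f\<in>PiE {..<p} \<Omega>. w f * (if \<bar>Y p f - y\<bar> \<le> R p then 1 else 0))"
    proof (intro sum_mono mult_left_mono w0)
      fix f assume f: "f \<in> PiE {..<p} \<Omega>"
      define A where "A = {a\<in>\<Omega> p. \<bar>Y (Suc p) (f(p := a)) - y\<bar> \<le> R (Suc p)}"
      have finA: "finite A" using fin[OF p] by (auto simp: A_def)
      have eq: "(\<Sum>a\<in>\<Omega> p. if \<bar>Y (Suc p) (f(p := a)) - y\<bar> \<le> R (Suc p) then 1 / near_count \<Omega> Y R p (f(p := a)) else 0)
         = (\<Sum>a\<in>A. 1 / near_count \<Omega> Y R p (f(p := a)))"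
        unfolding A_def using fin[OF p] by (intro sum.inter_filter[symmetric])
      show "(\<Sum>a\<in>\<Omega> p. if \<bar>Y (Suc p) (f(p := a)) - y\<bar> \<le> R (Suc p) then 1 / near_count \<Omega> Y R p (f(p := a)) else 0)
         \<le> (if \<bar>Y p f - y\<bar> \<le> R p then 1 else 0)"
      proof (cases "A = {}")
        case True
        then show ?thesis by (simp add: eq)
      next
        case False
        then obtain a where a: "a \<in> A" by auto
        have "f(p := a) \<in> PiE {..<Suc p} \<Omega>" using f a by (auto simp: A_def PiE_iff extensional_def less_Suc_eq)
        from Y[OF p this] have "\<bar>Y (Suc p) (f(p := a)) - Y p (f(p := a))\<bar> \<le> R p - R (Suc p)" .
        moreover have "Y p (f(p := a)) = Y p f" by (intro loc) auto
        ultimately have near: "\<bar>Y p f - y\<bar> \<le> R p" using a by (auto simp: A_def)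
        have "(\<Sum>a\<in>A. 1 / near_count \<Omega> Y R p (f(p := a))) \<le> (\<Sum>a\<in>A. 1 / card A)"
        proof (intro sum_mono)
          fix a assume a: "a \<in> A"
          have "A \<subseteq> {b\<in>\<Omega> p. \<bar>Y (Suc p) (f(p := a, p := b)) - Y (Suc p) (f(p := a))\<bar> \<le> 2 * R (Suc p)}"
            using a by (auto simp: A_def)
          hence "card A \<le> near_count \<Omega> Y R p (f(p := a))"
            unfolding near_count_def using fin[OF p] by (intro card_mono) auto
          moreover have "card A > 0" using a finA by (auto simp: card_gt_0_iff)
          ultimately show "1 / real (near_count \<Omega> Y R p (f(p := a))) \<le> 1 / real (card A)"
            by (intro divide_left_mono) auto
        qed
        also have "\<dots> \<le> 1" by simp
        finally show ?thesis using near eq by simp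
      qed
    qed
    also have "\<dots> \<le> 1" using Suc by (simp add: w_def if_distrib cong: if_cong)
    finally show ?case .
  qed
  from this[of P] show ?thesis
    using fin by (subst sum.inter_filter) (auto intro!: finite_PiE)
qed

lemma prod_ge_one_minus_sum:
  fixes y :: "'a \<Rightarrow> real"
  assumes "finite I" "\<And>i. i \<in> I \<Longrightarrow> y i > 0"
  shows "(\<Prod>i\<in>I. y i) \<ge> 1 - (\<Sum>i\<in>I. 1 / y i - 1)"
proof -
  have "1 - (\<Sum>i\<in>I. 1 / y i - 1) \<le> 1 + (\<Sum>i\<in>I. ln (y i))"
  proof -
    have "ln (1 / y i) \<le> 1 / y i - 1" if "i \<in> I" for i
      using assms(2)[OF that] by (intro ln_le_minus_one) auto
    hence "(\<Sum>i\<in>I. ln (1 / y i)) \<le> (\<Sum>i\<in>I. 1 / y i - 1)" by (intro sum_mono)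
    moreover have "(\<Sum>i\<in>I. ln (1 / y i)) = - (\<Sum>i\<in>I. ln (y i))"
      unfolding sum_negf[symmetric] by (intro sum.cong refl) (use assms(2) in \<open>auto simp: ln_div\<close>)
    ultimately show ?thesis by linarith
  qed
  also have "\<dots> \<le> exp (\<Sum>i\<in>I. ln (y i))" by (rule exp_ge_add_one_self)
  also have "\<dots> = (\<Prod>i\<in>I. y i)" using assms by (simp add: exp_sum)
  finally show ?thesis .
qed

text \<open>
  The tangent inequality above replaces Jensen's inequality: each factor enters linearly, so its
  average over the weights can be taken separately although all factors depend on the same \<open>c\<close>.
\<close>

lemma exists_weight_many_cells:
  fixes Y :: "'c \<Rightarrow> nat \<Rightarrow> (nat \<Rightarrow> 'a) \<Rightarrow> real" and W :: "'c \<Rightarrow> real" and a :: "nat \<Rightarrow> real"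
  assumes fin: "\<And>p. p < P \<Longrightarrow> finite (\<Omega> p)" and ne: "\<And>p. p < P \<Longrightarrow> \<Omega> p \<noteq> {}"
    and loc: "\<And>c p f g. c \<in> T \<Longrightarrow> (\<And>i. i < p \<Longrightarrow> f i = g i) \<Longrightarrow> Y c p f = Y c p g"
    and Y: "\<And>c p f. c \<in> T \<Longrightarrow> p < P \<Longrightarrow> f \<in> PiE {..<Suc p} \<Omega> \<Longrightarrow>
              \<bar>Y c (Suc p) f - Y c p f\<bar> \<le> R p - R (Suc p)"
    and R0: "\<And>p. p \<le> P \<Longrightarrow> R p \<ge> 0"
    and T: "finite T" "\<And>c. c \<in> T \<Longrightarrow> W c \<ge> 0" "(\<Sum>c\<in>T. W c) = 1"
    and apos: "\<And>p. p < P \<Longrightarrow> a p > 0"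
    and Q: "\<And>p f. p < P \<Longrightarrow> f \<in> PiE {..<Suc p} \<Omega> \<Longrightarrow>
              (\<Sum>c\<in>T. W c * near_count \<Omega> (Y c) R p f) \<le> card (\<Omega> p) * a p"
    and cells: "\<And>c f. c \<in> T \<Longrightarrow> f \<in> PiE {..<P} \<Omega> \<Longrightarrow> \<bar>Y c P f - r * real_of_int (z c f)\<bar> \<le> R P"
  shows "\<exists>c\<in>T. (\<Prod>p<P. 1 / a p) \<le> card (z c ` PiE {..<P} \<Omega>)"
proof (rule ccontr)
  assume "\<not> ?thesis"
  hence neg: "card (z c ` PiE {..<P} \<Omega>) < (\<Prod>p<P. 1 / a p)" if "c \<in> T" for c
    using that by (auto simp: not_le)
  define PP where "PP = PiE {..<P} \<Omega>"
  have finPP: "finite PP" using fin by (auto simp: PP_def intro!: finite_PiE)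
  have cardPP: "card PP = (\<Prod>p<P. card (\<Omega> p))" unfolding PP_def by (simp add: card_PiE)
  have cpos: "card (\<Omega> p) > 0" if "p < P" for p using fin[OF that] ne[OF that] by (simp add: card_gt_0_iff)
  have cPPpos: "card PP > 0" unfolding cardPP using cpos by (auto intro!: prod_pos)
  define N where "N c p f = real (near_count \<Omega> (Y c) R p f)" for c p f
  \<comment> \<open>The hypothesis on averages speaks of choices for the first \<open>Suc p\<close>
    stages, whereas an element of \<open>PP\<close> fixes all stages.\<close>
  have restr: "N c p f = N c p (restrict f {..<Suc p})" if "c \<in> T" for c p f
  proof -
    have "Y c (Suc p) (f(p := b)) = Y c (Suc p) ((restrict f {..<Suc p})(p := b))" for b
      by (intro loc that) auto
    moreover have "Y c (Suc p) f = Y c (Suc p) (restrict f {..<Suc p})" by (intro loc that) auto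
    ultimately show ?thesis by (simp add: N_def near_count_def)
  qed
  have Npos: "N c p f > 0" if "c \<in> T" "p < P" "f \<in> PP" for c p f
  proof -
    have "f p \<in> \<Omega> p" using that by (auto simp: PP_def)
    moreover have "R (Suc p) \<ge> 0" using R0 that by auto
    ultimately have "f p \<in> {a\<in>\<Omega> p. \<bar>Y c (Suc p) (f(p := a)) - Y c (Suc p) f\<bar> \<le> 2 * R (Suc p)}" by simp
    moreover have "finite {a\<in>\<Omega> p. \<bar>Y c (Suc p) (f(p := a)) - Y c (Suc p) f\<bar> \<le> 2 * R (Suc p)}"
      using fin[OF that(2)] by simp
    ultimately show ?thesis unfolding N_def near_count_def by (auto simp: card_gt_0_iff)
  qed
  \<comment> \<open>Choices with the same value of \<open>z c\<close> are near one grid point, so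
    each fibre has total weight at most 1, and the number of fibres is at least the total
    weight.\<close>
  have upper: "(\<Sum>f\<in>PP. \<Prod>p<P. 1 / N c p f) \<le> card (z c ` PP)" if c: "c \<in> T" for c
  proof -
    have "(\<Sum>f\<in>PP. \<Prod>p<P. 1 / N c p f) = (\<Sum>k\<in>z c ` PP. \<Sum>f\<in>{f\<in>PP. z c f = k}. \<Prod>p<P. 1 / N c p f)"
      using finPP by (intro sum.image_gen)
    also have "\<dots> \<le> (\<Sum>k\<in>z c ` PP. 1)"
    proof (intro sum_mono)
      fix k assume "k \<in> z c ` PP"
      have "(\<Sum>f\<in>{f\<in>PP. z c f = k}. \<Prod>p<P. 1 / N c p f)
        \<le> (\<Sum>f\<in>{f\<in>PP. \<bar>Y c P f - r * real_of_int k\<bar> \<le> R P}. \<Prod>p<P. 1 / N c p f)"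
        using finPP cells c by (intro sum_mono2) (auto simp: PP_def N_def intro!: prod_nonneg)
      also have "\<dots> \<le> 1" unfolding PP_def N_def
        by (rule sum_inverse_near_count_le_1) (erule fin, erule loc[OF c], erule (1) Y[OF c])
      finally show "(\<Sum>f\<in>{f\<in>PP. z c f = k}. \<Prod>p<P. 1 / N c p f) \<le> 1" .
    qed
    finally show ?thesis by simp
  qed
  \<comment> \<open>\<open>b p\<close> bounds the mean of \<open>N c p f\<close> over
    \<open>c\<close>. Hence every term subtracted in the tangent inequality has mean at most 0,
    which gives \<open>lower1\<close>.\<close>
  define b where "b p = card (\<Omega> p) * a p" for p
  have bpos: "b p > 0" if "p < P" for p using cpos[OF that] apos[OF that] by (simp add: b_def)
  have lower1: "1 \<le> (\<Sum>c\<in>T. W c * (\<Prod>p<P. b p / N c p f))" if f: "f \<in> PP" for f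
  proof -
    have Qf: "(\<Sum>c\<in>T. W c * N c p f) \<le> b p" if "p < P" for p
    proof -
      have "restrict f {..<Suc p} \<in> PiE {..<Suc p} \<Omega>" using f that by (auto simp: PP_def PiE_iff)
      from Q[OF that this] have "(\<Sum>c\<in>T. W c * N c p (restrict f {..<Suc p})) \<le> b p" by (simp add: N_def b_def)
      also have "(\<Sum>c\<in>T. W c * N c p (restrict f {..<Suc p})) = (\<Sum>c\<in>T. W c * N c p f)"
        by (intro sum.cong refl) (subst restr[of _ p f], auto)
      finally show ?thesis .
    qed
    have "1 \<le> 1 - (\<Sum>p<P. (\<Sum>c\<in>T. W c * N c p f) / b p - 1)"
    proof -
      have "(\<Sum>p<P. (\<Sum>c\<in>T. W c * N c p f) / b p - 1) \<le> 0"
        using Qf bpos by (intro sum_nonpos) (auto simp: field_simps)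
      thus ?thesis by simp
    qed
    also have "\<dots> = (\<Sum>c\<in>T. W c * (1 - (\<Sum>p<P. N c p f / b p - 1)))"
    proof -
      have "(\<Sum>c\<in>T. W c * (1 - (\<Sum>p<P. N c p f / b p - 1))) = (\<Sum>c\<in>T. W c) - (\<Sum>c\<in>T. W c * (\<Sum>p<P. N c p f / b p - 1))"
        by (simp add: right_diff_distrib sum_subtractf)
      also have "(\<Sum>c\<in>T. W c * (\<Sum>p<P. N c p f / b p - 1)) = (\<Sum>p<P. \<Sum>c\<in>T. W c * (N c p f / b p - 1))"
        unfolding sum_distrib_left by (rule sum.swap)
      also have "\<dots> = (\<Sum>p<P. (\<Sum>c\<in>T. W c * N c p f) / b p - 1)"
        by (intro sum.cong refl) (simp add: right_diff_distrib sum_subtractf T(3) sum_divide_distrib)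
      finally show ?thesis using T(3) by simp
    qed
    also have "\<dots> \<le> (\<Sum>c\<in>T. W c * (\<Prod>p<P. b p / N c p f))"
    proof (intro sum_mono mult_left_mono T(2))
      fix c assume c: "c \<in> T"
      have "1 - (\<Sum>p<P. 1 / (b p / N c p f) - 1) \<le> (\<Prod>p<P. b p / N c p f)"
        using Npos[OF c _ f] bpos by (intro prod_ge_one_minus_sum) auto
      thus "1 - (\<Sum>p<P. N c p f / b p - 1) \<le> (\<Prod>p<P. b p / N c p f)" by simp
    qed
    finally show ?thesis .
  qed
  have "real (card PP) \<le> (\<Sum>f\<in>PP. \<Sum>c\<in>T. W c * (\<Prod>p<P. b p / N c p f))"
    using sum_mono[of PP "\<lambda>_. 1", OF lower1] by simp
  also have "\<dots> = (\<Sum>c\<in>T. W c * ((\<Prod>p<P. b p) * (\<Sum>f\<in>PP. \<Prod>p<P. 1 / N c p f)))"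
    by (subst sum.swap) (simp add: sum_distrib_left prod.distrib[symmetric])
  also have "\<dots> \<le> (\<Sum>c\<in>T. W c * ((\<Prod>p<P. b p) * card (z c ` PP)))"
    using upper bpos by (intro sum_mono mult_left_mono T(2) prod_nonneg) (auto intro: less_imp_le)
  finally have 1: "real (card PP) \<le> (\<Sum>c\<in>T. W c * ((\<Prod>p<P. b p) * card (z c ` PP)))" .
  have bprod: "(\<Prod>p<P. b p) = card PP * (\<Prod>p<P. a p)" by (simp add: b_def prod.distrib cardPP)
  have apr: "(\<Prod>p<P. a p) > 0" using apos by (auto intro!: prod_pos)
  have "(\<Sum>c\<in>T. W c * ((\<Prod>p<P. b p) * card (z c ` PP))) = card PP * (\<Prod>p<P. a p) * (\<Sum>c\<in>T. W c * card (z c ` PP))"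
    unfolding bprod sum_distrib_left by (intro sum.cong refl) simp
  with 1 cPPpos have "1 \<le> (\<Prod>p<P. a p) * (\<Sum>c\<in>T. W c * card (z c ` PP))" by simp
  hence "(\<Prod>p<P. 1 / a p) \<le> (\<Sum>c\<in>T. W c * card (z c ` PP))"
    using apr by (simp add: prod_dividef field_simps)
  moreover have "(\<Sum>c\<in>T. W c * card (z c ` PP)) < (\<Sum>c\<in>T. W c * (\<Prod>p<P. 1 / a p))"
  proof -
    have "\<exists>c\<in>T. W c > 0"
    proof (rule ccontr)
      assume "\<not> ?thesis"
      hence "(\<Sum>c\<in>T. W c) \<le> 0" by (intro sum_nonpos) (auto simp: not_less)
      thus False using T by simp
    qed
    then obtain c0 where c0: "c0 \<in> T" "W c0 > 0" by blast
    show ?thesis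
    proof (rule sum_strict_mono_ex1)
      show "finite T" by (rule T(1))
      show "\<forall>c\<in>T. W c * card (z c ` PP) \<le> W c * (\<Prod>p<P. 1 / a p)"
        unfolding PP_def by (intro ballI mult_left_mono less_imp_le[OF neg] T(2))
      show "\<exists>c\<in>T. W c * card (z c ` PP) < W c * (\<Prod>p<P. 1 / a p)"
        unfolding PP_def by (intro bexI[of _ c0] mult_strict_left_mono neg c0)
    qed
  qed
  moreover have "(\<Sum>c\<in>T. W c * (\<Prod>p<P. 1 / a p)) = (\<Prod>p<P. 1 / a p)"
    unfolding sum_distrib_right[symmetric] T(3) by simp
  ultimately show False by simp
qed

section \<open>Binary codings inside a tree\<close>

text \<open>Points are integers in units of \<delta>, and the unit interval consists of
  \<open>q * D ^ N\<close> units. The factor \<open>q\<close> takes up what remains of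
  \<open>1 / \<delta> = 2 ^ k\<close> when \<open>k\<close> is not a multiple of the exponent of
  \<open>D\<close>.\<close>

definition cell :: "nat \<Rightarrow> nat \<Rightarrow> nat \<Rightarrow> nat \<Rightarrow> nat \<Rightarrow> nat"
  where "cell q D N j b = b div (q * D ^ (N - j))"

text \<open>
  A code word is a subset of the branching levels \<open>S\<close>. The gap 2 keeps the two children apart
  by at least one full cell.
\<close>

definition binary_coding ::
  "nat \<Rightarrow> nat \<Rightarrow> nat \<Rightarrow> nat set \<Rightarrow> nat \<Rightarrow> nat set \<Rightarrow> nat \<Rightarrow> (nat set \<Rightarrow> nat) \<Rightarrow> bool"
  where "binary_coding q D N B j S v \<phi> \<longleftrightarrow>
    (\<forall>\<omega>\<subseteq>S. \<phi> \<omega> \<in> B \<and> cell q D N j (\<phi> \<omega>) = v) \<and>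
    (\<forall>\<omega>\<subseteq>S. \<forall>\<omega>'\<subseteq>S. \<forall>i\<in>{j..N}. \<omega> \<inter> {..<i} = \<omega>' \<inter> {..<i} \<longrightarrow>
       cell q D N i (\<phi> \<omega>) = cell q D N i (\<phi> \<omega>')) \<and>
    (\<forall>\<omega>\<subseteq>S. \<forall>\<omega>'\<subseteq>S. \<forall>i\<in>S. \<omega> \<inter> {..<i} = \<omega>' \<inter> {..<i} \<longrightarrow> i \<notin> \<omega> \<longrightarrow> i \<in> \<omega>' \<longrightarrow>
       cell q D N (Suc i) (\<phi> \<omega>) + 2 \<le> cell q D N (Suc i) (\<phi> \<omega>'))"

definition shatters :: "nat \<Rightarrow> nat \<Rightarrow> nat \<Rightarrow> nat set \<Rightarrow> nat \<Rightarrow> nat set \<Rightarrow> nat \<Rightarrow> bool"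
  where "shatters q D N B j S v \<longleftrightarrow> (\<exists>\<phi>. binary_coding q D N B j S v \<phi>)"

lemma cell_div:
  assumes "i \<le> j" "j \<le> N"
  shows "cell q D N j b div D ^ (j - i) = cell q D N i b"
proof -
  have "q * D ^ (N - i) = q * D ^ (N - j) * D ^ (j - i)"
    using assms by (simp add: power_add[symmetric])
  hence "b div (q * D ^ (N - j)) div D ^ (j - i) = b div (q * D ^ (N - i))"
    by (simp only: div_mult2_eq)
  thus ?thesis by (simp only: cell_def)
qed

lemma binary_codingD:
  assumes "binary_coding q D N B j S v \<phi>"
  shows "\<omega> \<subseteq> S \<Longrightarrow> \<phi> \<omega> \<in> B" "\<omega> \<subseteq> S \<Longrightarrow> cell q D N j (\<phi> \<omega>) = v"
    "\<omega> \<subseteq> S \<Longrightarrow> \<omega>' \<subseteq> S \<Longrightarrow> j \<le> i \<Longrightarrow> i \<le> N \<Longrightarrow> \<omega> \<inter> {..<i} = \<omega>' \<inter> {..<i} \<Longrightarrow>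
       cell q D N i (\<phi> \<omega>) = cell q D N i (\<phi> \<omega>')"
    "\<omega> \<subseteq> S \<Longrightarrow> \<omega>' \<subseteq> S \<Longrightarrow> i \<in> S \<Longrightarrow> \<omega> \<inter> {..<i} = \<omega>' \<inter> {..<i} \<Longrightarrow> i \<notin> \<omega> \<Longrightarrow> i \<in> \<omega>' \<Longrightarrow>
       cell q D N (Suc i) (\<phi> \<omega>) + 2 \<le> cell q D N (Suc i) (\<phi> \<omega>')"
proof -
  note def = assms[unfolded binary_coding_def]
  note c = conjunct1[OF def] conjunct1[OF conjunct2[OF def]] conjunct2[OF conjunct2[OF def]]
  show "\<omega> \<subseteq> S \<Longrightarrow> \<phi> \<omega> \<in> B" "\<omega> \<subseteq> S \<Longrightarrow> cell q D N j (\<phi> \<omega>) = v" using c(1) by blast+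
  show "\<omega> \<subseteq> S \<Longrightarrow> \<omega>' \<subseteq> S \<Longrightarrow> j \<le> i \<Longrightarrow> i \<le> N \<Longrightarrow> \<omega> \<inter> {..<i} = \<omega>' \<inter> {..<i} \<Longrightarrow>
       cell q D N i (\<phi> \<omega>) = cell q D N i (\<phi> \<omega>')" 
    using c(2)[rule_format, of \<omega> \<omega>' i] by simp
  show "\<omega> \<subseteq> S \<Longrightarrow> \<omega>' \<subseteq> S \<Longrightarrow> i \<in> S \<Longrightarrow> \<omega> \<inter> {..<i} = \<omega>' \<inter> {..<i} \<Longrightarrow> i \<notin> \<omega> \<Longrightarrow> i \<in> \<omega>' \<Longrightarrow>
       cell q D N (Suc i) (\<phi> \<omega>) + 2 \<le> cell q D N (Suc i) (\<phi> \<omega>')"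
    by (rule c(3)[rule_format])
qed

lemma shatters_leaf: "v \<in> cell q D N N ` B \<Longrightarrow> shatters q D N B N {} v"
proof -
  assume "v \<in> cell q D N N ` B"
  then obtain b where "b \<in> B" "v = cell q D N N b" by auto
  hence "binary_coding q D N B N {} v (\<lambda>_. b)" by (simp add: binary_coding_def)
  thus ?thesis by (auto simp: shatters_def)
qed

lemma shatters_step:
  assumes sh: "shatters q D N B (Suc j) S w" and j: "j < N" and S: "S \<subseteq> {Suc j..<N}"
  shows "shatters q D N B j S (w div D)"
proof -
  obtain \<phi> where \<phi>: "binary_coding q D N B (Suc j) S w \<phi>" using sh by (auto simp: shatters_def)
  have c: "cell q D N j (\<phi> \<omega>) = w div D" if "\<omega> \<subseteq> S" for \<omega>
    using binary_codingD(2)[OF \<phi> that] cell_div[of j "Suc j" N q D "\<phi> \<omega>"] j by simp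
  have "binary_coding q D N B j S (w div D) \<phi>"
    unfolding binary_coding_def
  proof (intro conjI allI impI ballI)
    fix \<omega> assume "\<omega> \<subseteq> S" thus "\<phi> \<omega> \<in> B" "cell q D N j (\<phi> \<omega>) = w div D"
      using binary_codingD(1)[OF \<phi>] c by blast+
  next
    fix \<omega> \<omega>' i assume *: "\<omega> \<subseteq> S" "\<omega>' \<subseteq> S" "i \<in> {j..N}" "\<omega> \<inter> {..<i} = \<omega>' \<inter> {..<i}"
    show "cell q D N i (\<phi> \<omega>) = cell q D N i (\<phi> \<omega>')"
    proof (cases "i = j")
      case True thus ?thesis using c * by simp
    next
      case False hence "i \<in> {Suc j..N}" using * by auto
      thus ?thesis using binary_codingD(3)[OF \<phi> *(1,2) _ _ *(4)] by simp
    qed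
  next
    fix \<omega> \<omega>' i assume *: "\<omega> \<subseteq> S" "\<omega>' \<subseteq> S" "i \<in> S" "\<omega> \<inter> {..<i} = \<omega>' \<inter> {..<i}" "i \<notin> \<omega>" "i \<in> \<omega>'"
    show "cell q D N (Suc i) (\<phi> \<omega>) + 2 \<le> cell q D N (Suc i) (\<phi> \<omega>')"
      by (rule binary_codingD(4)[OF \<phi> *])
  qed
  thus ?thesis by (auto simp: shatters_def)
qed

text \<open>Bit \<open>j\<close> selects the child, and the other bits are handed to the coding of
  that child. Both children must shatter the same \<open>S\<close>; this is why the count below is
  kept separately for every candidate set.\<close>

lemma shatters_branch:
  assumes sh: "shatters q D N B (Suc j) S w" "shatters q D N B (Suc j) S w'"
    and w: "w div D = v" "w' div D = v" "w + 2 \<le> w'"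
    and j: "j < N" and S: "S \<subseteq> {Suc j..<N}"
  shows "shatters q D N B j (insert j S) v"
proof -
  obtain \<phi> where \<phi>: "binary_coding q D N B (Suc j) S w \<phi>" using sh by (auto simp: shatters_def)
  obtain \<phi>' where \<phi>': "binary_coding q D N B (Suc j) S w' \<phi>'" using sh by (auto simp: shatters_def)
  define \<psi> where "\<psi> \<omega> = (if j \<in> \<omega> then \<phi>' (\<omega> - {j}) else \<phi> \<omega>)" for \<omega>
  have jS: "j \<notin> S" using S by auto
  have wc: "\<psi> \<omega> \<in> B \<and> cell q D N (Suc j) (\<psi> \<omega>) = (if j \<in> \<omega> then w' else w)" if "\<omega> \<subseteq> insert j S" for \<omega>
  proof -
    have "j \<notin> \<omega> \<Longrightarrow> \<omega> \<subseteq> S" "\<omega> - {j} \<subseteq> S" using that by auto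
    thus ?thesis using binary_codingD(1,2)[OF \<phi>, of \<omega>] binary_codingD(1,2)[OF \<phi>', of "\<omega> - {j}"]
      by (simp add: \<psi>_def)
  qed
  have c: "cell q D N j (\<psi> \<omega>) = v" if "\<omega> \<subseteq> insert j S" for \<omega>
    using wc[OF that] cell_div[of j "Suc j" N q D "\<psi> \<omega>"] j w by (simp split: if_splits)
  have "binary_coding q D N B j (insert j S) v \<psi>"
    unfolding binary_coding_def
  proof (intro conjI allI impI ballI)
    fix \<omega> assume "\<omega> \<subseteq> insert j S" thus "\<psi> \<omega> \<in> B" "cell q D N j (\<psi> \<omega>) = v"
      using wc c by blast+
  next
    fix \<omega> \<omega>' i assume *: "\<omega> \<subseteq> insert j S" "\<omega>' \<subseteq> insert j S" "i \<in> {j..N}" "\<omega> \<inter> {..<i} = \<omega>' \<inter> {..<i}"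
    show "cell q D N i (\<psi> \<omega>) = cell q D N i (\<psi> \<omega>')"
    proof (cases "i = j")
      case True thus ?thesis using c * by simp
    next
      case False hence i: "i \<in> {Suc j..N}" using * by auto
      hence same: "j \<in> \<omega> \<longleftrightarrow> j \<in> \<omega>'" using *(4) by (metis Int_iff i lessThan_iff atLeastAtMost_iff Suc_le_lessD)
      have sub: "\<omega> - {j} \<subseteq> S" "\<omega>' - {j} \<subseteq> S" using * by auto
      have eq: "(\<omega> - {j}) \<inter> {..<i} = (\<omega>' - {j}) \<inter> {..<i}" using *(4) by blast
      show ?thesis
      proof (cases "j \<in> \<omega>")
        case True
        thus ?thesis using binary_codingD(3)[OF \<phi>' sub _ _ eq] i same by (simp add: \<psi>_def)
      next
        case False
        hence "\<omega> - {j} = \<omega>" "\<omega>' - {j} = \<omega>'" using same by auto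
        thus ?thesis using binary_codingD(3)[OF \<phi> sub _ _ eq] i same False by (simp add: \<psi>_def)
      qed
    qed
  next
    fix \<omega> \<omega>' i assume *: "\<omega> \<subseteq> insert j S" "\<omega>' \<subseteq> insert j S" "i \<in> insert j S" "\<omega> \<inter> {..<i} = \<omega>' \<inter> {..<i}" "i \<notin> \<omega>" "i \<in> \<omega>'"
    show "cell q D N (Suc i) (\<psi> \<omega>) + 2 \<le> cell q D N (Suc i) (\<psi> \<omega>')"
    proof (cases "i = j")
      case True
      thus ?thesis using wc[OF *(1)] wc[OF *(2)] *(5,6) w by simp
    next
      case False
      hence i: "i \<in> S" "j < i" using * S by auto
      hence same: "j \<in> \<omega> \<longleftrightarrow> j \<in> \<omega>'" using *(4) by (metis Int_iff i(2) lessThan_iff)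
      have sub: "\<omega> - {j} \<subseteq> S" "\<omega>' - {j} \<subseteq> S" using * by auto
      have eq: "(\<omega> - {j}) \<inter> {..<i} = (\<omega>' - {j}) \<inter> {..<i}" "i \<notin> \<omega> - {j}" "i \<in> \<omega>' - {j}" using *(4,5,6) False by blast+
      show ?thesis
      proof (cases "j \<in> \<omega>")
        case True
        thus ?thesis using binary_codingD(4)[OF \<phi>' sub i(1) eq] same by (simp add: \<psi>_def)
      next
        case False
        hence "\<omega> - {j} = \<omega>" "\<omega>' - {j} = \<omega>'" using same by auto
        thus ?thesis using binary_codingD(4)[OF \<phi> sub i(1) eq] same False by (simp add: \<psi>_def)
      qed
    qed
  qed
  thus ?thesis by (auto simp: shatters_def)
qed

lemma sum_Pow_insert:
  assumes "finite A" "x \<notin> A"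
  shows "(\<Sum>R\<in>Pow (insert x A). F R) = (\<Sum>R\<in>Pow A. F R + F (insert x R))"
proof -
  have "inj_on (insert x) (Pow A)" using assms(2) by (auto simp: inj_on_def)
  moreover have "Pow A \<inter> insert x ` Pow A = {}" using assms(2) by auto
  ultimately show ?thesis
    unfolding Pow_insert using assms(1)
    by (subst sum.union_disjoint) (auto simp: sum.reindex sum.distrib)
qed

text \<open>
  The analogue for trees of Pajor's form of the Sauer--Shelah lemma. If \<open>R\<close> is shattered by \<open>a\<close> children
  of a node, then the node shatters \<open>R\<close>, and also \<open>insert j R\<close> once \<open>a > 2\<close>, because then two of the
  children are not adjacent; in either case the contribution \<open>a\<close> is paid for by \<open>2 + D\<close>.
\<close>

lemma card_le_sum_shattered:
  assumes V: "finite V" "\<And>v'. v' \<in> V \<Longrightarrow> shatters q D N B t S' v'"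
    and t: "t \<le> N" and S': "S' \<subseteq> {t..<N}" and D: "D > 0"
  shows "h \<le> t \<Longrightarrow> card {v'\<in>V. v' div D ^ h = v} \<le>
     (\<Sum>R\<in>Pow {t-h..<t}. if shatters q D N B (t - h) (R \<union> S') v then 2 ^ (h - card R) * D ^ card R else 0)"
proof (induction h arbitrary: v)
  case 0
  show ?case
  proof (cases "v \<in> V")
    case True
    hence "{v'\<in>V. v' = v} = {v}" by auto
    then show ?thesis using V(2)[OF True] by simp
  next
    case False
    hence "{v'\<in>V. v' div D ^ 0 = v} = {}" by auto
    thus ?thesis by (simp only: card.empty)
  qed
next
  case (Suc h)
  define j where "j = t - Suc h"
  have j: "t - h = Suc j" "j < N" using Suc.prems t by (auto simp: j_def)
  have jI: "{j..<t} = insert j {Suc j..<t}" using Suc.prems by (auto simp: j_def)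
  define ch where "ch = {v * D..<v * D + D}"
  have ch: "w \<in> ch \<longleftrightarrow> w div D = v" for w
  proof
    assume "w \<in> ch" thus "w div D = v" by (intro div_nat_eqI) (auto simp: ch_def mult.commute)
  next
    assume "w div D = v"
    thus "w \<in> ch" using D dividend_less_div_times[OF D, of w] div_times_less_eq_dividend[of w D]
      by (auto simp: ch_def)
  qed
  define wt where "wt R = 2 ^ (h - card R) * D ^ card R" for R :: "nat set"
  define Sh where "Sh = shatters q D N B"
  have "{v'\<in>V. v' div D ^ Suc h = v} = (\<Union>w\<in>ch. {v'\<in>V. v' div D ^ h = w})"
    by (auto simp: ch div_mult2_eq power_Suc2 simp del: power_Suc)
  hence "card {v'\<in>V. v' div D ^ Suc h = v} \<le> (\<Sum>w\<in>ch. card {v'\<in>V. v' div D ^ h = w})"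
    using card_UN_le[of ch "\<lambda>w. {v'\<in>V. v' div D ^ h = w}"] by (simp add: ch_def)
  also have "\<dots> \<le> (\<Sum>w\<in>ch. \<Sum>R\<in>Pow {Suc j..<t}. if Sh (Suc j) (R \<union> S') w then wt R else 0)"
    using Suc.IH Suc.prems unfolding j(1) wt_def Sh_def by (intro sum_mono) (simp only: Suc_leD)
  also have "\<dots> = (\<Sum>R\<in>Pow {Suc j..<t}. \<Sum>w\<in>ch. if Sh (Suc j) (R \<union> S') w then wt R else 0)"
    by (rule sum.swap)
  also have "\<dots> = (\<Sum>R\<in>Pow {Suc j..<t}. card {w\<in>ch. Sh (Suc j) (R \<union> S') w} * wt R)"
    by (intro sum.cong refl, subst sum.inter_filter[symmetric]) (auto simp: ch_def)
  also have "\<dots> \<le> (\<Sum>R\<in>Pow {Suc j..<t}.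
      (if Sh j (R \<union> S') v then 2 * wt R else 0) + (if Sh j (insert j R \<union> S') v then D * wt R else 0))"
  proof (intro sum_mono)
    fix R assume R: "R \<in> Pow {Suc j..<t}"
    define A where "A = {w\<in>ch. Sh (Suc j) (R \<union> S') w}"
    have finA: "finite A" by (auto simp: A_def ch_def)
    have "A \<subseteq> ch" by (auto simp: A_def)
    hence "card A \<le> card ch" by (intro card_mono) (simp_all add: ch_def)
    hence cA: "card A \<le> D" by (simp add: ch_def)
    have memA: "w div D = v" "shatters q D N B (Suc j) (R \<union> S') w" if "w \<in> A" for w
      using that ch[of w] by (simp_all add: A_def Sh_def)
    have RS: "R \<union> S' \<subseteq> {Suc j..<N}" 
    proof -
      have "R \<subseteq> {Suc j..<t}" "Suc j \<le> t" using R Suc.prems by (auto simp: j_def)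
      thus ?thesis using S' t by (auto dest: subsetD)
    qed
    have step: "Sh j (R \<union> S') v" if nonempty: "A \<noteq> {}"
    proof -
      obtain w where w: "w \<in> A" using nonempty by auto
      show ?thesis using shatters_step[OF memA(2)[OF w] j(2) RS] memA(1)[OF w] by (simp add: Sh_def)
    qed
    have branch: "Sh j (insert j R \<union> S') v" if "card A > 2"
    proof -
      have ne: "A \<noteq> {}" using that by auto
      have mm: "Min A \<in> A" "Max A \<in> A" using ne finA by auto
      have "\<not> Max A < Min A + 2"
      proof
        assume "Max A < Min A + 2"
        hence "A \<subseteq> {Min A, Min A + 1}"
          using Min_le[OF finA] Max_ge[OF finA] by fastforce
        hence "card A \<le> card {Min A, Min A + 1}" by (intro card_mono) auto
        thus False using that by simp
      qed
      hence "Min A + 2 \<le> Max A" by simp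
      thus ?thesis
        using shatters_branch[OF memA(2)[OF mm(1)] memA(2)[OF mm(2)] memA(1)[OF mm(1)] memA(1)[OF mm(2)] _ j(2) RS]
        by (simp add: Sh_def)
    qed
    show "card {w\<in>ch. Sh (Suc j) (R \<union> S') w} * wt R \<le>
      (if Sh j (R \<union> S') v then 2 * wt R else 0) + (if Sh j (insert j R \<union> S') v then D * wt R else 0)"
    proof (cases "card A > 2")
      case True
      have "card A * wt R \<le> D * wt R" using cA by simp
      thus ?thesis unfolding A_def[symmetric] if_P[OF branch[OF True]] by (rule trans_le_add2)
    next
      case False
      hence le: "card A * wt R \<le> 2 * wt R" by (intro mult_right_mono) auto
      show ?thesis
      proof (cases "A = {}")
        case True
        thus ?thesis unfolding A_def[symmetric] by simp
      next
        case False
        show ?thesis unfolding A_def[symmetric] if_P[OF step[OF False]] by (rule trans_le_add1[OF le])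
      qed
    qed
  qed
  also have "\<dots> = (\<Sum>R\<in>Pow {Suc j..<t}.
      (if Sh j (R \<union> S') v then 2 ^ (Suc h - card R) * D ^ card R else 0) +
      (if Sh j (insert j R \<union> S') v then 2 ^ (Suc h - card (insert j R)) * D ^ card (insert j R) else 0))"
  proof (intro sum.cong refl)
    fix R assume R: "R \<in> Pow {Suc j..<t}"
    have "card R \<le> card {Suc j..<t}" using R by (intro card_mono) auto
    hence cR: "card R \<le> h" using j(1) Suc.prems by auto
    have "R \<subseteq> {Suc j..<t}" using R by simp
    hence "finite R" "j \<notin> R" using finite_subset[of R "{Suc j..<t}"] by (simp, auto)
    hence ci: "card (insert j R) = Suc (card R)" by simp
    show "(if Sh j (R \<union> S') v then 2 * wt R else 0) + (if Sh j (insert j R \<union> S') v then D * wt R else 0) =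
      (if Sh j (R \<union> S') v then 2 ^ (Suc h - card R) * D ^ card R else 0) +
      (if Sh j (insert j R \<union> S') v then 2 ^ (Suc h - card (insert j R)) * D ^ card (insert j R) else 0)"
      unfolding ci wt_def using cR by (simp add: Suc_diff_le)
  qed
  also have "\<dots> = (\<Sum>R\<in>Pow {j..<t}. if Sh j (R \<union> S') v then 2 ^ (Suc h - card R) * D ^ card R else 0)"
    unfolding jI by (subst sum_Pow_insert) auto
  finally show ?case by (simp add: j_def Sh_def)
qed

text \<open>Take a shattered set of largest size. The sum has at most \<open>2 ^ h\<close> terms,
  each at most \<open>2 ^ h * D ^ card R\<close>, hence the factor \<open>4 ^ h\<close>.\<close>

lemma exists_shattered:
  assumes V: "finite V" "\<And>v'. v' \<in> V \<Longrightarrow> shatters q D N B t S' v'"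
    and t: "t \<le> N" and S': "S' \<subseteq> {t..<N}" and D: "D > 0" and h: "h \<le> t"
    and ne: "{v'\<in>V. v' div D ^ h = v} \<noteq> {}"
  obtains R where "R \<subseteq> {t-h..<t}" "shatters q D N B (t - h) (R \<union> S') v"
    "card {v'\<in>V. v' div D ^ h = v} \<le> 4 ^ h * D ^ card R"
proof -
  define F where "F = {R\<in>Pow {t-h..<t}. shatters q D N B (t - h) (R \<union> S') v}"
  have finF: "finite F" by (auto simp: F_def)
  have "card F \<le> card (Pow {t-h..<t})" by (intro card_mono) (auto simp: F_def)
  hence cF: "card F \<le> 2 ^ h" using h by (simp add: card_Pow)
  have sum: "card {v'\<in>V. v' div D ^ h = v} \<le> (\<Sum>R\<in>F. 2 ^ (h - card R) * D ^ card R)"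
    using card_le_sum_shattered[OF V t S' D h, of v] unfolding F_def by (subst sum.inter_filter) auto
  have "card {v'\<in>V. v' div D ^ h = v} > 0" using ne V(1) by (subst card_gt_0_iff) auto
  hence Fne: "F \<noteq> {}" using sum by auto
  have "Max (card ` F) \<in> card ` F" using finF Fne by (intro Max_in) auto
  then obtain R where R: "R \<in> F" "card R = Max (card ` F)" by auto
  hence Rmax: "card R' \<le> card R" if "R' \<in> F" for R' using finF that by simp
  have "(\<Sum>R\<in>F. 2 ^ (h - card R) * D ^ card R) \<le> (\<Sum>R'\<in>F. 2 ^ h * D ^ card R)"
    using Rmax D by (intro sum_mono mult_mono power_increasing) auto
  also have "\<dots> \<le> 2 ^ h * (2 ^ h * D ^ card R)" using cF by simp
  also have "\<dots> = 4 ^ h * D ^ card R" by (simp add: power_mult_distrib[symmetric])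
  finally show ?thesis using R(1) sum that[of R] by (auto simp: F_def)
qed

text \<open>Equality occurs at the right endpoint \<open>b = q * D ^ N\<close>, so there are
  \<open>D ^ j + 1\<close> cells at level \<open>j\<close> and two at the root.\<close>

lemma cell_le: "0 < q \<Longrightarrow> 0 < D \<Longrightarrow> j \<le> N \<Longrightarrow> b \<le> q * D ^ N \<Longrightarrow> cell q D N j b \<le> D ^ j"
proof -
  assume *: "0 < q" "0 < D" "j \<le> N" "b \<le> q * D ^ N"
  have "q * D ^ N = D ^ j * (q * D ^ (N - j))"
    using *(3) by (simp add: power_add[symmetric])
  hence "b div (q * D ^ (N - j)) \<le> D ^ j * (q * D ^ (N - j)) div (q * D ^ (N - j))"
    using *(4) \<open>q * D ^ N = _\<close> by (intro div_le_mono) metis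
  also have "\<dots> = D ^ j" using * by (intro nonzero_mult_div_cancel_right) auto
  finally show ?thesis by (simp add: cell_def)
qed

text \<open>
  Shattering is used below level \<open>t\<close> first, and then above \<open>t\<close> for the cells that share the most
  popular lower set \<open>S\<close>; this is what forces branching at the coarse levels.
\<close>

lemma exists_binary_coding:
  fixes \<theta> :: real
  assumes q: "0 < q" "q \<le> D" and D: "2 \<le> D" and t: "t \<le> N"
    and B: "B \<subseteq> {..q * D ^ N}" "B \<noteq> {}"
    and \<theta>: "\<And>v. card {b\<in>B. cell q D N t b = v} \<le> \<theta> * card B"
  obtains R S v \<phi> where "R \<subseteq> {..<t}" "S \<subseteq> {t..<N}" "binary_coding q D N B 0 (R \<union> S) v \<phi>"
    "1 \<le> \<theta> * (4 * 8 ^ N * D ^ card R)"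
    "card B \<le> 4 * D ^ Suc t * 4 ^ N * D ^ card S"
proof -
  have D0: "0 < D" using D by simp
  have finB: "finite B" using B(1) finite_subset by blast
  have cB: "card B > 0" using finB B(2) by (simp add: card_gt_0_iff)
  define W where "W = {..D ^ t}"
  define Bv where "Bv v = {b\<in>B. cell q D N t b = v}" for v
  have \<theta>': "real (card (Bv v)) \<le> \<theta> * card B" for v using \<theta> by (simp add: Bv_def)
  \<comment> \<open>The cells with at least half of the average share. The other cells hold at most
    half of \<open>B\<close>, so the bound \<theta> on a single cell forces
    \<open>1 \<le> 2 * \<theta> * card H\<close>.\<close>
  define H where "H = {v\<in>W. real (card B) \<le> 2 * (real D ^ t + 1) * card (Bv v)}"
  have finW: "finite W" and cW: "card W = D ^ t + 1" by (auto simp: W_def)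
  have finH: "finite H" using finW by (simp add: H_def)
  have cellW: "cell q D N t b \<in> W" if "b \<in> B" for b
    using that B(1) cell_le[OF q(1) D0 t] by (auto simp: W_def)
  have "B = (\<Union>v\<in>W. Bv v)" using cellW by (auto simp: Bv_def)
  hence "card B \<le> (\<Sum>v\<in>W. card (Bv v))" using card_UN_le[OF finW, of Bv] by simp
  hence "real (card B) \<le> (\<Sum>v\<in>W. real (card (Bv v)))" by (metis of_nat_le_iff of_nat_sum)
  also have "\<dots> \<le> (\<Sum>v\<in>W. (if v \<in> H then real (card (Bv v)) else 0) + card B / (2 * (real D ^ t + 1)))"
  proof (intro sum_mono)
    fix v assume v: "v \<in> W"
    have pos: "2 * (real D ^ t + 1) > 0" by (simp add: add_pos_nonneg add_nonneg_pos)
    show "real (card (Bv v)) \<le> (if v \<in> H then real (card (Bv v)) else 0) + card B / (2 * (real D ^ t + 1))"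
    proof (cases "v \<in> H")
      case True then show ?thesis using pos by simp
    next
      case False
      hence "2 * (real D ^ t + 1) * card (Bv v) \<le> card B" using v by (simp add: H_def)
      thus ?thesis using False pos by (simp add: field_simps)
    qed
  qed
  also have "\<dots> = (\<Sum>v\<in>H. real (card (Bv v))) + card W * (card B / (2 * (real D ^ t + 1)))"
    using finW by (simp add: sum.distrib sum.inter_filter[symmetric] H_def)
  also have "card W * (card B / (2 * (real D ^ t + 1))) = card B / 2"
  proof -
    have "real (card W) = real D ^ t + 1" by (simp add: cW)
    moreover have "real D ^ t + 1 > 0" by (simp add: add_nonneg_pos)
    ultimately show ?thesis by (simp add: field_simps)
  qed
  also have "(\<Sum>v\<in>H. real (card (Bv v))) \<le> card H * (\<theta> * card B)"
    using sum_mono[of H, OF \<theta>'] by simp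
  finally have "real (card B) * 1 \<le> real (card B) * (2 * \<theta> * card H)" by (simp add: field_simps)
  hence heavy: "1 \<le> 2 * \<theta> * card H" using cB by (subst (asm) mult_le_cancel_left_pos) auto
  have "0 \<le> \<theta> * card B" using \<theta>'[of 0] by linarith
  hence "\<theta> \<ge> 0" using cB by (simp add: zero_le_mult_iff)
  \<comment> \<open>\<open>exists_shattered\<close> is applied to the cells of level
    \<open>N\<close> inside the heavy cell \<open>v\<close>. Each of them holds at most
    \<open>q \<le> D\<close> points of \<open>B\<close>, which accounts for the extra power of
    \<open>D\<close>.\<close>
  have ex: "\<exists>S. S \<subseteq> {t..<N} \<and> shatters q D N B t S v \<and> card B \<le> 4 * D ^ Suc t * 4 ^ N * D ^ card S" if v: "v \<in> H" for v
  proof -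
    define V where "V = cell q D N N ` B"
    define U where "U = {v'\<in>V. v' div D ^ (N - t) = v}"
    have UBv: "U = cell q D N N ` Bv v"
      using cell_div[OF t order_refl, of q D] by (auto simp: U_def V_def Bv_def)
    have "real (card B) > 0" using cB by simp
    moreover have "real (card B) \<le> 2 * (real D ^ t + 1) * card (Bv v)" using v by (simp add: H_def)
    ultimately have "Bv v \<noteq> {}" by auto
    hence Une: "U \<noteq> {}" by (simp add: UBv)
    have finV: "finite V" using finB by (simp add: V_def)
    obtain S where S: "S \<subseteq> {N - (N - t)..<N}" "shatters q D N B (N - (N - t)) (S \<union> {}) v"
      "card U \<le> 4 ^ (N - t) * D ^ card S"
      unfolding U_def
      by (rule exists_shattered[OF finV _ order_refl _ D0, where S' = "{}" and h = "N - t" and v = v and q = q and B = B])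
         (use Une in \<open>auto simp: V_def U_def intro!: shatters_leaf\<close>)
    have NNt: "N - (N - t) = t" using t by simp
    have "card (Bv v) \<le> card U * q"
    proof -
      have "Bv v \<subseteq> (\<Union>u\<in>U. {u * q..<u * q + q})"
      proof
        fix b assume b: "b \<in> Bv v"
        have "cell q D N N b = b div q" by (simp add: cell_def)
        hence "b div q \<in> U" using b UBv by (metis imageI)
        moreover have "b \<in> {b div q * q..<b div q * q + q}"
          using dividend_less_div_times[OF q(1), of b] div_times_less_eq_dividend[of b q] by simp
        ultimately show "b \<in> (\<Union>u\<in>U. {u * q..<u * q + q})" by blast
      qed
      moreover have finU: "finite U" using finV by (simp add: U_def)
      ultimately have "card (Bv v) \<le> card (\<Union>u\<in>U. {u * q..<u * q + q})" by (intro card_mono) auto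
      also have "\<dots> \<le> (\<Sum>u\<in>U. card {u * q..<u * q + q})" by (rule card_UN_le[OF finU])
      finally show ?thesis by simp
    qed
    also have "\<dots> \<le> (4 ^ (N - t) * D ^ card S) * D" using S(3) q(2) by (intro mult_mono) auto
    also have "\<dots> \<le> (4 ^ N * D ^ card S) * D" by (intro mult_mono power_increasing) (use D0 in auto)
    finally have "real (card (Bv v)) \<le> real ((4 ^ N * D ^ card S) * D)" by (simp only: of_nat_le_iff)
    have "real (card B) \<le> 2 * (real D ^ t + 1) * card (Bv v)" using v by (simp add: H_def)
    also have "\<dots> \<le> 4 * real D ^ t * card (Bv v)"
      using D0 by (intro mult_right_mono) (auto simp: one_le_power)
    also have "\<dots> \<le> 4 * real D ^ t * ((4 ^ N * D ^ card S) * D)"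
      using \<open>real (card (Bv v)) \<le> real ((4 ^ N * D ^ card S) * D)\<close> by (intro mult_left_mono) auto
    also have "\<dots> = real (4 * D ^ Suc t * 4 ^ N * D ^ card S)" by simp
    finally have "card B \<le> 4 * D ^ Suc t * 4 ^ N * D ^ card S" by (simp only: of_nat_le_iff)
    thus ?thesis using S NNt by auto
  qed
  define Sf where "Sf v = (SOME S. S \<subseteq> {t..<N} \<and> shatters q D N B t S v \<and> card B \<le> 4 * D ^ Suc t * 4 ^ N * D ^ card S)" for v
  have Sf: "Sf v \<subseteq> {t..<N}" "shatters q D N B t (Sf v) v" "card B \<le> 4 * D ^ Suc t * 4 ^ N * D ^ card (Sf v)"
    if "v \<in> H" for v
    using someI_ex[OF ex[OF that]] by (auto simp: Sf_def)
  have cH: "card H > 0" using heavy \<open>\<theta> \<ge> 0\<close> by (cases "card H = 0") auto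
  \<comment> \<open>The sets \<open>Sf v\<close> vary with \<open>v\<close>, but the codings can be
    joined above level \<open>t\<close> only if the lower set is the same. The most popular pair
    loses a factor of at most \<open>2 ^ N * 2\<close>. The second component is the root cell, which
    is 1 only for the right endpoint.\<close>
  define G where "G = (\<lambda>v. (Sf v, v div D ^ t)) ` H"
  have G: "G \<subseteq> Pow {t..<N} \<times> {0, 1}"
  proof -
    have "v div D ^ t \<in> {0, 1}" if "v \<in> H" for v
    proof -
      have "v div D ^ t \<le> D ^ t div D ^ t" using that by (intro div_le_mono) (auto simp: H_def W_def)
      also have "\<dots> \<le> 1" using D0 by simp
      finally show ?thesis by auto
    qed
    hence "(Sf v, v div D ^ t) \<in> Pow {t..<N} \<times> {0, 1}" if "v \<in> H" for v
      using Sf(1)[OF that] that by blast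
    thus ?thesis unfolding G_def by (rule image_subsetI)
  qed
  have finG: "finite G" using finH by (simp add: G_def)
  have "card G \<le> card (Pow {t..<N} \<times> {0::nat, 1})" by (rule card_mono[OF _ G]) simp
  also have "\<dots> = 2 ^ (N - t) * 2" by (simp add: card_cartesian_product card_Pow)
  also have "\<dots> \<le> 2 ^ N * 2" by (intro mult_mono power_increasing) (use D0 in auto)
  finally have cG: "card G \<le> 2 ^ N * 2" .
  obtain g where g: "g \<in> G" "card H \<le> card G * card {v\<in>H. (Sf v, v div D ^ t) = g}"
  proof -
    have "\<exists>g\<in>G. card H \<le> card G * card {v\<in>H. (Sf v, v div D ^ t) = g}"
    proof (rule ccontr)
      assume "\<not> ?thesis"
      hence lt: "card G * card {v\<in>H. (Sf v, v div D ^ t) = g} < card H" if "g \<in> G" for g using that by auto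
      have Gne: "G \<noteq> {}" using cH by (auto simp: G_def)
      have "card G * card H = card G * (\<Sum>g\<in>G. card {v\<in>H. (Sf v, v div D ^ t) = g})"
      proof -
        have "card H = (\<Sum>v\<in>H. 1)" by simp
        also have "\<dots> = (\<Sum>g\<in>G. \<Sum>v\<in>{v\<in>H. (Sf v, v div D ^ t) = g}. 1)"
          unfolding G_def by (rule sum.image_gen[OF finH])
        finally show ?thesis by simp
      qed
      also have "\<dots> = (\<Sum>g\<in>G. card G * card {v\<in>H. (Sf v, v div D ^ t) = g})" by (simp add: sum_distrib_left)
      also have "\<dots> < (\<Sum>g\<in>G. card H)" using lt finG Gne by (intro sum_strict_mono) auto
      finally show False by simp
    qed
    thus ?thesis using that by blast
  qed
  obtain S w where Sw: "g = (S, w)" by (cases g)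
  define V where "V = {v\<in>H. Sf v = S}"
  have Vw: "{v\<in>H. (Sf v, v div D ^ t) = g} = {v'\<in>V. v' div D ^ t = w}" by (auto simp: V_def Sw)
  have cV: "card H \<le> (2 ^ N * 2) * card {v'\<in>V. v' div D ^ t = w}"
    using g(2) cG unfolding Vw by (meson mult_le_mono1 order_trans)
  hence Vne: "{v'\<in>V. v' div D ^ t = w} \<noteq> {}" using cH by (intro notI) simp
  then obtain v1 where v1: "v1 \<in> H" "Sf v1 = S" by (auto simp: V_def)
  have finV: "finite V" using finH by (simp add: V_def)
  have shV: "shatters q D N B t S v'" if "v' \<in> V" for v' using Sf(2)[of v'] that by (simp add: V_def)
  have S1: "S \<subseteq> {t..<N}" using Sf(1) v1 by auto
  obtain R where R: "R \<subseteq> {t - t..<t}" "shatters q D N B (t - t) (R \<union> S) w"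
    "card {v'\<in>V. v' div D ^ t = w} \<le> 4 ^ t * D ^ card R"
    by (rule exists_shattered[OF finV shV t S1 D0 order_refl Vne])
  obtain \<phi> where \<phi>: "binary_coding q D N B 0 (R \<union> S) w \<phi>" using R(2) by (auto simp: shatters_def)
  have "card H \<le> (2 ^ N * 2) * (4 ^ t * D ^ card R)"
    using cV R(3) by (meson mult_le_mono2 order_trans)
  also have "\<dots> \<le> (2 ^ N * 2) * (4 ^ N * D ^ card R)" by (intro mult_mono power_increasing) (use D0 t in auto)
  also have "\<dots> = 2 * ((2 * 4) ^ N * D ^ card R)" unfolding power_mult_distrib by simp
  finally have "real (card H) \<le> real (2 * (8 ^ N * D ^ card R))" by (simp only: of_nat_le_iff) simp
  hence "2 * \<theta> * card H \<le> 2 * \<theta> * real (2 * (8 ^ N * D ^ card R))"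
    using \<open>\<theta> \<ge> 0\<close> by (intro mult_left_mono) auto
  hence "1 \<le> 2 * \<theta> * real (2 * (8 ^ N * D ^ card R))" using heavy by linarith
  also have "\<dots> = \<theta> * (4 * 8 ^ N * D ^ card R)" by simp
  finally have "1 \<le> \<theta> * (4 * 8 ^ N * D ^ card R)" .
  moreover have "card B \<le> 4 * D ^ Suc t * 4 ^ N * D ^ card S" using Sf(3)[OF v1(1)] v1(2) by simp
  moreover have "R \<subseteq> {..<t}" using R(1) by auto
  ultimately show ?thesis using S1 \<phi> by (intro that[of R S w \<phi>]) simp_all
qed

section \<open>Windows of scales\<close>

text \<open>Density at least \<open>1 / Q\<close> on every initial stretch after \<open>t\<close>,
  and not just in total, because \<open>D_power_le\<close> uses it at every depth of a window. The
  case \<open>v = Suc t\<close> puts \<open>t\<close> itself into \<open>S\<close>.\<close>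

definition forward_dense :: "nat \<Rightarrow> nat \<Rightarrow> nat set \<Rightarrow> nat \<Rightarrow> bool"
  where "forward_dense Q N S t \<longleftrightarrow> t \<le> N \<and> (\<forall>v\<in>{t..N}. v - t \<le> Q * card (S \<inter> {t..<v}))"

lemma card_Int_atLeastLessThan_add:
  assumes "a \<le> b" "b \<le> (c::nat)"
  shows "card (S \<inter> {a..<c}) = card (S \<inter> {a..<b}) + card (S \<inter> {b..<c})"
proof -
  have "S \<inter> {a..<c} = (S \<inter> {a..<b}) \<union> (S \<inter> {b..<c})" using assms by auto
  thus ?thesis by (simp add: card_Un_disjoint disjoint_iff)
qed

lemma forward_dense_mem:
  assumes "forward_dense Q N S t" "t < N"
  shows "t \<in> S"
proof (rule ccontr)
  assume "t \<notin> S"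
  hence "S \<inter> {t..<Suc t} = {}" by auto
  moreover have "Suc t - t \<le> Q * card (S \<inter> {t..<Suc t})"
    using assms unfolding forward_dense_def by (metis Suc_leI atLeastAtMost_iff le_SucI order_refl)
  ultimately show False by simp
qed

text \<open>As long as \<open>t\<close> fails, jump to a \<open>v\<close> that witnesses the
  failure. The stretches jumped over have density at most \<open>1 / Q\<close>, so few elements of
  \<open>S\<close> are lost with them.\<close>

lemma next_forward_dense:
  assumes "t \<le> N"
  obtains t' where "t \<le> t'" "forward_dense Q N S t'" "Q * card (S \<inter> {t..<t'}) \<le> t' - t"
proof -
  have "\<exists>t'\<ge>t. forward_dense Q N S t' \<and> Q * card (S \<inter> {t..<t'}) \<le> t' - t"
    using assms
  proof (induction "N - t" arbitrary: t rule: less_induct)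
    case less
    show ?case
    proof (cases "forward_dense Q N S t")
      case True
      then show ?thesis by (intro exI[of _ t]) auto
    next
      case False
      then obtain v where v: "t \<le> v" "v \<le> N" "Q * card (S \<inter> {t..<v}) < v - t"
        using less.prems by (auto simp: forward_dense_def not_le)
      hence "N - v < N - t" by linarith
      from less.hyps[OF this v(2)] obtain t' where t': "v \<le> t'" "forward_dense Q N S t'"
        "Q * card (S \<inter> {v..<t'}) \<le> t' - v"
        by auto
      have "Q * card (S \<inter> {t..<t'}) = Q * card (S \<inter> {t..<v}) + Q * card (S \<inter> {v..<t'})"
        using card_Int_atLeastLessThan_add[OF v(1) t'(1), of S] by (simp add: algebra_simps)
      also have "\<dots> \<le> (v - t) + (t' - v)" using v(3) t'(3) by linarith
      also have "\<dots> = t' - t" using v(1) t'(1) by simp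
      finally show ?thesis using t' v(1) by (intro exI[of _ t']) auto
    qed
  qed
  thus ?thesis using that by blast
qed

text \<open>A window consists of \<open>K\<close> scales and of what
  \<open>next_forward_dense\<close> then skips. So it contains at most \<open>K\<close> elements of
  \<open>S\<close> plus a proportion \<open>1 / Q\<close> of its length, which matters because the
  final count credits it with \<open>K\<close> full scales, however many elements of
  \<open>S\<close> it has.\<close>

lemma exists_windows:
  assumes K: "0 < K" and t: "forward_dense Q N S t"
  obtains P and \<tau> :: "nat \<Rightarrow> nat" where "\<tau> 0 = t"
    "\<And>p. p \<le> P \<Longrightarrow> forward_dense Q N S (\<tau> p)"
    "\<And>p. p < P \<Longrightarrow> \<tau> p + K \<le> \<tau> (Suc p)"
    "\<And>p. p < P \<Longrightarrow> Q * card (S \<inter> {\<tau> p..<\<tau> (Suc p)}) \<le> Q * K + (\<tau> (Suc p) - \<tau> p)"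
    "N < \<tau> P + K"
proof -
  have "\<exists>P \<tau>. \<tau> 0 = t \<and> (\<forall>p\<le>P. forward_dense Q N S (\<tau> p)) \<and> (\<forall>p<P. \<tau> p + K \<le> \<tau> (Suc p)) \<and>
    (\<forall>p<P. Q * card (S \<inter> {\<tau> p..<\<tau> (Suc p)}) \<le> Q * K + (\<tau> (Suc p) - \<tau> p)) \<and> N < \<tau> P + K"
    using t
  proof (induction "N - t" arbitrary: t rule: less_induct)
    case less
    show ?case
    proof (cases "N < t + K")
      case True
      then show ?thesis using less.prems by (intro exI[of _ 0] exI[of _ "\<lambda>_. t"]) auto
    next
      case False
      then obtain t' where t': "t + K \<le> t'" "forward_dense Q N S t'" "Q * card (S \<inter> {t+K..<t'}) \<le> t' - (t + K)"
        using next_forward_dense[of "t + K" N Q S] by auto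
      have t'N: "t' \<le> N" using t'(2) by (simp add: forward_dense_def)
      have "N - t' < N - t" using t'(1) t'N K by linarith
      from less.hyps[OF this t'(2)] obtain P \<tau> where \<tau>: "\<tau> 0 = t'" "\<forall>p\<le>P. forward_dense Q N S (\<tau> p)"
        "\<forall>p<P. \<tau> p + K \<le> \<tau> (Suc p)"
        "\<forall>p<P. Q * card (S \<inter> {\<tau> p..<\<tau> (Suc p)}) \<le> Q * K + (\<tau> (Suc p) - \<tau> p)" "N < \<tau> P + K" 
        by blast
      define \<sigma> where "\<sigma> p = (case p of 0 \<Rightarrow> t | Suc p \<Rightarrow> \<tau> p)" for p
      have "card (S \<inter> {t..<t+K}) \<le> card {t..<t+K}" by (intro card_mono) auto
      hence "Q * card (S \<inter> {t..<t+K}) \<le> Q * K" by (intro mult_le_mono2) simp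
      moreover have "Q * card (S \<inter> {t..<t'}) = Q * card (S \<inter> {t..<t+K}) + Q * card (S \<inter> {t+K..<t'})"
        using card_Int_atLeastLessThan_add[of t "t+K" t' S] t'(1) by (simp add: algebra_simps)
      ultimately have first: "Q * card (S \<inter> {t..<t'}) \<le> Q * K + (t' - t)" using t'(3) by linarith
      have "\<sigma> 0 = t" by (simp add: \<sigma>_def)
      moreover have "\<forall>p\<le>Suc P. forward_dense Q N S (\<sigma> p)"
        using \<tau>(2) less.prems by (auto simp: \<sigma>_def split: nat.splits)
      moreover have "\<forall>p<Suc P. \<sigma> p + K \<le> \<sigma> (Suc p)"
        using \<tau>(1,3) t'(1) by (auto simp: \<sigma>_def split: nat.splits)
      moreover have "\<forall>p<Suc P. Q * card (S \<inter> {\<sigma> p..<\<sigma> (Suc p)}) \<le> Q * K + (\<sigma> (Suc p) - \<sigma> p)"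
        using \<tau>(1,4) first by (auto simp: \<sigma>_def split: nat.splits)
      moreover have "N < \<sigma> (Suc P) + K" using \<tau>(5) by (simp add: \<sigma>_def)
      ultimately show ?thesis by (intro exI[of _ "Suc P"] exI[of _ \<sigma>]) blast
    qed
  qed
  thus ?thesis using that by blast
qed

section \<open>Discretising the measure\<close>

text \<open>The complement of the support is a union of open null sets, and by the Lindelof property
  countably many of them suffice.\<close>

lemma null_set_compl_spt:
  fixes \<nu> :: "'a::second_countable_topology measure"
  assumes "sets \<nu> = sets borel"
  shows "- spt \<nu> \<in> null_sets \<nu>"
proof -
  define F where "F = {U. open U \<and> emeasure \<nu> U = 0}"
  obtain F' where F': "F' \<subseteq> F" "countable F'" "\<Union>F' = \<Union>F"
    using Lindelof[of F] by (auto simp: F_def)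
  have "\<Union>F = - spt \<nu>" by (auto simp: F_def spt_def not_less)
  moreover have "\<Union>F' \<in> null_sets \<nu>"
    using F' assms by (intro null_sets_UN'[of F' "\<lambda>x. x", simplified]) (auto simp: F_def null_sets_def)
  ultimately show ?thesis using F'(3) by simp
qed

text \<open>Each \<delta>-interval of positive mass meets the support, and its mass is moved to a
  point chosen there. For \<open>r \<ge> \<delta>\<close> the intervals whose points lie within
  \<open>r\<close> of \<open>x\<close> are contained in the ball of radius \<open>2 * r\<close>, and
  \<open>2 powr \<gamma> \<le> 2\<close> turns 20 into 40. The averages over coefficients become
  finite sums over points of the support itself.\<close>

lemma frostman_discretization:
  fixes \<nu> :: "real measure"
  assumes prob: "prob_space \<nu>" and sets: "sets \<nu> = sets borel" and spt: "spt \<nu> \<subseteq> {-1..1}"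
    and \<delta>: "\<delta> > 0" and \<gamma>: "0 < \<gamma>" "\<gamma> \<le> 1"
    and fr: "\<And>x r. r \<ge> \<delta> \<Longrightarrow> measure \<nu> (ball x r) \<le> 20 * r powr \<gamma>"
  obtains C w where "finite C" "C \<subseteq> spt \<nu>" "\<And>c. c \<in> C \<Longrightarrow> (w c :: real) \<ge> 0" "sum w C = 1"
    "\<And>x r. r \<ge> \<delta> \<Longrightarrow> sum w {c\<in>C. \<bar>c - x\<bar> \<le> r} \<le> 40 * r powr \<gamma>"
proof -
  interpret prob_space \<nu> by (rule prob)
  have null: "- spt \<nu> \<in> null_sets \<nu>" by (rule null_set_compl_spt[OF sets])
  define I where "I k = {real_of_int k * \<delta> ..< (real_of_int k + 1) * \<delta>}" for k
  have sI: "I k \<in> sets \<nu>" for k by (simp add: I_def sets)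
  have memI: "y \<in> I k \<longleftrightarrow> \<lfloor>y / \<delta>\<rfloor> = k" for y k
    using \<delta> by (auto simp: I_def floor_eq_iff field_simps)
  define M where "M = \<lceil>1 / \<delta>\<rceil> + 1"
  define J where "J = {k\<in>{-M..M}. measure \<nu> (I k) > 0}"
  have finJ: "finite J" unfolding J_def by (rule finite_subset[of _ "{-M..M}"]) auto
  have "\<exists>c. c \<in> spt \<nu> \<inter> I k" if "k \<in> J" for k
  proof (rule ccontr)
    assume "\<nexists>c. c \<in> spt \<nu> \<inter> I k"
    hence "I k \<subseteq> - spt \<nu>" by auto
    hence "I k \<in> null_sets \<nu>" using null sI by (meson null_sets_subset)
    hence "measure \<nu> (I k) = 0" by (simp add: measure_def null_sets_def)
    thus False using that by (simp add: J_def)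
  qed
  then obtain c where c: "\<And>k. k \<in> J \<Longrightarrow> c k \<in> spt \<nu> \<inter> I k" by metis
  have fl: "\<lfloor>c k / \<delta>\<rfloor> = k" if "k \<in> J" for k using c[OF that] memI by auto
  have inj: "inj_on c J" by (rule inj_on_inverseI[of _ "\<lambda>y. \<lfloor>y / \<delta>\<rfloor>"]) (rule fl)
  define w where "w y = measure \<nu> (I \<lfloor>y / \<delta>\<rfloor>)" for y
  have disj: "disjoint_family_on I A" for A
    by (auto simp: disjoint_family_on_def memI)
  have sumI: "measure \<nu> (\<Union>k\<in>A. I k) = (\<Sum>k\<in>A. measure \<nu> (I k))" if "finite A" for A
    using that sI disj by (intro finite_measure_finite_Union) auto
  show ?thesis
  proof
    show "finite (c ` J)" "c ` J \<subseteq> spt \<nu>" using finJ c by auto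
    show "w y \<ge> 0" for y by (simp add: w_def)
    have "sum w (c ` J) = (\<Sum>k\<in>J. measure \<nu> (I k))"
      by (subst sum.reindex[OF inj]) (simp add: w_def fl)
    also have "\<dots> = (\<Sum>k\<in>{-M..M}. measure \<nu> (I k))"
      by (intro sum.mono_neutral_left) (auto simp: J_def zero_less_measure_iff)
    also have "\<dots> = measure \<nu> (\<Union>k\<in>{-M..M}. I k)" by (rule sumI[symmetric]) simp
    also have "\<dots> = 1"
    proof -
      have cov: "spt \<nu> \<subseteq> (\<Union>k\<in>{-M..M}. I k)"
      proof
        fix y assume "y \<in> spt \<nu>"
        hence y: "-1 \<le> y" "y \<le> 1" using spt by auto
        have "y / \<delta> \<le> 1 / \<delta>" "- (1 / \<delta>) \<le> y / \<delta>" using y \<delta> by (auto simp: field_simps)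
        hence "\<lfloor>y / \<delta>\<rfloor> \<in> {-M..M}" by (simp add: M_def) linarith
        thus "y \<in> (\<Union>k\<in>{-M..M}. I k)" using memI by blast
      qed
      have "space \<nu> - (\<Union>k\<in>{-M..M}. I k) \<in> null_sets \<nu>"
        using cov sI by (intro null_sets_subset[OF null]) auto
      thus ?thesis using sI prob_compl[of "\<Union>k\<in>{-M..M}. I k"] by (simp add: measure_def null_sets_def sets.finite_UN)
    qed
    finally show "sum w (c ` J) = 1" .
  next
    fix x r :: real assume r: "r \<ge> \<delta>"
    define A where "A = {k\<in>J. \<bar>c k - x\<bar> \<le> r}"
    have "{y \<in> c ` J. \<bar>y - x\<bar> \<le> r} = c ` A" by (auto simp: A_def)
    moreover have "inj_on c A" using inj by (rule inj_on_subset) (auto simp: A_def)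
    ultimately have "sum w {y \<in> c ` J. \<bar>y - x\<bar> \<le> r} = (\<Sum>k\<in>A. measure \<nu> (I k))"
      by (simp add: sum.reindex w_def fl A_def)
    also have "\<dots> = measure \<nu> (\<Union>k\<in>A. I k)" using finJ by (intro sumI[symmetric]) (simp add: A_def)
    also have "\<dots> \<le> measure \<nu> (ball x (2 * r))"
    proof (rule finite_measure_mono)
      show "(\<Union>k\<in>A. I k) \<subseteq> ball x (2 * r)"
      proof
        fix y assume "y \<in> (\<Union>k\<in>A. I k)"
        then obtain k where k: "k \<in> A" "y \<in> I k" by auto
        have "c k \<in> I k" using c k by (auto simp: A_def)
        hence "\<bar>y - c k\<bar> < \<delta>" using k(2) by (auto simp: I_def algebra_simps)
        thus "y \<in> ball x (2 * r)" using k(1) r by (auto simp: A_def dist_real_def)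
      qed
    qed (simp add: sets)
    also have "\<dots> \<le> 20 * (2 * r) powr \<gamma>" using r \<delta> by (intro fr) auto
    also have "\<dots> = 20 * (2 powr \<gamma> * r powr \<gamma>)" using r \<delta> by (simp add: powr_mult)
    also have "\<dots> \<le> 20 * (2 * r powr \<gamma>)"
      using \<gamma> powr_mono[of \<gamma> 1 2] by (intro mult_left_mono mult_right_mono) auto
    finally show "sum w {y \<in> c ` J. \<bar>y - x\<bar> \<le> r} \<le> 40 * r powr \<gamma>" by simp
  qed
qed

text \<open>Fix all coefficients except \<open>c i\<close>. Because \<open>v i\<close> is at least
  \<mu> in absolute value, the inequality confines \<open>c i\<close> to an interval of radius
  \<open>\<rho> / \<mu>\<close>, whatever the other \<open>v\<close> are.\<close>

lemma sum_transversal: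
  fixes w :: "real \<Rightarrow> real" and v :: "'i \<Rightarrow> real"
  assumes C: "finite C" "\<And>c. c \<in> C \<Longrightarrow> w c \<ge> 0" "sum w C = 1"
    and I: "finite I" "i \<in> I"
    and fr: "\<And>x. sum w {c\<in>C. \<bar>c - x\<bar> \<le> \<rho> / \<mu>} \<le> M"
    and v: "\<bar>v i\<bar> \<ge> \<mu>" "\<mu> > 0"
  shows "(\<Sum>c\<in>PiE I (\<lambda>_. C). (\<Prod>i\<in>I. w (c i)) * (if \<bar>y + (\<Sum>i\<in>I. c i * v i)\<bar> \<le> \<rho> then 1 else 0)) \<le> M"
proof -
  define J where "J = I - {i}"
  have J: "finite J" "i \<notin> J" "I = insert i J" using I by (auto simp: J_def)
  have vi: "v i \<noteq> 0" using v by auto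
  have prod1: "(\<Sum>g\<in>PiE J (\<lambda>_. C). \<Prod>j\<in>J. w (g j)) = 1"
    using prod_sum_PiE[of J "\<lambda>_. C" "\<lambda>_. w"] C J(1) by simp
  have inner: "(\<Sum>a\<in>C. w a * (if \<bar>z + a * v i\<bar> \<le> \<rho> then 1 else 0)) \<le> M" for z
  proof -
    have "(\<Sum>a\<in>C. w a * (if \<bar>z + a * v i\<bar> \<le> \<rho> then 1 else 0)) = sum w {a\<in>C. \<bar>z + a * v i\<bar> \<le> \<rho>}"
      using C(1) by (subst sum.inter_filter) (auto intro!: sum.cong)
    also have "\<dots> \<le> sum w {c\<in>C. \<bar>c - (- z / v i)\<bar> \<le> \<rho> / \<mu>}"
    proof (rule sum_mono2)
      show "{a \<in> C. \<bar>z + a * v i\<bar> \<le> \<rho>} \<subseteq> {c \<in> C. \<bar>c - (- z / v i)\<bar> \<le> \<rho> / \<mu>}"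
      proof (clarify)
        fix a assume a: "a \<in> C" "\<bar>z + a * v i\<bar> \<le> \<rho>"
        have "z + a * v i = (a - (- z / v i)) * v i" using vi by (simp add: distrib_right)
        hence "\<bar>a - (- z / v i)\<bar> = \<bar>z + a * v i\<bar> / \<bar>v i\<bar>" using vi by (simp only: abs_mult) simp
        also have "\<dots> \<le> \<rho> / \<mu>" using a(2) v by (intro frac_le) auto
        finally show "\<bar>a - (- z / v i)\<bar> \<le> \<rho> / \<mu>" .
      qed
    qed (use C in auto)
    also have "\<dots> \<le> M" by (rule fr)
    finally show ?thesis .
  qed
  have "(\<Sum>c\<in>PiE I (\<lambda>_. C). (\<Prod>i\<in>I. w (c i)) * (if \<bar>y + (\<Sum>i\<in>I. c i * v i)\<bar> \<le> \<rho> then 1 else 0))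
     = (\<Sum>g\<in>PiE J (\<lambda>_. C). \<Sum>a\<in>C. (\<Prod>j\<in>J. w (g j)) * (w a * (if \<bar>(y + (\<Sum>j\<in>J. g j * v j)) + a * v i\<bar> \<le> \<rho> then 1 else 0)))"
    unfolding J(3) sum_PiE_insert[OF J(2)]
  proof (intro sum.cong refl)
    fix g a
    have "(\<Prod>j\<in>J. w ((g(i := a)) j)) = (\<Prod>j\<in>J. w (g j))" using J(2) by (intro prod.cong) auto
    moreover have "(\<Sum>j\<in>J. (g(i := a)) j * v j) = (\<Sum>j\<in>J. g j * v j)" using J(2) by (intro sum.cong) auto
    ultimately show "(\<Prod>k\<in>insert i J. w ((g(i := a)) k)) * (if \<bar>y + (\<Sum>k\<in>insert i J. (g(i := a)) k * v k)\<bar> \<le> \<rho> then 1 else 0) =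
       (\<Prod>j\<in>J. w (g j)) * (w a * (if \<bar>(y + (\<Sum>j\<in>J. g j * v j)) + a * v i\<bar> \<le> \<rho> then 1 else 0))"
      using J by (simp add: ac_simps)
  qed
  also have "\<dots> = (\<Sum>g\<in>PiE J (\<lambda>_. C). (\<Prod>j\<in>J. w (g j)) * (\<Sum>a\<in>C. w a * (if \<bar>(y + (\<Sum>j\<in>J. g j * v j)) + a * v i\<bar> \<le> \<rho> then 1 else 0)))"
    by (simp only: sum_distrib_left)
  also have "\<dots> \<le> (\<Sum>g\<in>PiE J (\<lambda>_. C). (\<Prod>j\<in>J. w (g j)) * M)"
    using C(2) by (intro sum_mono mult_left_mono inner prod_nonneg) auto
  also have "\<dots> = M" unfolding sum_distrib_right[symmetric] prod1 by simp
  finally show ?thesis .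
qed

section \<open>The long sum\<close>

text \<open>
  A choice in window \<open>p\<close> is a pair \<open>(u, x)\<close>. Among the \<open>m\<close> copies of \<open>B\<close> with coefficient \<open>c\<^sub>0\<close>, the first
  \<open>u\<close> branch to the right at level \<open>\<tau> p\<close>, so that their sum runs through a progression of length \<open>m\<close>.
  The copy with coefficient \<open>c i\<close> uses the bits \<open>x i\<close> of the window.
\<close>

locale coded_windows =
  fixes D N Q K n m P :: nat and S :: "nat set" and b :: "nat set \<Rightarrow> real" and \<tau> :: "nat \<Rightarrow> nat"
    and C :: "real set" and w :: "real \<Rightarrow> real" and \<gamma> \<delta> c\<^sub>0 \<eta> :: real
  assumes D: "2 \<le> D" and S: "S \<subseteq> {..<N}"
    and b_near: "\<And>\<omega> \<omega>' i. \<omega> \<subseteq> S \<Longrightarrow> \<omega>' \<subseteq> S \<Longrightarrow> i \<le> N \<Longrightarrow> \<omega> \<inter> {..<i} = \<omega>' \<inter> {..<i} \<Longrightarrow>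
        \<bar>b \<omega> - b \<omega>'\<bar> \<le> 1 / real D ^ i"
    and b_far: "\<And>\<omega> \<omega>' i. \<omega> \<subseteq> S \<Longrightarrow> \<omega>' \<subseteq> S \<Longrightarrow> i \<in> S \<Longrightarrow> \<omega> \<inter> {..<i} = \<omega>' \<inter> {..<i} \<Longrightarrow>
        i \<notin> \<omega> \<Longrightarrow> i \<in> \<omega>' \<Longrightarrow> 1 / real D ^ Suc i \<le> b \<omega>' - b \<omega>"
    and dense: "\<And>p. p \<le> P \<Longrightarrow> forward_dense Q N S (\<tau> p)"
    and step: "\<And>p. p < P \<Longrightarrow> \<tau> p + K \<le> \<tau> (Suc p)"
    and K: "0 < K" and n: "D ^ Q \<le> 2 ^ n" "n \<le> m" and m: "m = D ^ K"
    and C: "finite C" "C \<subseteq> {-1..1}"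
    and w: "\<And>c. c \<in> C \<Longrightarrow> 0 \<le> w c" "sum w C = 1"
    and frostman: "\<And>x r. \<delta> \<le> r \<Longrightarrow> sum w {c\<in>C. \<bar>c - x\<bar> \<le> r} \<le> 40 * r powr \<gamma>"
    and \<gamma>: "0 < \<gamma>" "\<gamma> \<le> 1" and \<delta>: "0 < \<delta>" "\<delta> \<le> 1 / real D ^ N"
    and c0: "0 < \<eta>" "\<eta> \<le> \<bar>c\<^sub>0\<bar>" "\<bar>c\<^sub>0\<bar> \<le> 1"
begin

section \<open>Partial sums along the windows\<close>

definition "win p = {\<tau> p..<\<tau> (Suc p)}"

definition "choices p = {..<m} \<times> PiE {..<n} (\<lambda>_. Pow (S \<inter> win p))"

definition "bits i p f = (\<Union>q<p. snd (f q) i)" for f :: "nat \<Rightarrow> nat \<times> (nat \<Rightarrow> nat set)" and i p :: nat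

definition "steps i p f = \<tau> ` {q. q < p \<and> i < fst (f q)}" for f :: "nat \<Rightarrow> nat \<times> (nat \<Rightarrow> nat set)" and i p :: nat

definition "Y c p f = c\<^sub>0 * (\<Sum>i<m. b (steps i p f)) + (\<Sum>i<n. c i * b (bits i p f))"

text \<open>The choice in window \<open>p\<close> moves each of the \<open>n + m\<close> copies by
  at most \<open>1 / D ^ \<tau> p\<close>. The factor 2 makes the radii summable in the sense of
  \<open>Y_step\<close>: since \<open>D \<ge> 2\<close>, each radius is at most half of the one
  before.\<close>

definition "rad p = 2 * (real n + real m) / real D ^ \<tau> p"

lemma tau_le: "p \<le> P \<Longrightarrow> \<tau> p \<le> N"
  using dense[of p] by (simp add: forward_dense_def)

lemma tau_less: "p < P \<Longrightarrow> \<tau> p < \<tau> (Suc p)"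
  using step[of p] K by simp

lemma tau_strict: "q < p \<Longrightarrow> p \<le> P \<Longrightarrow> \<tau> q < \<tau> p"
proof (induction p)
  case (Suc p)
  thus ?case using tau_less[of p] by (cases "q = p") auto
qed simp

lemma tau_mem: "p < P \<Longrightarrow> \<tau> p \<in> S"
  using forward_dense_mem[OF dense[of p]] tau_less[of p] tau_le[of "Suc p"] by simp

lemma D_pos: "real D > 0" "real D \<ge> 2" "real D \<ge> 1"
  using D by auto

lemma m_pos: "0 < m"
  using D by (simp add: m)

lemma finite_S: "finite S"
  using S finite_subset by blast

lemma finite_choices: "finite (choices p)"
  unfolding choices_def by (intro finite_cartesian_product finite_PiE) (auto simp: finite_S)

lemma choices_nonempty: "choices p \<noteq> {}"
proof -
  have "(0, \<lambda>i\<in>{..<n}. {}) \<in> choices p" using m_pos by (auto simp: choices_def)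
  thus ?thesis by blast
qed

lemma steps_sub:
  assumes "p \<le> P" shows "steps i p f \<subseteq> S" "steps i p f \<subseteq> {..<\<tau> p}"
  using assms tau_mem tau_strict[OF _ assms] by (auto simp: steps_def)

lemma steps_Suc: "steps i (Suc p) f = (if i < fst (f p) then insert (\<tau> p) (steps i p f) else steps i p f)"
  by (auto simp: steps_def less_Suc_eq)

lemma bits_Suc: "bits i (Suc p) f = bits i p f \<union> snd (f p) i"
  by (auto simp: bits_def less_Suc_eq)

lemma choicesD: "a \<in> choices p \<Longrightarrow> fst a < m" "a \<in> choices p \<Longrightarrow> i < n \<Longrightarrow> snd a i \<subseteq> S \<inter> win p"
proof -
  show "a \<in> choices p \<Longrightarrow> fst a < m" by (auto simp: choices_def)
  assume "a \<in> choices p" "i < n"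
  hence "snd a \<in> PiE {..<n} (\<lambda>_. Pow (S \<inter> win p))" unfolding choices_def by (simp only: mem_Times_iff)
  from PiE_mem[OF this, of i] \<open>i < n\<close> show "snd a i \<subseteq> S \<inter> win p" by simp
qed

lemma bits_sub:
  assumes "p \<le> P" "\<And>q. q < p \<Longrightarrow> f q \<in> choices q" "i < n"
  shows "bits i p f \<subseteq> S" "bits i p f \<subseteq> {..<\<tau> p}"
proof -
  have "snd (f q) i \<subseteq> S \<inter> {..<\<tau> p}" if "q < p" for q
  proof -
    have "snd (f q) i \<subseteq> S \<inter> win q" using assms that by (intro choicesD)
    moreover have "\<tau> (Suc q) \<le> \<tau> p"
      using tau_strict[of "Suc q" p] that assms(1) by (cases "Suc q = p") auto
    ultimately show ?thesis by (auto simp: win_def)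
  qed
  thus "bits i p f \<subseteq> S" "bits i p f \<subseteq> {..<\<tau> p}" by (auto simp: bits_def)
qed

lemma Y_local: "(\<And>i. i < p \<Longrightarrow> f i = g i) \<Longrightarrow> Y c p f = Y c p g"
proof -
  assume *: "\<And>i. i < p \<Longrightarrow> f i = g i"
  have "steps i p f = steps i p g" "bits i p f = bits i p g" for i
    using * by (auto simp: steps_def bits_def)
  thus ?thesis by (simp add: Y_def)
qed

lemma C_abs: "c \<in> C \<Longrightarrow> \<bar>c\<bar> \<le> 1"
  using C(2)[THEN subsetD, of c] by (simp add: abs_le_iff)

lemma Y_step:
  assumes p: "p < P" and f: "f \<in> PiE {..<Suc p} choices" and c: "c \<in> PiE {..<n} (\<lambda>_. C)"
  shows "\<bar>Y c (Suc p) f - Y c p f\<bar> \<le> rad p - rad (Suc p)"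
proof -
  have fq: "f q \<in> choices q" if "q < Suc p" for q using f that by (auto simp: PiE_iff)
  have pN: "p \<le> P" "Suc p \<le> P" "\<tau> p \<le> N" using p tau_le by auto
  have s: "\<bar>b (steps i (Suc p) f) - b (steps i p f)\<bar> \<le> 1 / real D ^ \<tau> p" for i
  proof (rule b_near)
    show "steps i (Suc p) f \<inter> {..<\<tau> p} = steps i p f \<inter> {..<\<tau> p}" by (auto simp: steps_Suc)
  qed (use steps_sub pN in auto)
  have x: "\<bar>b (bits i (Suc p) f) - b (bits i p f)\<bar> \<le> 1 / real D ^ \<tau> p" if "i < n" for i
  proof (rule b_near)
    have "snd (f p) i \<inter> {..<\<tau> p} = {}" using choicesD(2)[OF fq[of p] that] by (auto simp: win_def)
    thus "bits i (Suc p) f \<inter> {..<\<tau> p} = bits i p f \<inter> {..<\<tau> p}" by (auto simp: bits_Suc)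
    show "bits i (Suc p) f \<subseteq> S" "bits i p f \<subseteq> S" using bits_sub(1) fq that pN by auto
  qed (use pN in auto)
  have eq: "Y c (Suc p) f - Y c p f = c\<^sub>0 * (\<Sum>i<m. b (steps i (Suc p) f) - b (steps i p f))
      + (\<Sum>i<n. c i * (b (bits i (Suc p) f) - b (bits i p f)))"
    by (simp add: Y_def sum_subtractf algebra_simps)
  have "\<bar>Y c (Suc p) f - Y c p f\<bar> \<le> \<bar>c\<^sub>0\<bar> * (\<Sum>i<m. \<bar>b (steps i (Suc p) f) - b (steps i p f)\<bar>)
      + (\<Sum>i<n. \<bar>c i\<bar> * \<bar>b (bits i (Suc p) f) - b (bits i p f)\<bar>)"
    unfolding eq abs_mult[symmetric]
    by (intro order_trans[OF abs_triangle_ineq] add_mono sum_abs)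
       (auto simp: abs_mult intro!: mult_left_mono sum_abs)
  also have "\<dots> \<le> 1 * (\<Sum>i<m. 1 / real D ^ \<tau> p) + (\<Sum>i<n. 1 * (1 / real D ^ \<tau> p))"
  proof (rule add_mono)
    show "\<bar>c\<^sub>0\<bar> * (\<Sum>i<m. \<bar>b (steps i (Suc p) f) - b (steps i p f)\<bar>) \<le> 1 * (\<Sum>i<m. 1 / real D ^ \<tau> p)"
    proof (rule mult_mono)
      show "(\<Sum>i<m. \<bar>b (steps i (Suc p) f) - b (steps i p f)\<bar>) \<le> (\<Sum>i<m. 1 / real D ^ \<tau> p)"
        by (rule sum_mono) (rule s)
    qed (simp_all add: c0 sum_nonneg)
    show "(\<Sum>i<n. \<bar>c i\<bar> * \<bar>b (bits i (Suc p) f) - b (bits i p f)\<bar>) \<le> (\<Sum>i<n. 1 * (1 / real D ^ \<tau> p))"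
    proof (rule sum_mono)
      fix i assume i: "i \<in> {..<n}"
      hence "c i \<in> C" using c by (auto simp: PiE_iff)
      thus "\<bar>c i\<bar> * \<bar>b (bits i (Suc p) f) - b (bits i p f)\<bar> \<le> 1 * (1 / real D ^ \<tau> p)"
        using i by (intro mult_mono C_abs x) simp_all
    qed
  qed
  also have "\<dots> = (real n + real m) / real D ^ \<tau> p" by (simp add: add_divide_distrib)
  also have "\<dots> \<le> rad p - rad (Suc p)"
  proof -
    have "real D ^ \<tau> p * 2 \<le> real D ^ \<tau> p * real D" using D_pos by (intro mult_left_mono) auto
    also have "\<dots> = real D ^ Suc (\<tau> p)" by simp
    also have "\<dots> \<le> real D ^ \<tau> (Suc p)" using tau_less[OF p] D_pos by (intro power_increasing) auto
    finally have "rad (Suc p) \<le> 2 * (real n + real m) / (real D ^ \<tau> p * 2)"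
      unfolding rad_def using D_pos by (intro divide_left_mono) auto
    also have "\<dots> = (real n + real m) / real D ^ \<tau> p"
      by (metis mult.commute mult_divide_mult_cancel_left zero_neq_numeral)
    finally have "rad (Suc p) \<le> (real n + real m) / real D ^ \<tau> p" .
    moreover have "rad p = (real n + real m) / real D ^ \<tau> p + (real n + real m) / real D ^ \<tau> p"
      by (simp add: rad_def add_divide_distrib)
    ultimately show ?thesis by linarith
  qed
  finally show ?thesis .
qed

text \<open>Exactly \<open>\<bar>u' - u\<bar>\<close> of the copies turn differently at
  \<open>\<tau> p\<close>, and all of them move in the same direction, so that nothing
  cancels.\<close>

lemma steps_diff:
  assumes p: "p < P" and u: "u < m" "u' < m"
  shows "\<bar>(\<Sum>i<m. b (steps i (Suc p) (f(p := (u', x'))))) - (\<Sum>i<m. b (steps i (Suc p) (f(p := (u, x)))))\<bar>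
     \<ge> \<bar>real u' - real u\<bar> / real D ^ Suc (\<tau> p)"
proof -
  have mono: "(real u' - real u) / real D ^ Suc (\<tau> p) \<le>
      (\<Sum>i<m. b (steps i (Suc p) (f(p := (u', x'))))) - (\<Sum>i<m. b (steps i (Suc p) (f(p := (u, x)))))"
    if u: "u \<le> u'" "u' < m" for u u' x x'
  proof -
    have st: "steps i p (f(p := a)) = steps i p f" for i a by (auto simp: steps_def)
    have t: "\<tau> p \<in> S" "\<tau> p \<notin> steps i p f" "steps i p f \<subseteq> S" for i
    proof -
      show "\<tau> p \<in> S" by (rule tau_mem[OF p])
      show "steps i p f \<subseteq> S" using p by (intro steps_sub) simp
      have "steps i p f \<subseteq> {..<\<tau> p}" using p by (intro steps_sub) simp
      thus "\<tau> p \<notin> steps i p f" by blast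
    qed
    have "(\<Sum>i<m. if i \<in> {u..<u'} then 1 / real D ^ Suc (\<tau> p) else 0) \<le>
      (\<Sum>i<m. b (steps i (Suc p) (f(p := (u', x')))) - b (steps i (Suc p) (f(p := (u, x)))))"
    proof (rule sum_mono)
      fix i assume "i \<in> {..<m}"
      show "(if i \<in> {u..<u'} then 1 / real D ^ Suc (\<tau> p) else 0) \<le>
        b (steps i (Suc p) (f(p := (u', x')))) - b (steps i (Suc p) (f(p := (u, x))))"
      proof (cases "i \<in> {u..<u'}")
        case True
        have "1 / real D ^ Suc (\<tau> p) \<le> b (insert (\<tau> p) (steps i p f)) - b (steps i p f)"
          using t by (intro b_far) auto
        thus ?thesis using True by (simp add: steps_Suc st)
      next
        case False
        hence "i < u \<longleftrightarrow> i < u'" using u by auto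
        thus ?thesis unfolding if_not_P[OF False] by (simp add: steps_Suc st)
      qed
    qed
    also have "(\<Sum>i<m. if i \<in> {u..<u'} then 1 / real D ^ Suc (\<tau> p) else 0) = (\<Sum>i\<in>{u..<u'}. 1 / real D ^ Suc (\<tau> p))"
    proof -
      have "{..<m} \<inter> {u..<u'} = {u..<u'}" using u by auto
      thus ?thesis by (simp only: sum.inter_restrict[OF finite_lessThan, symmetric])
    qed
    also have "\<dots> = (real u' - real u) / real D ^ Suc (\<tau> p)" using u by (simp add: of_nat_diff)
    finally show ?thesis by (simp only: sum_subtractf)
  qed
  show ?thesis
  proof (cases "u \<le> u'")
    case True
    thus ?thesis using mono[OF True u(2), of x' x] D_pos by (intro order_trans[OF _ abs_ge_self]) simp
  next
    case False
    hence "u' \<le> u" by simp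
    from mono[OF this u(1), of x x'] show ?thesis using False D_pos
      by (subst abs_minus_commute, intro order_trans[OF _ abs_ge_self]) (simp add: abs_minus_commute)
  qed
qed

section \<open>Patterns that agree to a given depth\<close>

definition "patterns p = PiE {..<n} (\<lambda>_. Pow (S \<inter> win p))"

definition "agree j x x' \<longleftrightarrow> (\<forall>i<n. x' i \<inter> {..<j} = x i \<inter> {..<j})"
  for x x' :: "nat \<Rightarrow> nat set" and j :: nat

lemma finite_patterns: "finite (patterns p)"
  unfolding patterns_def by (intro finite_PiE) (auto simp: finite_S)

lemma choices_eq: "choices p = {..<m} \<times> patterns p"
  by (simp add: choices_def patterns_def)

lemma card_patterns: "card (patterns p) = 2 ^ (n * card (S \<inter> win p))"
  unfolding patterns_def
  by (subst card_PiE) (simp_all add: card_Pow finite_S power_mult[symmetric] mult.commute del: Pow_Int_eq)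

lemma card_agree_le:
  assumes "p < P"
  shows "card {x'\<in>patterns p. agree j x x'} \<le> 2 ^ (n * card (S \<inter> {j..<\<tau> (Suc p)}))"
proof -
  define E where "E i = {y\<in>Pow (S \<inter> win p). y \<inter> {..<j} = x i \<inter> {..<j}}" for i
  have cE: "card (E i) \<le> 2 ^ card (S \<inter> {j..<\<tau> (Suc p)})" for i
  proof -
    have "inj_on (\<lambda>y. y \<inter> {j..}) (E i)"
    proof (rule inj_onI)
      fix y z assume y: "y \<in> E i" and z: "z \<in> E i" and eq: "y \<inter> {j..} = z \<inter> {j..}"
      have "y \<inter> {..<j} = z \<inter> {..<j}" using y z by (simp add: E_def)
      moreover have "y = (y \<inter> {..<j}) \<union> (y \<inter> {j..})" "z = (z \<inter> {..<j}) \<union> (z \<inter> {j..})" by auto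
      ultimately show "y = z" using eq by metis
    qed
    moreover have "(\<lambda>y. y \<inter> {j..}) ` E i \<subseteq> Pow (S \<inter> {j..<\<tau> (Suc p)})"
      by (auto simp: E_def win_def)
    ultimately have "card (E i) \<le> card (Pow (S \<inter> {j..<\<tau> (Suc p)}))"
      by (intro card_inj_on_le) (auto simp: finite_S)
    thus ?thesis by (simp only: card_Pow[OF finite_subset[OF Int_lower1 finite_S]])
  qed
  have "{x'\<in>patterns p. agree j x x'} \<subseteq> PiE {..<n} E"
  proof (intro subsetI PiE_I)
    fix y i assume y: "y \<in> {x'\<in>patterns p. agree j x x'}"
    show "y i \<in> E i" if "i \<in> {..<n}"
      using y that PiE_mem[of y "{..<n}" "\<lambda>_. Pow (S \<inter> win p)" i]
      by (simp add: patterns_def agree_def E_def del: Pow_Int_eq)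
    show "y i = undefined" if "i \<notin> {..<n}"
      using y that PiE_arb[of y "{..<n}" "\<lambda>_. Pow (S \<inter> win p)" i]
      by (simp add: patterns_def del: Pow_Int_eq)
  qed
  moreover have finE: "finite (E i)" for i unfolding E_def by (rule finite_subset[of _ "Pow (S \<inter> win p)"]) (auto simp: finite_S)
  ultimately have "card {x'\<in>patterns p. agree j x x'} \<le> card (PiE {..<n} E)"
    by (intro card_mono finite_PiE) auto
  also have "\<dots> = (\<Prod>i<n. card (E i))" by (simp add: card_PiE)
  also have "\<dots> \<le> (\<Prod>i<n. 2 ^ card (S \<inter> {j..<\<tau> (Suc p)}))" by (intro prod_mono) (simp add: cE)
  also have "\<dots> = 2 ^ (n * card (S \<inter> {j..<\<tau> (Suc p)}))" by (simp add: power_mult[symmetric] mult.commute)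
  finally show ?thesis .
qed

text \<open>Forward density gives one element of \<open>S\<close> for every \<open>Q\<close> scales,
  and \<open>n\<close> copies contribute \<open>2 ^ n \<ge> D ^ Q\<close> patterns for each such
  element. To every depth the patterns are therefore at least as numerous as the nodes of a full
  \<open>D\<close>-adic tree.\<close>

lemma D_power_le:
  assumes p: "p < P" and j: "\<tau> p \<le> j" "j \<le> \<tau> (Suc p)"
  shows "D ^ (j - \<tau> p) \<le> 2 ^ (n * card (S \<inter> {\<tau> p..<j}))"
proof -
  have "j \<in> {\<tau> p..N}" using j tau_le[of "Suc p"] p by auto
  hence "j - \<tau> p \<le> Q * card (S \<inter> {\<tau> p..<j})"
    using dense[of p] p by (auto simp: forward_dense_def)
  hence "D ^ (j - \<tau> p) \<le> D ^ (Q * card (S \<inter> {\<tau> p..<j}))" using D by (intro power_increasing) auto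
  also have "\<dots> = (D ^ Q) ^ card (S \<inter> {\<tau> p..<j})" by (simp add: power_mult)
  also have "\<dots> \<le> (2 ^ n) ^ card (S \<inter> {\<tau> p..<j})" using n by (intro power_mono) auto
  finally show ?thesis by (simp add: power_mult)
qed

lemma card_agree_D_power:
  assumes p: "p < P" and j: "\<tau> p \<le> j" "j \<le> \<tau> (Suc p)"
  shows "card {x'\<in>patterns p. agree j x x'} * D ^ (j - \<tau> p) \<le> card (patterns p)"
proof -
  have "card {x'\<in>patterns p. agree j x x'} * D ^ (j - \<tau> p) \<le>
     2 ^ (n * card (S \<inter> {j..<\<tau> (Suc p)})) * 2 ^ (n * card (S \<inter> {\<tau> p..<j}))"
    by (intro mult_le_mono card_agree_le D_power_le assms)
  also have "\<dots> = card (patterns p)"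
    unfolding card_patterns win_def card_Int_atLeastLessThan_add[OF j]
    by (simp add: power_add algebra_simps)
  finally show ?thesis .
qed

lemma bits_far:
  assumes p: "p < P" and f: "\<And>q. q < p \<Longrightarrow> f q \<in> choices q" and i: "i < n"
    and x: "x \<in> patterns p" "x' \<in> patterns p" and j: "j \<in> x i" "j \<notin> x' i" "x' i \<inter> {..<j} = x i \<inter> {..<j}"
  shows "1 / real D ^ Suc j \<le> b (bits i (Suc p) (f(p := (u, x)))) - b (bits i (Suc p) (f(p := (u', x'))))"
proof -
  have xs: "x i \<subseteq> S \<inter> win p" "x' i \<subseteq> S \<inter> win p"
    using x i PiE_mem[of _ "{..<n}" "\<lambda>_. Pow (S \<inter> win p)" i] unfolding patterns_def by blast+
  have st: "bits i p (f(p := a)) = bits i p f" for a by (auto simp: bits_def)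
  have B: "bits i p f \<subseteq> S" "bits i p f \<subseteq> {..<\<tau> p}" using bits_sub[of p f i] p f i by auto
  have eq: "bits i (Suc p) (f(p := (u, x))) = bits i p f \<union> x i"
    "bits i (Suc p) (f(p := (u', x'))) = bits i p f \<union> x' i"
    by (simp_all add: bits_Suc st)
  have jw: "j \<in> S" "\<tau> p \<le> j" using xs(1) j(1) by (auto simp: win_def)
  have nj: "j \<notin> bits i p f" using B(2) jw(2) by auto
  show ?thesis unfolding eq
  proof (rule b_far)
    show "(bits i p f \<union> x' i) \<inter> {..<j} = (bits i p f \<union> x i) \<inter> {..<j}"
      unfolding Int_Un_distrib2 j(3) ..
  qed (use B xs j jw nj in auto)
qed

text \<open>\<open>j\<close> is the first level at which any of the \<open>n\<close> copies differs,
  and \<open>i\<close> is a copy that differs there. Separation of this one copy is enough for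
  \<open>sum_transversal\<close>.\<close>

lemma first_difference:
  assumes p: "p < P" and f: "\<And>q. q < p \<Longrightarrow> f q \<in> choices q"
    and x: "x \<in> patterns p" "x' \<in> patterns p" and ne: "x' \<noteq> x"
  obtains j i where "j \<in> win p" "i < n" "agree j x x'"
    "1 / real D ^ Suc j \<le> \<bar>b (bits i (Suc p) (f(p := (u', x')))) - b (bits i (Suc p) (f(p := (u, x))))\<bar>"
proof -
  have "\<exists>i<n. x' i \<noteq> x i"
  proof (rule ccontr)
    assume "\<not> ?thesis"
    hence "x' = x" using x unfolding patterns_def by (intro PiE_ext) auto
    thus False using ne by simp
  qed
  hence ex: "\<exists>j. \<exists>i<n. (j \<in> x' i) \<noteq> (j \<in> x i)" by blast
  define j where "j = (LEAST j. \<exists>i<n. (j \<in> x' i) \<noteq> (j \<in> x i))"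
  from LeastI_ex[OF ex] obtain i where i: "i < n" "(j \<in> x' i) \<noteq> (j \<in> x i)" unfolding j_def by blast
  have ag: "agree j x x'"
    unfolding agree_def
  proof (intro allI impI)
    fix k assume "k < n"
    hence "l < j \<Longrightarrow> (l \<in> x' k) = (l \<in> x k)" for l
      using not_less_Least[of l "\<lambda>j. \<exists>i<n. (j \<in> x' i) \<noteq> (j \<in> x i)"] unfolding j_def by blast
    thus "x' k \<inter> {..<j} = x k \<inter> {..<j}" by blast
  qed
  have xs: "x i \<subseteq> S \<inter> win p" "x' i \<subseteq> S \<inter> win p"
    using x i PiE_mem[of _ "{..<n}" "\<lambda>_. Pow (S \<inter> win p)" i] unfolding patterns_def by blast+
  have jw: "j \<in> win p" using xs i(2) by blast
  have agi: "x' i \<inter> {..<j} = x i \<inter> {..<j}" using ag i(1) by (simp add: agree_def)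
  have "1 / real D ^ Suc j \<le> \<bar>b (bits i (Suc p) (f(p := (u', x')))) - b (bits i (Suc p) (f(p := (u, x))))\<bar>"
  proof (cases "j \<in> x i")
    case True
    with i(2) have "j \<notin> x' i" by simp
    from bits_far[OF p f i(1) x True this agi, of u u'] show ?thesis by linarith
  next
    case False
    with i(2) have "j \<in> x' i" by simp
    from bits_far[OF p f i(1) x(2,1) this False agi[symmetric], of u' u] show ?thesis by linarith
  qed
  thus ?thesis using that[OF jw i(1) ag] by blast
qed

section \<open>The expected number of near-coincidences in one window\<close>

definition "weight c = (\<Prod>i<n. w (c i))" for c :: "nat \<Rightarrow> real"

definition "width p = real (\<tau> (Suc p)) - real (\<tau> p)"

text \<open>Chosen so that \<open>\<eta> * radius / D = 8 + n\<close>: a larger gap between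
  \<open>u\<close> and \<open>u'\<close> moves the progression by more than the \<open>n\<close>
  random copies (at most \<open>n / D ^ \<tau> p\<close> together) and the tolerance
  \<open>2 * rad (Suc p)\<close> (at most \<open>8 / D ^ \<tau> p\<close>) can compensate.\<close>

definition "radius = (8 + real n) * real D / \<eta>"

text \<open>A bound for the expected proportion of choices near a given one. Of the
  \<open>D ^ K\<close> values of \<open>u\<close> at most \<open>2 * radius + 1\<close> are near.
  The factor with exponent \<open>\<gamma> * (K - width)\<close> is the Frostman mass for patterns
  that differ from the top of the window on, and \<open>width + 1\<close> counts the levels of first
  difference and the diagonal.\<close>

definition "loss p = (2 * radius + 1) * (320 * real D * (width p + 1)) * real D powr (\<gamma> * (real K - width p) - real K)"

lemma weight_nonneg: "c \<in> PiE {..<n} (\<lambda>_. C) \<Longrightarrow> 0 \<le> weight c"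
  unfolding weight_def by (intro prod_nonneg w) (auto dest: PiE_mem)

lemma sum_weight: "(\<Sum>c\<in>PiE {..<n} (\<lambda>_. C). weight c) = 1"
  unfolding weight_def using prod_sum_PiE[of "{..<n}" "\<lambda>_. C" "\<lambda>_. w"] C w by simp

lemma width_pos: "p < P \<Longrightarrow> 0 < width p"
  using tau_less[of p] by (simp add: width_def)

lemma loss_pos: "p < P \<Longrightarrow> 0 < loss p"
proof -
  assume "p < P"
  hence "0 < width p" by (rule width_pos)
  moreover have "0 \<le> radius" unfolding radius_def using c0 by simp
  ultimately show ?thesis unfolding loss_def using D_pos by (intro mult_pos_pos) auto
qed

lemma rad_Suc_le:
  assumes p: "p < P"
  shows "2 * rad (Suc p) \<le> 8 * (real D ^ K / real D ^ \<tau> (Suc p))"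
proof -
  have "real n \<le> real m" using n by simp
  hence "4 * (real n + real m) \<le> 8 * real m" by simp
  moreover have "real m = real D ^ K" by (simp add: m)
  ultimately have "4 * (real n + real m) \<le> 8 * real D ^ K" by metis
  hence "4 * (real n + real m) / real D ^ \<tau> (Suc p) \<le> 8 * real D ^ K / real D ^ \<tau> (Suc p)"
    using D_pos by (intro divide_right_mono) auto
  thus ?thesis by (simp add: rad_def)
qed

lemma rad_ge_delta:
  assumes p: "p \<le> P"
  shows "(real n + real m) * \<delta> \<le> rad p"
proof -
  have "\<delta> \<le> 1 / real D ^ \<tau> p"
  proof -
    have "real D ^ \<tau> p \<le> real D ^ N" using tau_le[OF p] D_pos by (intro power_increasing) auto
    hence "1 / real D ^ N \<le> 1 / real D ^ \<tau> p" using D_pos by (intro divide_left_mono) auto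
    thus ?thesis using \<delta> by linarith
  qed
  hence "(real n + real m) * \<delta> \<le> (real n + real m) * (1 / real D ^ \<tau> p)" by (intro mult_left_mono) auto
  also have "\<dots> \<le> rad p" using D_pos by (simp add: rad_def divide_right_mono)
  finally show ?thesis .
qed

text \<open>The Frostman bound for two patterns that first differ at level \<open>j\<close>. The
  constant is \<open>320 = 40 * 8\<close>, with 8 from \<open>rad_Suc_le\<close>; the factor
  \<open>D\<close> comes from \<open>Suc j\<close>.\<close>

lemma level_bound:
  assumes p: "p < P" and j: "j \<in> win p"
  shows "40 * (2 * rad (Suc p) / (1 / real D ^ Suc j)) powr \<gamma>
     \<le> 320 * real D * real D powr (\<gamma> * (real K - real (\<tau> (Suc p)) + real j))"
proof -
  have "2 * rad (Suc p) / (1 / real D ^ Suc j) = 2 * rad (Suc p) * real D ^ Suc j" by simp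
  also have "\<dots> \<le> 8 * (real D ^ K / real D ^ \<tau> (Suc p)) * real D ^ Suc j"
    using D_pos by (intro mult_right_mono rad_Suc_le p) auto
  also have "\<dots> = 8 * real D * real D powr (real K - real (\<tau> (Suc p)) + real j)"
    using D_pos by (simp add: powr_add powr_diff powr_realpow)
  finally have "(2 * rad (Suc p) / (1 / real D ^ Suc j)) powr \<gamma> \<le>
     (8 * real D * real D powr (real K - real (\<tau> (Suc p)) + real j)) powr \<gamma>"
    using \<gamma> D_pos by (intro powr_mono2) (auto simp: rad_def)
  also have "\<dots> = (8 * real D) powr \<gamma> * real D powr (\<gamma> * (real K - real (\<tau> (Suc p)) + real j))"
    by (simp add: powr_mult powr_powr mult.commute)
  also have "\<dots> \<le> (8 * real D) powr 1 * real D powr (\<gamma> * (real K - real (\<tau> (Suc p)) + real j))"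
    using \<gamma> D_pos by (intro mult_right_mono powr_mono) auto
  finally show ?thesis using D_pos by simp
qed

text \<open>A later first difference makes a coincidence more likely by
  \<open>D powr (\<gamma> * (j - \<tau> p))\<close>, but the patterns that agree so long are rarer
  by \<open>D ^ (j - \<tau> p)\<close>. As \<open>\<gamma> \<le> 1\<close>, no level contributes
  more than the bound for the top level.\<close>

lemma agree_level_bound:
  assumes p: "p < P" and j: "j \<in> win p"
  shows "card {x'\<in>patterns p. agree j x x'} * (320 * real D * real D powr (\<gamma> * (real K - real (\<tau> (Suc p)) + real j)))
     \<le> card (patterns p) * (320 * real D * real D powr (\<gamma> * (real K - width p)))"
proof -
  have jt: "\<tau> p \<le> j" "j \<le> \<tau> (Suc p)" using j by (auto simp: win_def)
  have "real (card {x'\<in>patterns p. agree j x x'} * D ^ (j - \<tau> p)) \<le> card (patterns p)"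
    using card_agree_D_power[OF p jt, of x] by (simp only: of_nat_le_iff)
  hence le: "real (card {x'\<in>patterns p. agree j x x'}) * real D ^ (j - \<tau> p) \<le> card (patterns p)" by simp
  have "real D powr (\<gamma> * (real j - real (\<tau> p))) \<le> real D powr (1 * (real j - real (\<tau> p)))"
    using \<gamma> jt D_pos by (intro powr_mono mult_right_mono) auto
  also have "\<dots> = real D ^ (j - \<tau> p)" using D_pos jt by (simp add: powr_realpow[symmetric] of_nat_diff)
  finally have pw: "real D powr (\<gamma> * (real j - real (\<tau> p))) \<le> real D ^ (j - \<tau> p)" .
  have "\<gamma> * (real K - real (\<tau> (Suc p)) + real j) = \<gamma> * (real j - real (\<tau> p)) + \<gamma> * (real K - width p)"
    by (simp add: width_def algebra_simps)
  hence eq: "real D powr (\<gamma> * (real K - real (\<tau> (Suc p)) + real j)) =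
      real D powr (\<gamma> * (real j - real (\<tau> p))) * real D powr (\<gamma> * (real K - width p))"
    by (simp add: powr_add)
  have "real (card {x'\<in>patterns p. agree j x x'}) * real D powr (\<gamma> * (real j - real (\<tau> p)))
     \<le> real (card {x'\<in>patterns p. agree j x x'}) * real D ^ (j - \<tau> p)"
    by (intro mult_left_mono pw) auto
  also note le
  finally have "real (card {x'\<in>patterns p. agree j x x'}) * real D powr (\<gamma> * (real j - real (\<tau> p))) * (320 * real D * real D powr (\<gamma> * (real K - width p)))
     \<le> card (patterns p) * (320 * real D * real D powr (\<gamma> * (real K - width p)))"
    using D_pos by (intro mult_right_mono) auto
  thus ?thesis unfolding eq by (simp add: mult_ac)
qed

text \<open>This absorbs the diagonal \<open>x' = x\<close>, where no coefficient helps: there are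
  at least \<open>D powr width p\<close> patterns, and \<open>\<gamma> \<le> 1\<close>.\<close>

lemma patterns_large:
  assumes p: "p < P"
  shows "1 \<le> card (patterns p) * (320 * real D * real D powr (\<gamma> * (real K - width p)))"
proof -
  have "D ^ (\<tau> (Suc p) - \<tau> p) \<le> card (patterns p)"
    using D_power_le[OF p, of "\<tau> (Suc p)"] tau_less[OF p] by (simp add: card_patterns win_def)
  hence "real (D ^ (\<tau> (Suc p) - \<tau> p)) \<le> card (patterns p)" by (simp only: of_nat_le_iff)
  moreover have "real (D ^ (\<tau> (Suc p) - \<tau> p)) = real D powr width p"
    using D_pos tau_less[OF p] by (simp add: powr_realpow[symmetric] width_def of_nat_diff)
  ultimately have c: "real D powr width p \<le> card (patterns p)" by metis
  have "0 \<le> (1 - \<gamma>) * width p + \<gamma> * real K" using \<gamma> width_pos[OF p] by (intro add_nonneg_nonneg mult_nonneg_nonneg) auto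
  also have "\<dots> = width p + \<gamma> * (real K - width p)" by (simp add: algebra_simps)
  finally have "1 \<le> real D powr (width p + \<gamma> * (real K - width p))"
    using D_pos by (intro ge_one_powr_ge_zero) auto
  also have "\<dots> = real D powr width p * (1 * real D powr (\<gamma> * (real K - width p)))" by (simp add: powr_add)
  also have "\<dots> \<le> card (patterns p) * (320 * real D * real D powr (\<gamma> * (real K - width p)))"
    using D_pos by (intro mult_mono c mult_right_mono) auto
  finally show ?thesis .
qed

lemma few_near_indices:
  assumes "0 \<le> L" shows "real (card {u'\<in>{..<m}. \<bar>real u' - real u\<bar> \<le> L}) \<le> 2 * L + 1"
proof -
  have "int ` {u'\<in>{..<m}. \<bar>real u' - real u\<bar> \<le> L} \<subseteq> {int u - \<lfloor>L\<rfloor>..int u + \<lfloor>L\<rfloor>}"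
  proof (clarify)
    fix u' assume "\<bar>real u' - real u\<bar> \<le> L"
    hence "real_of_int \<bar>int u' - int u\<bar> \<le> L" by simp
    hence "\<bar>int u' - int u\<bar> \<le> \<lfloor>L\<rfloor>" by (simp only: le_floor_iff)
    thus "int u' \<in> {int u - \<lfloor>L\<rfloor>..int u + \<lfloor>L\<rfloor>}" by auto
  qed
  hence "card (int ` {u'\<in>{..<m}. \<bar>real u' - real u\<bar> \<le> L}) \<le> card {int u - \<lfloor>L\<rfloor>..int u + \<lfloor>L\<rfloor>}"
    by (intro card_mono) auto
  hence "card {u'\<in>{..<m}. \<bar>real u' - real u\<bar> \<le> L} \<le> nat (2 * \<lfloor>L\<rfloor> + 1)"
    by (subst (asm) card_image) (auto simp: algebra_simps)
  hence "real (card {u'\<in>{..<m}. \<bar>real u' - real u\<bar> \<le> L}) \<le> real (nat (2 * \<lfloor>L\<rfloor> + 1))" by (simp only: of_nat_le_iff)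
  also have "\<dots> \<le> 2 * L + 1" using assms by simp
  finally show ?thesis .
qed

text \<open>If \<open>u\<close> and \<open>u'\<close> are far apart, the progression part rules out
  a coincidence for every choice of coefficients. Otherwise different patterns are separated in one
  copy, and averaging over its coefficient gives the Frostman bound.\<close>

lemma pair_bound:
  assumes p: "p < P" and f: "f \<in> PiE {..<Suc p} choices" and fp: "f p = (u, x)"
    and a: "u' < m" "x' \<in> patterns p"
  shows "(\<Sum>c\<in>PiE {..<n} (\<lambda>_. C). weight c *
      (if \<bar>Y c (Suc p) (f(p := (u', x'))) - Y c (Suc p) f\<bar> \<le> 2 * rad (Suc p) then 1 else 0))
    \<le> (if \<bar>real u' - real u\<bar> \<le> radius then 1 else 0) * ((if x' = x then 1 else 0) +
       (\<Sum>j\<in>win p. if agree j x x' then 320 * real D * real D powr (\<gamma> * (real K - real (\<tau> (Suc p)) + real j)) else 0))"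
    (is "?lhs \<le> ?near * (?same + ?levels)")
proof -
  have fq: "f q \<in> choices q" if "q < Suc p" for q using f that by (auto simp: PiE_iff)
  have ux: "u < m" "x \<in> patterns p" using fq[of p] fp by (auto simp: choices_eq)
  have upd: "f(p := (u, x)) = f" using fp by (metis fun_upd_triv)
  define y where "y = c\<^sub>0 * ((\<Sum>i<m. b (steps i (Suc p) (f(p := (u', x'))))) - (\<Sum>i<m. b (steps i (Suc p) f)))"
  define v where "v i = b (bits i (Suc p) (f(p := (u', x')))) - b (bits i (Suc p) f)" for i
  have diff: "Y c (Suc p) (f(p := (u', x'))) - Y c (Suc p) f = y + (\<Sum>i<n. c i * v i)" for c
    by (simp add: Y_def y_def v_def sum_subtractf right_diff_distrib)
  define \<rho> where "\<rho> = 2 * rad (Suc p)"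
  have lev0: "?levels \<ge> 0" using D_pos by (intro sum_nonneg) auto
  have le1: "?lhs \<le> 1"
  proof -
    have "?lhs \<le> (\<Sum>c\<in>PiE {..<n} (\<lambda>_. C). weight c * 1)"
      using weight_nonneg by (intro sum_mono mult_left_mono) auto
    thus ?thesis by (simp add: sum_weight)
  qed
  show ?thesis
  proof (cases "\<bar>real u' - real u\<bar> \<le> radius")
    case False
    have "\<bar>Y c (Suc p) (f(p := (u', x'))) - Y c (Suc p) f\<bar> > 2 * rad (Suc p)" if c: "c \<in> PiE {..<n} (\<lambda>_. C)" for c
    proof -
      have vb: "\<bar>v i\<bar> \<le> 1 / real D ^ \<tau> p" if "i < n" for i
        unfolding v_def
      proof (rule b_near)
        have g: "(f(p := (u', x'))) q \<in> choices q" if "q < Suc p" for q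
          using fq that a by (auto simp: choices_eq)
        show "bits i (Suc p) (f(p := (u', x'))) \<subseteq> S" using bits_sub(1)[of "Suc p" "f(p := (u', x'))" i] g p \<open>i < n\<close> by simp
        show "bits i (Suc p) f \<subseteq> S" using bits_sub(1)[of "Suc p" f i] fq p \<open>i < n\<close> by simp
        have e: "bits i p (f(p := (u', x'))) = bits i p f" by (auto simp: bits_def)
        have "snd ((f(p := (u', x'))) p) i \<inter> {..<\<tau> p} = {}" "snd (f p) i \<inter> {..<\<tau> p} = {}"
          using choicesD(2)[OF g[of p] \<open>i < n\<close>] choicesD(2)[OF fq[of p] \<open>i < n\<close>] by (auto simp: win_def)
        thus "bits i (Suc p) (f(p := (u', x'))) \<inter> {..<\<tau> p} = bits i (Suc p) f \<inter> {..<\<tau> p}"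
          unfolding bits_Suc e Int_Un_distrib2 by simp
      qed (use tau_le[of p] p in simp)
      have "\<bar>\<Sum>i<n. c i * v i\<bar> \<le> (\<Sum>i<n. 1 * (1 / real D ^ \<tau> p))"
      proof (rule order_trans[OF sum_abs], rule sum_mono)
        fix i assume i: "i \<in> {..<n}"
        hence "c i \<in> C" using c by (auto simp: PiE_iff)
        thus "\<bar>c i * v i\<bar> \<le> 1 * (1 / real D ^ \<tau> p)"
          unfolding abs_mult using i by (intro mult_mono C_abs vb) simp_all
      qed
      hence s: "\<bar>\<Sum>i<n. c i * v i\<bar> \<le> real n / real D ^ \<tau> p" by simp
      have "radius < \<bar>real u' - real u\<bar>" using False by simp
      hence "radius / real D ^ Suc (\<tau> p) < \<bar>real u' - real u\<bar> / real D ^ Suc (\<tau> p)"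
        using D_pos by (intro divide_strict_right_mono) auto
      also have "\<dots> \<le> \<bar>(\<Sum>i<m. b (steps i (Suc p) (f(p := (u', x'))))) - (\<Sum>i<m. b (steps i (Suc p) f))\<bar>"
        using steps_diff[OF p ux(1) a(1), of f x' x] unfolding upd .
      finally have "\<eta> * (radius / real D ^ Suc (\<tau> p)) < \<bar>y\<bar>"
        unfolding y_def abs_mult using c0 D_pos
        by (intro mult_le_less_imp_less) (auto simp: radius_def)
      moreover have "\<eta> * (radius / real D ^ Suc (\<tau> p)) = (8 + real n) / real D ^ \<tau> p"
        using c0 D_pos by (simp add: radius_def)
      ultimately have y: "(8 + real n) / real D ^ \<tau> p < \<bar>y\<bar>" by simp
      have "real D ^ K * real D ^ \<tau> p \<le> real D ^ \<tau> (Suc p)"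
        unfolding power_add[symmetric] using step[OF p] D_pos by (intro power_increasing) auto
      hence "real D ^ K / real D ^ \<tau> (Suc p) \<le> 1 / real D ^ \<tau> p" using D_pos by (simp add: field_simps)
      hence "2 * rad (Suc p) \<le> 8 * (1 / real D ^ \<tau> p)" using rad_Suc_le[OF p] by linarith
      moreover have "(8 + real n) / real D ^ \<tau> p = 8 * (1 / real D ^ \<tau> p) + real n / real D ^ \<tau> p"
        by (simp add: add_divide_distrib)
      ultimately show ?thesis unfolding diff using s y by linarith
    qed
    hence "(if \<bar>Y c (Suc p) (f(p := (u', x'))) - Y c (Suc p) f\<bar> \<le> 2 * rad (Suc p) then 1 else (0::real)) = 0"
      if "c \<in> PiE {..<n} (\<lambda>_. C)" for c using that by (simp only: not_le[symmetric] if_False)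
    hence "?lhs = 0" by (intro sum.neutral ballI) (simp only: mult_zero_right)
    thus ?thesis using False by simp
  next
    case True
    show ?thesis
    proof (cases "x' = x")
      case xx: True
      have "1 \<le> 1 + ?levels" using lev0 by simp
      from order_trans[OF le1 this] have "?lhs \<le> 1 + ?levels" .
      thus ?thesis unfolding if_P[OF True] if_P[OF xx] by (simp only: mult_1_left)
    next
      case xx: False
      have fq': "f q \<in> choices q" if "q < p" for q using fq that by simp
      obtain j i where j: "j \<in> win p" "i < n" "agree j x x'"
        "1 / real D ^ Suc j \<le> \<bar>b (bits i (Suc p) (f(p := (u', x')))) - b (bits i (Suc p) (f(p := (u, x))))\<bar>"
        by (rule first_difference[OF p fq' ux(2) a(2) xx, of u' u])
      have vi: "1 / real D ^ Suc j \<le> \<bar>v i\<bar>" using j(4) unfolding upd v_def .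
      have "?lhs = (\<Sum>c\<in>PiE {..<n} (\<lambda>_. C). (\<Prod>i<n. w (c i)) * (if \<bar>y + (\<Sum>i<n. c i * v i)\<bar> \<le> \<rho> then 1 else 0))"
        unfolding diff weight_def \<rho>_def ..
      also have "\<dots> \<le> 40 * (\<rho> / (1 / real D ^ Suc j)) powr \<gamma>"
      proof (rule sum_transversal[where i = i])
        have "\<delta> \<le> rad (Suc p)"
        proof -
          have "1 * \<delta> \<le> (real n + real m) * \<delta>" using m_pos \<delta> by (intro mult_right_mono) auto
          thus ?thesis using rad_ge_delta[of "Suc p"] p by simp
        qed
        also have "\<dots> \<le> 2 * rad (Suc p) * real D ^ Suc j"
        proof -
          have "1 * 1 \<le> 2 * real D ^ Suc j" using D_pos by (intro mult_mono one_le_power) auto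
          hence "rad (Suc p) * 1 \<le> rad (Suc p) * (2 * real D ^ Suc j)" by (intro mult_left_mono) (auto simp: rad_def)
          thus ?thesis by (simp add: mult_ac)
        qed
        finally show "sum w {c \<in> C. \<bar>c - x\<bar> \<le> \<rho> / (1 / real D ^ Suc j)} \<le> 40 * (\<rho> / (1 / real D ^ Suc j)) powr \<gamma>" for x
          by (intro frostman) (simp add: \<rho>_def)
      qed (use C w j vi D_pos in auto)
      also have "\<dots> \<le> 320 * real D * real D powr (\<gamma> * (real K - real (\<tau> (Suc p)) + real j))"
        unfolding \<rho>_def by (rule level_bound[OF p j(1)])
      also have "\<dots> = (if agree j x x' then 320 * real D * real D powr (\<gamma> * (real K - real (\<tau> (Suc p)) + real j)) else 0)"
        using j(3) by simp
      \<comment> \<open>The level \<open>j\<close> depends on \<open>x'\<close>. Adding the bounds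
        for all levels of agreement removes this dependence, so that the sum over \<open>x'\<close>
        can later be taken level by level.\<close>
      also have "\<dots> \<le> ?levels"
        using j(1) D_pos by (intro member_le_sum) (auto simp: win_def)
      finally show ?thesis using True xx by simp
    qed
  qed
qed

lemma expected_near_count:
  assumes p: "p < P" and f: "f \<in> PiE {..<Suc p} choices"
  shows "(\<Sum>c\<in>PiE {..<n} (\<lambda>_. C). weight c * near_count choices (Y c) rad p f) \<le> card (choices p) * loss p"
proof -
  obtain u x where fp: "f p = (u, x)" by (cases "f p")
  define T where "T = PiE {..<n} (\<lambda>_. C)"
  define lev where "lev j = 320 * real D * real D powr (\<gamma> * (real K - real (\<tau> (Suc p)) + real j))" for j
  define M where "M = 320 * real D * real D powr (\<gamma> * (real K - width p))"
  define hit where "hit c a = (if \<bar>Y c (Suc p) (f(p := a)) - Y c (Suc p) f\<bar> \<le> 2 * rad (Suc p) then 1 else (0::real))" for c a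
  have nc: "real (near_count choices (Y c) rad p f) = (\<Sum>a\<in>choices p. hit c a)" for c
    unfolding near_count_def hit_def using finite_choices[of p] by (simp add: sum.If_cases Int_def)
  have rad0: "0 \<le> radius" unfolding radius_def using c0 by simp
  have lev0: "lev j \<ge> 0" for j by (simp add: lev_def)
  have "(\<Sum>c\<in>T. weight c * near_count choices (Y c) rad p f) = (\<Sum>a\<in>choices p. \<Sum>c\<in>T. weight c * hit c a)"
    unfolding nc sum_distrib_left by (rule sum.swap)
  also have "\<dots> = (\<Sum>u'<m. \<Sum>x'\<in>patterns p. \<Sum>c\<in>T. weight c * hit c (u', x'))"
    unfolding choices_eq sum.cartesian_product[of "\<lambda>u' x'. \<Sum>c\<in>T. weight c * hit c (u', x')"]
    by (intro sum.cong refl) auto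
  also have "\<dots> \<le> (\<Sum>u'<m. \<Sum>x'\<in>patterns p. (if \<bar>real u' - real u\<bar> \<le> radius then 1 else 0) *
      ((if x' = x then 1 else 0) + (\<Sum>j\<in>win p. if agree j x x' then lev j else 0)))"
    unfolding T_def hit_def lev_def by (intro sum_mono pair_bound[OF p f fp]) auto
  also have "\<dots> = (\<Sum>u'<m. if \<bar>real u' - real u\<bar> \<le> radius then 1 else 0) *
      (\<Sum>x'\<in>patterns p. (if x' = x then 1 else 0) + (\<Sum>j\<in>win p. if agree j x x' then lev j else 0))"
    by (simp only: sum_product)
  also have "\<dots> \<le> (2 * radius + 1) * (card (patterns p) * (M * (width p + 1)))"
  proof (rule mult_mono)
    have "(\<Sum>u'<m. if \<bar>real u' - real u\<bar> \<le> radius then 1 else (0::real)) = card {u'\<in>{..<m}. \<bar>real u' - real u\<bar> \<le> radius}"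
      by (simp add: sum.If_cases Int_def)
    also have "\<dots> \<le> 2 * radius + 1" by (rule few_near_indices[OF rad0])
    finally show "(\<Sum>u'<m. if \<bar>real u' - real u\<bar> \<le> radius then 1 else 0) \<le> 2 * radius + 1" .
  next
    have "(\<Sum>x'\<in>patterns p. if x' = x then 1 else (0::real)) \<le> 1"
      using finite_patterns[of p] by (simp add: sum.delta)
    also have "\<dots> \<le> card (patterns p) * M" unfolding M_def by (rule patterns_large[OF p])
    finally have 1: "(\<Sum>x'\<in>patterns p. if x' = x then 1 else (0::real)) \<le> card (patterns p) * M" .
    have "(\<Sum>x'\<in>patterns p. \<Sum>j\<in>win p. if agree j x x' then lev j else 0) =
        (\<Sum>j\<in>win p. \<Sum>x'\<in>patterns p. if agree j x x' then lev j else 0)"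
      by (rule sum.swap)
    also have "\<dots> = (\<Sum>j\<in>win p. card {x'\<in>patterns p. agree j x x'} * lev j)"
      using finite_patterns[of p] by (simp add: sum.If_cases Int_def)
    also have "\<dots> \<le> (\<Sum>j\<in>win p. card (patterns p) * M)"
      unfolding lev_def M_def by (intro sum_mono agree_level_bound[OF p])
    also have "\<dots> = card (patterns p) * M * width p"
      using tau_less[OF p] by (simp add: win_def width_def of_nat_diff)
    finally have 2: "(\<Sum>x'\<in>patterns p. \<Sum>j\<in>win p. if agree j x x' then lev j else 0) \<le> card (patterns p) * M * width p" .
    show "(\<Sum>x'\<in>patterns p. (if x' = x then 1 else 0) + (\<Sum>j\<in>win p. if agree j x x' then lev j else 0))
      \<le> card (patterns p) * (M * (width p + 1))"
      unfolding sum.distrib using 1 2 by (simp add: algebra_simps)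
  next
    show "0 \<le> 2 * radius + 1" using rad0 by simp
    show "0 \<le> (\<Sum>x'\<in>patterns p. (if x' = x then 1 else 0) + (\<Sum>j\<in>win p. if agree j x x' then lev j else 0))"
      using lev0 by (intro sum_nonneg add_nonneg_nonneg) auto
  qed
  also have "\<dots> = card (choices p) * loss p"
  proof -
    have "real (card (choices p)) = real D powr real K * card (patterns p)"
    proof -
      have "real (card (choices p)) = real m * card (patterns p)"
        by (simp add: choices_eq card_cartesian_product)
      moreover have "real m = real D powr real K" using D_pos by (simp add: m powr_realpow)
      ultimately show ?thesis by metis
    qed
    moreover have "loss p = (2 * radius + 1) * (M * (width p + 1)) * real D powr (- real K)"
    proof -
      have "real D powr (\<gamma> * (real K - width p) - real K) = real D powr (\<gamma> * (real K - width p)) * real D powr (- real K)"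
        by (simp only: powr_add[symmetric] diff_conv_add_uminus)
      thus ?thesis by (simp add: loss_def M_def mult_ac)
    qed
    moreover have "real D powr real K * real D powr (- real K) = 1"
      using D_pos by (simp only: powr_add[symmetric]) simp
    ultimately show ?thesis by (simp add: mult_ac)
  qed
  finally show ?thesis unfolding T_def .
qed

text \<open>Rounding each summand separately changes the sum by at most
  \<open>(n + m) * \<delta> \<le> rad P\<close>. So the cells counted by
  \<open>exists_weight_many_cells\<close> are elements of the sumset of the rounded dilates, the set
  that the Pluennecke inequality controls.\<close>

lemma exists_large_sumset:
  assumes finB: "finite B" and bB: "\<And>\<omega>. \<omega> \<subseteq> S \<Longrightarrow> b \<omega> \<in> B"
  obtains c where "c \<in> PiE {..<n} (\<lambda>_. C)"
    "(\<Prod>p<P. 1 / loss p) \<le> card (\<Sum>i<n + m. (\<lambda>x. \<lfloor>(if i < n then c i else c\<^sub>0) * x / \<delta>\<rfloor>) ` B)"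
proof -
  define z where "z c f = (\<Sum>i<n. \<lfloor>c i * b (bits i P f) / \<delta>\<rfloor>) + (\<Sum>i<m. \<lfloor>c\<^sub>0 * b (steps i P f) / \<delta>\<rfloor>)" for c f
  have fl: "\<bar>t - \<delta> * \<lfloor>t / \<delta>\<rfloor>\<bar> \<le> \<delta>" for t
  proof -
    have "t - \<delta> * \<lfloor>t / \<delta>\<rfloor> = \<delta> * (t / \<delta> - \<lfloor>t / \<delta>\<rfloor>)" using \<delta> by (simp add: right_diff_distrib)
    also have "\<bar>\<dots>\<bar> = \<delta> * \<bar>t / \<delta> - \<lfloor>t / \<delta>\<rfloor>\<bar>" using \<delta> by (simp add: abs_mult)
    also have "\<dots> \<le> \<delta> * 1" using \<delta> by (intro mult_left_mono) linarith+
    finally show ?thesis by simp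
  qed
  have "\<exists>c\<in>PiE {..<n} (\<lambda>_. C). (\<Prod>p<P. 1 / loss p) \<le> card (z c ` PiE {..<P} choices)"
  proof (rule exists_weight_many_cells[where Y = Y and R = rad and W = weight and r = \<delta>])
    fix c f assume c: "c \<in> PiE {..<n} (\<lambda>_. C)" and f: "f \<in> PiE {..<P} choices"
    have "Y c P f - \<delta> * real_of_int (z c f) =
      (\<Sum>i<m. c\<^sub>0 * b (steps i P f) - \<delta> * \<lfloor>c\<^sub>0 * b (steps i P f) / \<delta>\<rfloor>) +
      (\<Sum>i<n. c i * b (bits i P f) - \<delta> * \<lfloor>c i * b (bits i P f) / \<delta>\<rfloor>)"
      by (simp add: Y_def z_def sum_subtractf sum_distrib_left distrib_left)
    also have "\<bar>\<dots>\<bar> \<le> (\<Sum>i<m. \<delta>) + (\<Sum>i<n. \<delta>)"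
      by (intro order_trans[OF abs_triangle_ineq] add_mono order_trans[OF sum_abs] sum_mono fl)
    also have "\<dots> = (real n + real m) * \<delta>" by (simp add: algebra_simps)
    also have "\<dots> \<le> rad P" by (rule rad_ge_delta) simp
    finally show "\<bar>Y c P f - \<delta> * real_of_int (z c f)\<bar> \<le> rad P" .
  next
    show "(\<Sum>c\<in>PiE {..<n} (\<lambda>_. C). weight c * near_count choices (Y c) rad p f) \<le> card (choices p) * loss p"
      if "p < P" "f \<in> PiE {..<Suc p} choices" for p f by (rule expected_near_count[OF that])
    show "Y c p f = Y c p g" if "\<And>i. i < p \<Longrightarrow> f i = g i" for c p f g using that by (rule Y_local)
    show "\<bar>Y c (Suc p) f - Y c p f\<bar> \<le> rad p - rad (Suc p)"
      if "c \<in> PiE {..<n} (\<lambda>_. C)" "p < P" "f \<in> PiE {..<Suc p} choices" for c p f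
      using that by (intro Y_step)
    show "finite (PiE {..<n} (\<lambda>_. C))" using C by (intro finite_PiE) auto
  qed (simp_all add: finite_choices choices_nonempty loss_pos weight_nonneg sum_weight rad_def)
  then obtain c where c: "c \<in> PiE {..<n} (\<lambda>_. C)" "(\<Prod>p<P. 1 / loss p) \<le> card (z c ` PiE {..<P} choices)" by blast
  define F where "F i = (\<lambda>x. \<lfloor>(if i < n then c i else c\<^sub>0) * x / \<delta>\<rfloor>) ` B" for i
  have "z c ` PiE {..<P} choices \<subseteq> (\<Sum>i<n + m. F i)"
  proof (rule image_subsetI)
    fix f assume f: "f \<in> PiE {..<P} choices"
    define g where "g i = (if i < n then \<lfloor>c i * b (bits i P f) / \<delta>\<rfloor> else \<lfloor>c\<^sub>0 * b (steps (i - n) P f) / \<delta>\<rfloor>)" for i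
    have split: "(\<Sum>i<n + k. g i) = (\<Sum>i<n. g i) + (\<Sum>i<k. g (n + i))" for k
      by (induction k) simp_all
    have "z c f = (\<Sum>i<n + m. g i)" unfolding split by (simp add: z_def g_def)
    also have "\<dots> \<in> (\<Sum>i<n + m. F i)"
    proof (rule sum_in_sumset)
      fix i
      have "b (bits i P f) \<in> B" if "i < n"
        using f that by (intro bB bits_sub(1)) (auto simp: PiE_iff)
      moreover have "b (steps (i - n) P f) \<in> B" by (intro bB steps_sub(1)) simp
      ultimately show "g i \<in> F i" by (auto simp: g_def F_def)
    qed simp
    finally show "z c f \<in> (\<Sum>i<n + m. F i)" .
  qed
  moreover have "finite (\<Sum>i<k. F i)" for k
    by (induction k) (auto simp: F_def finB set_zero intro!: finite_set_plus)
  ultimately have "card (z c ` PiE {..<P} choices) \<le> card (\<Sum>i<n + m. F i)" by (intro card_mono)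
  with c(2) have "(\<Prod>p<P. 1 / loss p) \<le> card (\<Sum>i<n + m. F i)" by linarith
  thus ?thesis using that[OF c(1)] unfolding F_def by blast
qed

text \<open>Up to errors the exponent is \<open>K + \<gamma> * (width p - K)\<close>, and
  \<open>sparse\<close> allows \<open>K\<close> to be replaced by the number of elements of
  \<open>S\<close>. The three errors of size at most \<open>s * width p\<close> come from the
  constants of \<open>loss\<close>, from its factor \<open>width p + 1\<close>, and from this
  replacement.\<close>

lemma inverse_loss_ge:
  fixes s :: real
  assumes p: "p < P" and s: "0 \<le> s" "(2 * radius + 1) * (320 * real D) \<le> real D powr (s * real K)" "2 \<le> real D powr s"
    and sparse: "Q * card (S \<inter> win p) \<le> Q * K + (\<tau> (Suc p) - \<tau> p)" and Q: "1 \<le> s * real Q"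
  shows "real D powr ((1 - \<gamma>) * card (S \<inter> win p) + (\<gamma> - 3 * s) * width p) \<le> 1 / loss p"
proof -
  define k where "k = real (card (S \<inter> win p))"
  have w: "width p = real (\<tau> (Suc p) - \<tau> p)" "real K \<le> width p"
    using tau_less[OF p] step[OF p] by (auto simp: width_def of_nat_diff)
  have "width p + 1 \<le> 2 ^ (\<tau> (Suc p) - \<tau> p)"
    unfolding w(1) using less_exp[of "\<tau> (Suc p) - \<tau> p"] by (metis Suc_leI of_nat_Suc of_nat_le_iff of_nat_numeral of_nat_power add.commute)
  also have "\<dots> = 2 powr width p" by (simp add: w(1) powr_realpow)
  also have "\<dots> \<le> (real D powr s) powr width p" using s w by (intro powr_mono2) auto
  finally have w1: "width p + 1 \<le> real D powr (s * width p)" by (simp add: powr_powr)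
  have rad0: "0 \<le> radius" unfolding radius_def using c0 by simp
  have "loss p = ((2 * radius + 1) * (320 * real D)) * (width p + 1) * real D powr (\<gamma> * (real K - width p) - real K)"
    unfolding loss_def by (simp only: mult_ac)
  also have "\<dots> \<le> real D powr (s * real K) * real D powr (s * width p) * real D powr (\<gamma> * (real K - width p) - real K)"
    using s w1 width_pos[OF p] by (intro mult_right_mono mult_mono) auto
  also have "\<dots> = real D powr (s * real K + s * width p + \<gamma> * (real K - width p) - real K)"
    by (simp add: powr_add[symmetric] algebra_simps)
  also have "\<dots> \<le> real D powr (- ((1 - \<gamma>) * k + (\<gamma> - 3 * s) * width p))"
  proof (rule powr_mono)
    have "real (Q * card (S \<inter> win p)) \<le> real (Q * K + (\<tau> (Suc p) - \<tau> p))" using sparse by (simp only: of_nat_le_iff)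
    hence "real Q * k \<le> real Q * real K + width p" by (simp add: k_def w(1))
    hence "s * (real Q * k) \<le> s * (real Q * real K + width p)" using s(1) by (rule mult_left_mono)
    hence a: "(s * real Q) * (k - real K) \<le> s * width p" by (simp add: algebra_simps)
    have "k - real K \<le> s * width p"
    proof (cases "k \<le> real K")
      case True
      moreover have "0 \<le> s * width p" using s(1) width_pos[OF p] by simp
      ultimately show ?thesis by linarith
    next
      case False
      hence "1 * (k - real K) \<le> (s * real Q) * (k - real K)" using Q by (intro mult_right_mono) auto
      from order_trans[OF this a] show ?thesis by simp
    qed
    hence "(1 - \<gamma>) * (k - real K) \<le> (1 - \<gamma>) * (s * width p)" using \<gamma> by (intro mult_left_mono) auto
    also have "\<dots> \<le> 1 * (s * width p)" using \<gamma> s(1) width_pos[OF p] by (intro mult_right_mono) auto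
    finally have b: "(1 - \<gamma>) * k \<le> (1 - \<gamma>) * real K + s * width p" by (simp add: algebra_simps)
    have "s * real K \<le> s * width p" using s(1) w(2) by (intro mult_left_mono) auto
    thus "s * real K + s * width p + \<gamma> * (real K - width p) - real K \<le> - ((1 - \<gamma>) * k + (\<gamma> - 3 * s) * width p)"
      using b by (simp add: algebra_simps)
    show "1 \<le> real D" by (rule D_pos)
  qed
  finally have "loss p \<le> 1 / real D powr ((1 - \<gamma>) * k + (\<gamma> - 3 * s) * width p)"
    by (simp only: powr_minus_divide)
  moreover have "0 < real D powr ((1 - \<gamma>) * k + (\<gamma> - 3 * s) * width p)" using D_pos by simp
  ultimately have "loss p * real D powr ((1 - \<gamma>) * k + (\<gamma> - 3 * s) * width p) \<le> 1"
    by (simp only: pos_le_divide_eq)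
  thus ?thesis unfolding k_def pos_le_divide_eq[OF loss_pos[OF p]] by (simp only: mult.commute)
qed

lemma prod_inverse_loss_ge:
  fixes s :: real
  assumes s: "0 \<le> s" "(2 * radius + 1) * (320 * real D) \<le> real D powr (s * real K)" "2 \<le> real D powr s"
    and sparse: "\<And>p. p < P \<Longrightarrow> Q * card (S \<inter> win p) \<le> Q * K + (\<tau> (Suc p) - \<tau> p)" and Q: "1 \<le> s * real Q"
  shows "real D powr ((1 - \<gamma>) * card (S \<inter> {\<tau> 0..<\<tau> P}) + (\<gamma> - 3 * s) * (real (\<tau> P) - real (\<tau> 0))) \<le> (\<Prod>p<P. 1 / loss p)"
proof -
  have "p \<le> P \<Longrightarrow> \<tau> 0 \<le> \<tau> p \<and> real D powr ((1 - \<gamma>) * card (S \<inter> {\<tau> 0..<\<tau> p}) + (\<gamma> - 3 * s) * (real (\<tau> p) - real (\<tau> 0))) \<le> (\<Prod>q<p. 1 / loss q)" for p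
  proof (induction p)
    case 0
    show ?case using D_pos by simp
  next
    case (Suc p)
    hence p: "p < P" and IH: "\<tau> 0 \<le> \<tau> p"
      "real D powr ((1 - \<gamma>) * card (S \<inter> {\<tau> 0..<\<tau> p}) + (\<gamma> - 3 * s) * (real (\<tau> p) - real (\<tau> 0))) \<le> (\<Prod>q<p. 1 / loss q)"
      by auto
    have le: "\<tau> p \<le> \<tau> (Suc p)" using tau_less[OF p] by simp
    have "card (S \<inter> {\<tau> 0..<\<tau> (Suc p)}) = card (S \<inter> {\<tau> 0..<\<tau> p}) + card (S \<inter> win p)"
      unfolding win_def by (rule card_Int_atLeastLessThan_add[OF IH(1) le])
    hence "(1 - \<gamma>) * card (S \<inter> {\<tau> 0..<\<tau> (Suc p)}) + (\<gamma> - 3 * s) * (real (\<tau> (Suc p)) - real (\<tau> 0)) =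
      ((1 - \<gamma>) * card (S \<inter> {\<tau> 0..<\<tau> p}) + (\<gamma> - 3 * s) * (real (\<tau> p) - real (\<tau> 0))) +
      ((1 - \<gamma>) * card (S \<inter> win p) + (\<gamma> - 3 * s) * width p)"
      by (simp add: width_def algebra_simps)
    hence "real D powr ((1 - \<gamma>) * card (S \<inter> {\<tau> 0..<\<tau> (Suc p)}) + (\<gamma> - 3 * s) * (real (\<tau> (Suc p)) - real (\<tau> 0))) =
      real D powr ((1 - \<gamma>) * card (S \<inter> {\<tau> 0..<\<tau> p}) + (\<gamma> - 3 * s) * (real (\<tau> p) - real (\<tau> 0))) *
      real D powr ((1 - \<gamma>) * card (S \<inter> win p) + (\<gamma> - 3 * s) * width p)"
      by (simp only: powr_add)
    also have "\<dots> \<le> (\<Prod>q<p. 1 / loss q) * (1 / loss p)"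
      using IH(2) inverse_loss_ge[OF p s sparse[OF p] Q] by (intro mult_mono) (auto intro: order_trans[OF powr_ge_zero])
    finally show ?case using IH(1) le by simp
  qed
  thus ?thesis by blast
qed

end

section \<open>Choice of the constants\<close>

text \<open>Two points in one cell differ by at most its length, and cell numbers that differ by at
  least 2 leave a whole cell between the points. This turns the two integer conditions of a coding
  into the upper and lower bounds for real differences.\<close>

lemma real_binary_coding:
  fixes B :: "real set" and \<delta> \<theta> :: real
  assumes \<delta>: "\<delta> = 1 / 2 ^ k" and D: "D = 2 ^ d" and d: "0 < d" and N: "N = k div d" and t: "t \<le> N"
    and B: "B \<subseteq> (\<lambda>x. \<delta> * x) ` \<int> \<inter> {0..1}" "B \<noteq> {}"
    and \<theta>: "\<And>x. card (B \<inter> ball x (1 / real D ^ t)) \<le> \<theta> * card B"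
  obtains R S b where "R \<subseteq> {..<t}" "S \<subseteq> {t..<N}" "\<And>\<omega>. \<omega> \<subseteq> R \<union> S \<Longrightarrow> b \<omega> \<in> B"
    "\<And>\<omega> \<omega>' i. \<omega> \<subseteq> R \<union> S \<Longrightarrow> \<omega>' \<subseteq> R \<union> S \<Longrightarrow> i \<le> N \<Longrightarrow> \<omega> \<inter> {..<i} = \<omega>' \<inter> {..<i} \<Longrightarrow>
        \<bar>b \<omega> - b \<omega>'\<bar> \<le> 1 / real D ^ i"
    "\<And>\<omega> \<omega>' i. \<omega> \<subseteq> R \<union> S \<Longrightarrow> \<omega>' \<subseteq> R \<union> S \<Longrightarrow> i \<in> R \<union> S \<Longrightarrow> \<omega> \<inter> {..<i} = \<omega>' \<inter> {..<i} \<Longrightarrow>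
        i \<notin> \<omega> \<Longrightarrow> i \<in> \<omega>' \<Longrightarrow> 1 / real D ^ Suc i \<le> b \<omega>' - b \<omega>"
    "1 \<le> \<theta> * (4 * 8 ^ N * real D ^ card R)"
    "card B \<le> 4 * D ^ Suc t * 4 ^ N * D ^ card S"
proof -
  define q :: nat where "q = 2 ^ (k mod d)"
  have q: "0 < q" "q \<le> D" using d by (auto simp: q_def D intro!: power_increasing)
  have D2: "2 \<le> D" using d by (simp add: D self_le_power)
  have D0: "real D > 0" using D2 by simp
  have qDN: "q * D ^ N = 2 ^ k"
    unfolding q_def D N by (simp add: power_mult[symmetric] power_add[symmetric])
  have \<delta>0: "0 < \<delta>" by (simp add: \<delta>)
  have mesh: "\<delta> * real (q * D ^ (N - i)) = 1 / real D ^ i" if "i \<le> N" for i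
  proof -
    have "q * D ^ (N - i) * D ^ i = 2 ^ k"
      using that by (simp only: mult.assoc power_add[symmetric] le_add_diff_inverse2 qDN)
    hence "real (q * D ^ (N - i)) * real D ^ i = 2 ^ k" by (metis of_nat_mult of_nat_numeral of_nat_power)
    thus ?thesis using D0 by (simp add: \<delta> field_simps)
  qed
  define B0 where "B0 = (\<lambda>x. nat \<lfloor>x / \<delta>\<rfloor>) ` B"
  have reconstruct: "\<delta> * real (nat \<lfloor>x / \<delta>\<rfloor>) = x" if xB: "x \<in> B" for x
  proof -
    have "x \<in> (\<lambda>x. \<delta> * x) ` \<int> \<inter> {0..1}" using B(1) xB by blast
    then obtain z where z: "z \<in> \<int>" "x = \<delta> * z" "0 \<le> x" by auto
    then obtain y :: int where y: "z = of_int y" by (auto elim: Ints_cases)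
    have "0 \<le> y" using z y \<delta>0 by (simp add: zero_le_mult_iff)
    thus ?thesis using z(2) y \<delta>0 by simp
  qed
  have inj: "inj_on (\<lambda>x. nat \<lfloor>x / \<delta>\<rfloor>) B" by (rule inj_on_inverseI[of _ "\<lambda>y. \<delta> * real y"]) (rule reconstruct)
  have cB0: "card B0 = card B" unfolding B0_def by (rule card_image[OF inj])
  have mem0: "\<delta> * real y \<in> B" if "y \<in> B0" for y using that reconstruct by (auto simp: B0_def)
  have B0: "B0 \<subseteq> {..q * D ^ N}"
  proof
    fix y assume "y \<in> B0"
    hence "\<delta> * real y \<in> {0..1}" using mem0 B(1) by blast
    hence "\<delta> * real y \<le> 1" by simp
    hence "real y \<le> real (2 ^ k)" by (simp add: \<delta> field_simps)
    thus "y \<in> {..q * D ^ N}" unfolding qDN by (simp only: of_nat_le_iff atMost_iff)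
  qed
  have finB: "finite B" using finite_imageD[OF finite_subset[OF B0 finite_atMost, unfolded B0_def] inj] .
  have \<theta>0: "real (card {y\<in>B0. cell q D N t y = v}) \<le> \<theta> * card B0" for v
  proof -
    \<comment> \<open>The left endpoint of the cell. A cell is half-open, so it lies in the open
      ball about \<open>x\<close> whose radius is the length of the cell.\<close>
    define x where "x = \<delta> * (real v * real (q * D ^ (N - t)))"
    have "(\<lambda>y. \<delta> * real y) ` {y\<in>B0. cell q D N t y = v} \<subseteq> B \<inter> ball x (1 / real D ^ t)"
    proof (rule image_subsetI)
      fix y assume y: "y \<in> {y\<in>B0. cell q D N t y = v}"
      define M where "M = q * D ^ (N - t)"
      have M: "0 < M" using q D2 by (simp add: M_def)
      have "y div M = v" using y by (simp add: cell_def M_def)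
      hence "v * M \<le> y" "y < v * M + M"
        using dividend_less_div_times[OF M, of y] div_times_less_eq_dividend[of y M] by auto
      hence "real v * real M \<le> real y" "real y < real v * real M + real M"
        by (metis of_nat_le_iff of_nat_mult, metis of_nat_less_iff of_nat_mult of_nat_add)
      hence "\<delta> * (real v * real M) \<le> \<delta> * real y" "\<delta> * real y < \<delta> * (real v * real M + real M)"
        using \<delta>0 by simp_all
      hence "\<bar>x - \<delta> * real y\<bar> < \<delta> * real M" by (simp add: x_def M_def[symmetric] distrib_left)
      thus "\<delta> * real y \<in> B \<inter> ball x (1 / real D ^ t)"
        using mem0 y mesh[OF t] by (simp add: M_def dist_real_def)
    qed
    hence "card ((\<lambda>y. \<delta> * real y) ` {y\<in>B0. cell q D N t y = v}) \<le> card (B \<inter> ball x (1 / real D ^ t))"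
      using finB by (intro card_mono) auto
    also have "card ((\<lambda>y. \<delta> * real y) ` {y\<in>B0. cell q D N t y = v}) = card {y\<in>B0. cell q D N t y = v}"
      using \<delta>0 by (intro card_image inj_onI) simp
    finally show ?thesis using \<theta>[of x] cB0 by simp
  qed
  have "B0 \<noteq> {}" using B(2) by (simp add: B0_def)
  then obtain R S v \<phi> where \<phi>: "R \<subseteq> {..<t}" "S \<subseteq> {t..<N}" "binary_coding q D N B0 0 (R \<union> S) v \<phi>"
    "1 \<le> \<theta> * (4 * 8 ^ N * real D ^ card R)" "card B0 \<le> 4 * D ^ Suc t * 4 ^ N * D ^ card S"
    by (rule exists_binary_coding[OF q D2 t B0 _ \<theta>0])
  note code = binary_codingD[OF \<phi>(3)]
  show ?thesis
  proof (rule that[of R S "\<lambda>\<omega>. \<delta> * real (\<phi> \<omega>)"])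
    show "\<delta> * real (\<phi> \<omega>) \<in> B" if "\<omega> \<subseteq> R \<union> S" for \<omega> using code(1)[OF that] by (rule mem0)
  next
    fix \<omega> \<omega>' i assume *: "\<omega> \<subseteq> R \<union> S" "\<omega>' \<subseteq> R \<union> S" "i \<le> N" "\<omega> \<inter> {..<i} = \<omega>' \<inter> {..<i}"
    define M where "M = q * D ^ (N - i)"
    have M: "0 < M" using q D2 by (simp add: M_def)
    have eq: "\<phi> \<omega> div M = \<phi> \<omega>' div M" using code(3)[OF *(1,2) _ *(3,4)] by (simp add: cell_def M_def)
    have "\<phi> \<omega> \<le> \<phi> \<omega>' + M" "\<phi> \<omega>' \<le> \<phi> \<omega> + M"
      using dividend_less_div_times[OF M, of "\<phi> \<omega>"] div_times_less_eq_dividend[of "\<phi> \<omega>" M]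
        dividend_less_div_times[OF M, of "\<phi> \<omega>'"] div_times_less_eq_dividend[of "\<phi> \<omega>'" M]
      unfolding eq by linarith+
    hence close: "\<bar>real (\<phi> \<omega>) - real (\<phi> \<omega>')\<bar> \<le> real M" by linarith
    have "\<bar>\<delta> * real (\<phi> \<omega>) - \<delta> * real (\<phi> \<omega>')\<bar> = \<delta> * \<bar>real (\<phi> \<omega>) - real (\<phi> \<omega>')\<bar>"
      using \<delta>0 by (simp add: right_diff_distrib[symmetric] abs_mult)
    also have "\<dots> \<le> \<delta> * real M"
      using close \<delta>0 by (intro mult_left_mono) auto
    also have "\<dots> = 1 / real D ^ i" unfolding M_def by (rule mesh[OF *(3)])
    finally show "\<bar>\<delta> * real (\<phi> \<omega>) - \<delta> * real (\<phi> \<omega>')\<bar> \<le> 1 / real D ^ i" .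
  next
    fix \<omega> \<omega>' i assume *: "\<omega> \<subseteq> R \<union> S" "\<omega>' \<subseteq> R \<union> S" "i \<in> R \<union> S" "\<omega> \<inter> {..<i} = \<omega>' \<inter> {..<i}" "i \<notin> \<omega>" "i \<in> \<omega>'"
    define M where "M = q * D ^ (N - Suc i)"
    have M: "0 < M" using q D2 by (simp add: M_def)
    have iN: "Suc i \<le> N" using *(3) \<phi>(1,2) t by auto
    have "\<phi> \<omega> div M + 2 \<le> \<phi> \<omega>' div M" using code(4)[OF *] by (simp add: cell_def M_def)
    hence "(\<phi> \<omega> div M + 2) * M \<le> \<phi> \<omega>' div M * M" by (rule mult_right_mono) simp
    hence "\<phi> \<omega> div M * M + 2 * M \<le> \<phi> \<omega>' div M * M" by (simp only: add_mult_distrib)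
    hence "\<phi> \<omega> + M \<le> \<phi> \<omega>'"
      using dividend_less_div_times[OF M, of "\<phi> \<omega>"] div_times_less_eq_dividend[of "\<phi> \<omega>'" M] by linarith
    hence "real M \<le> real (\<phi> \<omega>') - real (\<phi> \<omega>)" by linarith
    hence "\<delta> * real M \<le> \<delta> * (real (\<phi> \<omega>') - real (\<phi> \<omega>))" using \<delta>0 by simp
    also have "\<delta> * real M = 1 / real D ^ Suc i" unfolding M_def by (rule mesh[OF iN])
    finally show "1 / real D ^ Suc i \<le> \<delta> * real (\<phi> \<omega>') - \<delta> * real (\<phi> \<omega>)"
      by (simp only: right_diff_distrib)
  qed (use \<phi> cB0 in auto)
qed

section \<open>From covering numbers to the long sum\<close>

lemma card_floor_le_dyadic_covering_number:
  fixes \<delta> :: real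
  assumes \<delta>: "0 < \<delta>" and fin: "finite E"
  shows "card ((\<lambda>x. \<lfloor>x / \<delta>\<rfloor>) ` E) \<le> dyadic_covering_number \<delta> E"
proof -
  define I where "I k = {real_of_int k * \<delta> ..< (real_of_int k + 1) * \<delta>}" for k
  have memI: "y \<in> I k \<longleftrightarrow> \<lfloor>y / \<delta>\<rfloor> = k" for y k
    using \<delta> by (auto simp: I_def floor_eq_iff field_simps)
  have "\<exists>n \<I>. \<I> \<subseteq> dyadic_intervals \<delta> \<and> finite \<I> \<and> card \<I> = n \<and> E \<subseteq> \<Union>\<I>"
  proof (intro exI conjI)
    show "(\<lambda>x. I \<lfloor>x / \<delta>\<rfloor>) ` E \<subseteq> dyadic_intervals \<delta>" by (auto simp: dyadic_intervals_def I_def)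
    show "E \<subseteq> \<Union>((\<lambda>x. I \<lfloor>x / \<delta>\<rfloor>) ` E)" using memI by auto
  qed (use fin in auto)
  from LeastI_ex[OF this] obtain \<I> where \<I>: "\<I> \<subseteq> dyadic_intervals \<delta>" "finite \<I>"
    "card \<I> = dyadic_covering_number \<delta> E" "E \<subseteq> \<Union>\<I>"
    unfolding dyadic_covering_number_def by blast
  have "I ` (\<lambda>x. \<lfloor>x / \<delta>\<rfloor>) ` E \<subseteq> \<I>"
  proof (clarify)
    fix x assume "x \<in> E"
    then obtain J where J: "J \<in> \<I>" "x \<in> J" using \<I>(4) by blast
    then obtain k where k: "J = I k" using \<I>(1) by (auto simp: dyadic_intervals_def I_def)
    thus "I \<lfloor>x / \<delta>\<rfloor> \<in> \<I>" using J memI by auto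
  qed
  hence "card (I ` (\<lambda>x. \<lfloor>x / \<delta>\<rfloor>) ` E) \<le> card \<I>" using \<I>(2) by (intro card_mono)
  moreover have "inj I"
  proof (rule injI)
    fix k l assume eq: "I k = I l"
    have "\<lfloor>real_of_int k * \<delta> / \<delta>\<rfloor> = k" using \<delta> by simp
    hence "real_of_int k * \<delta> \<in> I l" using memI eq by metis
    thus "k = l" using memI \<delta> by simp
  qed
  hence "card (I ` (\<lambda>x. \<lfloor>x / \<delta>\<rfloor>) ` E) = card ((\<lambda>x. \<lfloor>x / \<delta>\<rfloor>) ` E)"
    by (intro card_image) (auto intro: inj_on_subset)
  ultimately show ?thesis using \<I>(3) by simp
qed

text \<open>Each \<open>A' i\<close> misses at most a proportion \<open>1 / (2 * h)\<close> of
  \<open>A\<close>, so their intersection \<open>X\<close> keeps half of \<open>A\<close>, and all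
  \<open>h\<close> bounds hold for \<open>X\<close> at once. Points of \<open>A\<close> lie on the
  grid, so rounding commutes with adding them; this makes \<open>Z + F i\<close> a set of rounded
  points of \<open>A' i + e i * B\<close>.\<close>

lemma card_long_sum_le:
  fixes A B :: "real set" and \<delta> M :: real and A' :: "nat \<Rightarrow> real set"
  assumes \<delta>: "0 < \<delta>" and A: "A \<subseteq> (\<lambda>x. \<delta> * x) ` \<int>" "finite A" "A \<noteq> {}" and B: "finite B" and h: "0 < h"
    and A': "\<And>i. i < h \<Longrightarrow> A' i \<subseteq> A" "\<And>i. i < h \<Longrightarrow> (1 - 1 / (2 * real h)) * card A \<le> card (A' i)"
    and small: "\<And>i. i < h \<Longrightarrow> real (dyadic_covering_number \<delta> (A' i + (\<lambda>b. e i * b) ` B)) \<le> M * card A"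
  shows "real (card (\<Sum>i<h. (\<lambda>b. \<lfloor>e i * b / \<delta>\<rfloor>) ` B)) \<le> (2 * real h * M) ^ h * card A"
proof -
  define X where "X = A - (\<Union>i<h. A - A' i)"
  define F where "F i = (\<lambda>b. \<lfloor>e i * b / \<delta>\<rfloor>) ` B" for i
  define G where "G = (\<Union>i<h. F i)"
  have finA': "finite (A' i)" if "i < h" for i using A'(1)[OF that] A(2) by (rule finite_subset)
  have XA: "X \<subseteq> A" "\<And>i. i < h \<Longrightarrow> X \<subseteq> A' i" by (auto simp: X_def)
  have finX: "finite X" using XA(1) A(2) by (rule finite_subset)
  have cA: "0 < real (card A)" using A by (simp add: card_gt_0_iff)
  have "card (\<Union>i<h. A - A' i) \<le> (\<Sum>i<h. card (A - A' i))" by (intro card_UN_le) simp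
  hence "real (card (\<Union>i<h. A - A' i)) \<le> (\<Sum>i<h. real (card (A - A' i)))" by (metis of_nat_le_iff of_nat_sum)
  also have "\<dots> \<le> (\<Sum>i<h. card A / (2 * real h))"
  proof (intro sum_mono)
    fix i assume i: "i \<in> {..<h}"
    have "real (card (A - A' i)) = real (card A) - card (A' i)"
      using A'(1)[of i] i A(2) finA'[of i] by (simp add: card_Diff_subset card_mono of_nat_diff)
    also have "\<dots> \<le> card A / (2 * real h)" using A'(2)[of i] i by (simp add: left_diff_distrib)
    finally show "real (card (A - A' i)) \<le> card A / (2 * real h)" .
  qed
  also have "\<dots> = card A / 2" using h by simp
  finally have bad: "real (card (\<Union>i<h. A - A' i)) \<le> card A / 2" .
  have "card A \<le> card X + card (\<Union>i<h. A - A' i)"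
  proof -
    have "A \<subseteq> X \<union> (\<Union>i<h. A - A' i)" by (auto simp: X_def)
    hence "card A \<le> card (X \<union> (\<Union>i<h. A - A' i))" using finX A(2) by (intro card_mono) auto
    also have "\<dots> \<le> card X + card (\<Union>i<h. A - A' i)" by (rule card_Un_le)
    finally show ?thesis .
  qed
  hence "real (card A) \<le> card X + real (card (\<Union>i<h. A - A' i))" by (metis of_nat_add of_nat_le_iff)
  hence cX: "real (card A) \<le> 2 * card X" using bad by linarith
  have Xne: "X \<noteq> {}" using cX cA by auto
  define Z where "Z = (\<lambda>a. \<lfloor>a / \<delta>\<rfloor>) ` X"
  have grid: "\<delta> * real_of_int \<lfloor>a / \<delta>\<rfloor> = a" if aX: "a \<in> X" for a
  proof -
    have "a \<in> (\<lambda>x. \<delta> * x) ` \<int>" using A(1) XA(1) aX by blast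
    then obtain z where "a = \<delta> * z" "z \<in> \<int>" by blast
    thus ?thesis using \<delta> by (auto elim!: Ints_cases)
  qed
  have "inj_on (\<lambda>a. \<lfloor>a / \<delta>\<rfloor>) X" by (rule inj_on_inverseI[of _ "\<lambda>y. \<delta> * real_of_int y"]) (rule grid)
  hence cZ: "card Z = card X" unfolding Z_def by (rule card_image)
  have finF: "finite (F i)" for i using B by (simp add: F_def)
  have part: "real (card (Z + F i)) \<le> M * card A" if i: "i < h" for i
  proof -
    define E where "E = A' i + (\<lambda>b. e i * b) ` B"
    have finE: "finite E" using finA'[OF i] B by (auto simp: E_def intro!: finite_set_plus)
    have "Z + F i \<subseteq> (\<lambda>x. \<lfloor>x / \<delta>\<rfloor>) ` E"
    proof
      fix z assume "z \<in> Z + F i"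
      then obtain a b where ab: "a \<in> X" "b \<in> B" "z = \<lfloor>a / \<delta>\<rfloor> + \<lfloor>e i * b / \<delta>\<rfloor>"
        by (auto simp: set_plus_def Z_def F_def)
      have "a / \<delta> = real_of_int \<lfloor>a / \<delta>\<rfloor>" using grid[OF ab(1)] \<delta> by (simp add: field_simps)
      hence "(a + e i * b) / \<delta> = e i * b / \<delta> + real_of_int \<lfloor>a / \<delta>\<rfloor>"
        by (metis add.commute add_divide_distrib)
      hence "z = \<lfloor>(a + e i * b) / \<delta>\<rfloor>" using ab(3) by (simp only: floor_add_int[symmetric])
      moreover have "a + e i * b \<in> E" using ab XA(2)[OF i] by (auto simp: E_def set_plus_def)
      ultimately show "z \<in> (\<lambda>x. \<lfloor>x / \<delta>\<rfloor>) ` E" by blast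
    qed
    hence "card (Z + F i) \<le> card ((\<lambda>x. \<lfloor>x / \<delta>\<rfloor>) ` E)" using finE by (intro card_mono) auto
    also have "\<dots> \<le> dyadic_covering_number \<delta> E" by (rule card_floor_le_dyadic_covering_number[OF \<delta> finE])
    finally have "real (card (Z + F i)) \<le> real (dyadic_covering_number \<delta> E)" by simp
    also have "\<dots> \<le> M * card A" unfolding E_def by (rule small[OF i])
    finally show ?thesis .
  qed
  have M0: "0 \<le> M"
  proof -
    have "0 \<le> M * card A" using small[OF h] by (rule order_trans[rotated]) simp
    thus ?thesis using cA by (simp add: zero_le_mult_iff)
  qed
  \<comment> \<open>Putting all rounded dilates into one set costs a factor \<open>h\<close>;
    comparing with \<open>X\<close> instead of \<open>A\<close> costs a factor 2.\<close>
  have "Z + G = (\<Union>i<h. Z + F i)" by (auto simp: G_def set_plus_def)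
  hence "card (Z + G) \<le> (\<Sum>i<h. card (Z + F i))" using card_UN_le[of "{..<h}" "\<lambda>i. Z + F i"] by simp
  hence "real (card (Z + G)) \<le> (\<Sum>i<h. real (card (Z + F i)))" by (metis of_nat_le_iff of_nat_sum)
  also have "\<dots> \<le> (\<Sum>i<h. M * card A)" by (intro sum_mono part) simp
  also have "\<dots> = real h * M * card A" by simp
  also have "\<dots> \<le> real h * M * (2 * card X)" using cX M0 by (intro mult_left_mono) auto
  finally have "real (card (Z + G)) \<le> (2 * real h * M) * card Z" by (simp add: cZ mult_ac)
  hence "real (card (\<Sum>i<h. F i)) \<le> (2 * real h * M) ^ h * card Z"
    using finX Xne finF by (intro plunnecke_sum[where B = G]) (auto simp: Z_def G_def)
  also have "\<dots> \<le> (2 * real h * M) ^ h * card A"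
    using card_mono[OF A(2) XA(1)] M0 by (intro mult_left_mono) (auto simp: cZ)
  finally show ?thesis by (simp only: F_def)
qed

lemma exists_nat_ge2: "\<exists>n::nat. 0 < n \<and> x \<le> real n \<and> y \<le> real n"
proof -
  obtain a b :: nat where "x \<le> real a" "y \<le> real b" using real_arch_simple by metis
  thus ?thesis by (intro exI[of _ "Suc (a + b)"]) auto
qed

text \<open>
  The constants are chosen in the order \<open>s\<close>, \<open>d\<close>, \<open>Q\<close>, \<open>K\<close>; every loss is at most a multiple of \<open>s l\<close>,
  where \<open>l\<close> is the number of \<open>D\<close>-adic scales between 1 and \<open>\<delta>\<close>.
\<close>

lemma long_sums:
  fixes \<beta> \<gamma> \<kappa> \<sigma> :: real
  assumes \<gamma>: "0 < \<gamma>" "\<gamma> \<le> 1" and \<kappa>: "0 < \<kappa>" and \<sigma>: "0 < \<sigma>" "\<sigma> \<le> 1"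
  shows "\<exists>\<epsilon>\<^sub>0 \<delta>\<^sub>0 h. 0 < \<epsilon>\<^sub>0 \<and> \<epsilon>\<^sub>0 \<le> 1 / 2 \<and> 0 < \<delta>\<^sub>0 \<and> 0 < h \<and>
    (\<forall>(k::nat) \<delta> (B :: real set) (\<nu> :: real measure).
      \<delta> = 1 / 2 ^ k \<longrightarrow> \<delta> \<le> \<delta>\<^sub>0 \<longrightarrow> B \<subseteq> (\<lambda>x. \<delta> * x) ` \<int> \<inter> {0..1} \<longrightarrow> finite B \<longrightarrow>
      \<delta> powr (- \<beta>) \<le> card B \<longrightarrow>
      (\<forall>x r. \<delta> \<le> r \<and> r \<le> \<delta> powr \<epsilon>\<^sub>0 \<longrightarrow> card (B \<inter> ball x r) \<le> r powr \<kappa> * card B) \<longrightarrow>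
      prob_space \<nu> \<longrightarrow> sets \<nu> = sets borel \<longrightarrow> spt \<nu> \<subseteq> {-1..1} \<longrightarrow>
      (\<forall>x r. \<delta> \<le> r \<longrightarrow> measure \<nu> (ball x r) \<le> 20 * r powr \<gamma>) \<longrightarrow>
      (\<exists>e. (\<forall>i<h. e i \<in> spt \<nu>) \<and>
        \<delta> powr (- (\<beta> + \<gamma> * (1 - \<beta>) - \<sigma> / 2)) \<le> card (\<Sum>i<(h::nat). (\<lambda>b. \<lfloor>e i * b / \<delta>\<rfloor>) ` B)))"
proof -
  \<comment> \<open>In \<open>expo\<close> the losses amount to at most \<open>7 * s * l\<close>,
    while \<open>\<sigma> / 2 * l = 16 * s * l\<close> is available. The bound
    \<open>s \<le> 1 / 32\<close> also keeps \<open>t\<close> below \<open>N\<close>.\<close>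
  define s where "s = \<sigma> / 32"
  have s: "0 < s" "s \<le> 1 / 32" using \<sigma> by (auto simp: s_def)
  \<comment> \<open>The bound \<open>1 / s\<close> gives \<open>2 \<le> D powr s\<close>, so that
    factors exponential in the number of scales, such as \<open>4 ^ N\<close>, cost only a multiple
    of \<open>s * l\<close> scales. The other bound lets \<open>D powr (\<kappa> * t)\<close> beat
    \<open>8 ^ N\<close> in \<open>Rlarge\<close>.\<close>
  obtain d :: nat where d: "0 < d" "1 / s \<le> real d" "10 / (\<kappa> * s) \<le> real d" using exists_nat_ge2 by blast
  have ds: "1 \<le> real d * s" "10 \<le> real d * (\<kappa> * s)" using d s \<kappa> by (simp_all add: field_simps)
  define D :: nat where "D = 2 ^ d"
  have D2: "2 \<le> D" using d by (simp add: D_def self_le_power)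
  have Dpow: "real D ^ j = 2 powr (real d * real j)" for j
    by (simp add: D_def powr_realpow[symmetric] powr_powr)
  have Dpowr: "real D powr y = 2 powr (real d * y)" for y
    by (simp add: D_def powr_realpow[symmetric] powr_powr)
  have Ds: "2 \<le> real D powr s" unfolding Dpowr using powr_mono[of 1 "real d * s" 2] ds by simp
  \<comment> \<open>The bound \<open>1 / s\<close> makes the elements of \<open>S\<close> in excess
    of \<open>K\<close> cost a proportion \<open>s\<close> of a window; the other one yields the
    contradiction in \<open>t0t\<close>.\<close>
  obtain Q :: nat where Q: "0 < Q" "1 / s \<le> real Q" "4 / (\<kappa> * s) \<le> real Q" using exists_nat_ge2 by blast
  have Qs: "1 \<le> s * real Q" "4 \<le> real Q * (\<kappa> * s)" using Q s \<kappa> by (simp_all add: field_simps)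
  define n where "n = d * Q"
  have n: "D ^ Q \<le> 2 ^ n" by (simp add: D_def n_def power_mult)
  \<comment> \<open>The interval of radius \<eta> about 0 has mass at most
    \<open>40 * \<eta> powr \<gamma> = 1 / 2\<close>, so some coefficient is at least \<eta> in
    absolute value. It becomes the fixed one, and \<eta> bounds from below how far its copies
    move.\<close>
  define \<eta> where "\<eta> = (1 / 80) powr (1 / \<gamma>)"
  have \<eta>: "0 < \<eta>" "\<eta> powr \<gamma> = 1 / 80" using \<gamma> by (auto simp: \<eta>_def powr_powr)
  define E0 where "E0 = (2 * ((8 + real n) * real D / \<eta>) + 1) * (320 * real D)"
  \<comment> \<open>\<open>E0\<close> is the part of \<open>loss\<close> that does not depend on the
    window. From \<open>E0 \<le> K\<close> follows
    \<open>E0 \<le> 2 ^ K \<le> D powr (s * K)\<close>, and \<open>n \<le> K\<close> gives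
    \<open>n \<le> D ^ K\<close>.\<close>
  obtain K :: nat where K: "0 < K" "real n \<le> real K" "E0 \<le> real K" using exists_nat_ge2 by blast
  have K2: "real K \<le> 2 ^ K" using less_exp[of K] by (metis of_nat_le_iff of_nat_numeral of_nat_power less_imp_le)
  have nm: "n \<le> D ^ K"
  proof -
    have "n \<le> K" using K(2) by simp
    also have "K \<le> 2 ^ K" using less_exp[of K] by simp
    also have "\<dots> \<le> D ^ K" using D2 by (rule power_mono) simp
    finally show ?thesis .
  qed
  have E0: "E0 \<le> real D powr (s * real K)"
  proof -
    have "E0 \<le> 2 ^ K" using K(3) K2 by linarith
    also have "\<dots> \<le> (real D powr s) ^ K" using Ds by (intro power_mono) auto
    also have "\<dots> = real D powr (s * real K)" using D2 by (simp add: powr_realpow[symmetric] powr_powr)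
    finally show ?thesis .
  qed
  \<comment> \<open>With at least \<open>L\<close> scales, every bounded number of scales lost is
    absorbed in \<open>s * l\<close>. The minimum with \<eta> in \<open>\<delta>\<^sub>0\<close>
    admits \<eta> as a radius in the Frostman bound.\<close>
  define L where "L = (real K + 6) / s + 4"
  define \<delta>\<^sub>0 where "\<delta>\<^sub>0 = min \<eta> (2 powr (- (real d * L)))"
  define h where "h = n + D ^ K"
  show ?thesis
  proof (rule exI[of _ s], rule exI[of _ \<delta>\<^sub>0], rule exI[of _ h], intro conjI allI impI)
    show "0 < s" "s \<le> 1 / 2" using s by auto
    show "0 < \<delta>\<^sub>0" using \<eta> by (simp add: \<delta>\<^sub>0_def)
    show "0 < h" using D2 by (simp add: h_def)
    fix k :: nat and \<delta> :: real and B :: "real set" and \<nu> :: "real measure"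
    assume \<delta>: "\<delta> = 1 / 2 ^ k" and \<delta>le: "\<delta> \<le> \<delta>\<^sub>0" and B: "B \<subseteq> (\<lambda>x. \<delta> * x) ` \<int> \<inter> {0..1}" and finB: "finite B"
      and cB: "\<delta> powr (- \<beta>) \<le> card B"
      and frB: "\<forall>x r. \<delta> \<le> r \<and> r \<le> \<delta> powr s \<longrightarrow> card (B \<inter> ball x r) \<le> r powr \<kappa> * card B"
      and prob: "prob_space \<nu>" and sets: "sets \<nu> = sets borel" and spt: "spt \<nu> \<subseteq> {-1..1}"
      and fr: "\<forall>x r. \<delta> \<le> r \<longrightarrow> measure \<nu> (ball x r) \<le> 20 * r powr \<gamma>"
    have \<delta>0: "0 < \<delta>" by (simp add: \<delta>)
    have \<delta>2: "\<delta> = 2 powr (- real k)" by (simp add: \<delta> powr_minus_divide powr_realpow)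
    define l where "l = real k / real d"
    have kl: "real k = real d * l" using d by (simp add: l_def)
    have lL: "L \<le> l"
    proof -
      have "2 powr (- real k) \<le> 2 powr (- (real d * L))" using \<delta>le by (simp add: \<delta>2 \<delta>\<^sub>0_def)
      hence "real d * L \<le> real k" by simp
      thus ?thesis using d by (simp add: l_def field_simps)
    qed
    have l: "4 \<le> l" "real K + 6 \<le> s * l"
    proof -
      have "0 \<le> (real K + 6) / s" using s by simp
      thus "4 \<le> l" using lL by (simp add: L_def)
      have "(real K + 6) / s \<le> l" using lL by (simp add: L_def)
      thus "real K + 6 \<le> s * l" using s by (simp add: field_simps)
    qed
    define N where "N = k div d"
    have N: "real N \<le> l" "l < real N + 1" and dN: "d * N \<le> k"
    proof -
      show "d * N \<le> k" by (simp add: N_def)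
      hence "real (d * N) \<le> real k" by (simp only: of_nat_le_iff)
      thus "real N \<le> l" using d by (simp add: l_def field_simps)
      have "k < d * (N + 1)" using dividend_less_div_times[OF d(1), of k] by (simp add: N_def algebra_simps)
      hence "real k < real (d * (N + 1))" by (simp only: of_nat_less_iff)
      thus "l < real N + 1" using d by (simp add: l_def field_simps)
    qed
    \<comment> \<open>The first level whose cells have length at most
      \<open>\<delta> powr s\<close>, so that the non-concentration of \<open>B\<close> applies to
      them.\<close>
    define t where "t = nat \<lceil>s * l\<rceil>"
    have t: "s * l \<le> real t" "real t \<le> s * l + 1"
    proof -
      have "0 \<le> s * l" using s l by simp
      thus "s * l \<le> real t" "real t \<le> s * l + 1" unfolding t_def by linarith+
    qed
    have sl: "s * l \<le> l / 32" using s l mult_right_mono[of s "1/32" l] by simp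
    have tN: "t \<le> N"
    proof -
      have "real t < real N + 1" using t(2) sl l(1) N(2) by linarith
      thus ?thesis by linarith
    qed
    define \<theta> where "\<theta> = real D powr (- \<kappa> * real t)"
    have \<theta>: "real (card (B \<inter> ball x (1 / real D ^ t))) \<le> \<theta> * card B" for x
    proof -
      have r: "1 / real D ^ t = 2 powr (- (real d * real t))" by (simp add: Dpow powr_minus_divide)
      have "real (d * t) \<le> real k" using tN dN by (metis mult_le_mono2 of_nat_le_iff order_trans)
      hence "\<delta> \<le> 1 / real D ^ t" unfolding r \<delta>2 by simp
      moreover have "1 / real D ^ t \<le> \<delta> powr s"
      proof -
        have "real d * (s * l) \<le> real d * real t" using t(1) by (intro mult_left_mono) auto
        hence "real k * s \<le> real d * real t" unfolding kl by (simp add: mult_ac)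
        thus ?thesis unfolding r \<delta>2 by (simp add: powr_powr)
      qed
      ultimately have "real (card (B \<inter> ball x (1 / real D ^ t))) \<le> (1 / real D ^ t) powr \<kappa> * card B"
        using frB by blast
      also have "(1 / real D ^ t) powr \<kappa> = \<theta>" unfolding r \<theta>_def Dpowr by (simp add: powr_powr mult_ac)
      finally show ?thesis .
    qed
    have cBpos: "0 < real (card B)" using cB by (rule less_le_trans[rotated]) (use \<delta>0 in simp)
    hence Bne: "B \<noteq> {}" by auto
    obtain R S b where RS: "R \<subseteq> {..<t}" "S \<subseteq> {t..<N}" and bB: "\<And>\<omega>. \<omega> \<subseteq> R \<union> S \<Longrightarrow> b \<omega> \<in> B"
      and b_near: "\<And>\<omega> \<omega>' i. \<omega> \<subseteq> R \<union> S \<Longrightarrow> \<omega>' \<subseteq> R \<union> S \<Longrightarrow> i \<le> N \<Longrightarrow> \<omega> \<inter> {..<i} = \<omega>' \<inter> {..<i} \<Longrightarrow>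
        \<bar>b \<omega> - b \<omega>'\<bar> \<le> 1 / real D ^ i"
      and b_far: "\<And>\<omega> \<omega>' i. \<omega> \<subseteq> R \<union> S \<Longrightarrow> \<omega>' \<subseteq> R \<union> S \<Longrightarrow> i \<in> R \<union> S \<Longrightarrow> \<omega> \<inter> {..<i} = \<omega>' \<inter> {..<i} \<Longrightarrow>
        i \<notin> \<omega> \<Longrightarrow> i \<in> \<omega>' \<Longrightarrow> 1 / real D ^ Suc i \<le> b \<omega>' - b \<omega>"
      and cR: "1 \<le> \<theta> * (4 * 8 ^ N * real D ^ card R)"
      and cS: "card B \<le> 4 * D ^ Suc t * 4 ^ N * D ^ card S"
    proof (rule real_binary_coding[OF \<delta> D_def d(1) N_def tN B Bne \<theta>], goal_cases)
      case (1 R S b)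
      show ?case by (rule 1(1)[of R S b]) (fact 1)+
    qed
    have p4: "(4::real) = 2 powr 2" "(8::real) ^ N = 2 powr (3 * real N)" "(4::real) ^ N = 2 powr (2 * real N)"
    proof -
      show "(4::real) = 2 powr 2" by simp
      have "(8::real) ^ N = (2 ^ 3) ^ N" by simp
      also have "\<dots> = 2 ^ (3 * N)" by (simp only: power_mult)
      also have "\<dots> = 2 powr (3 * real N)" by (simp add: powr_realpow[symmetric])
      finally show "(8::real) ^ N = 2 powr (3 * real N)" .
      have "(4::real) ^ N = (2 ^ 2) ^ N" by simp
      also have "\<dots> = 2 ^ (2 * N)" by (simp only: power_mult)
      also have "\<dots> = 2 powr (2 * real N)" by (simp add: powr_realpow[symmetric])
      finally show "(4::real) ^ N = 2 powr (2 * real N)" .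
    qed
    \<comment> \<open>A cell of level \<open>t\<close> holds at most a proportion
      \<open>D powr (- \<kappa> * t)\<close> of \<open>B\<close>, so many coarse cells are occupied.
      By the choice of \<open>d\<close>, half of the exponent survives the factor
      \<open>4 * 8 ^ N\<close>.\<close>
    have Rlarge: "\<kappa> * s * l / 2 \<le> real (card R)"
    proof -
      have "\<theta> * (4 * 8 ^ N * real D ^ card R) =
          2 powr (real d * (- \<kappa> * real t)) * (2 powr 2 * 2 powr (3 * real N) * 2 powr (real d * real (card R)))"
        unfolding \<theta>_def Dpowr Dpow p4(2) by simp
      also have "\<dots> = 2 powr (real d * (- \<kappa> * real t) + (2 + 3 * real N + real d * real (card R)))"
        by (simp only: powr_add)
      finally have "1 \<le> 2 powr (real d * (- \<kappa> * real t) + (2 + 3 * real N + real d * real (card R)))" using cR by simp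
      hence "2 powr 0 \<le> 2 powr (real d * (- \<kappa> * real t) + (2 + 3 * real N + real d * real (card R)))" by simp
      hence "0 \<le> real d * (- \<kappa> * real t) + (2 + 3 * real N + real d * real (card R))"
        by (subst (asm) powr_le_cancel_iff) auto
      hence 1: "real d * (\<kappa> * real t) \<le> 2 + 3 * real N + real d * real (card R)" by simp
      have "real d * (\<kappa> * (s * l)) \<le> real d * (\<kappa> * real t)" using t(1) \<kappa> by (intro mult_left_mono) auto
      moreover have "10 * l \<le> (real d * (\<kappa> * s)) * l" using ds(2) l(1) by (intro mult_right_mono) auto
      hence "10 * l \<le> real d * (\<kappa> * (s * l))" by (simp only: mult.assoc)
      ultimately have "real d * (\<kappa> * (s * l)) / 2 \<le> real d * real (card R)" using 1 N(1) l(1) by linarith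
      hence "real d * (\<kappa> * (s * l) / 2) \<le> real d * real (card R)" by simp
      hence "\<kappa> * (s * l) / 2 \<le> real (card R)" using d(1) by (simp only: mult_le_cancel_left_pos of_nat_0_less_iff)
      thus ?thesis by (simp only: mult.assoc)
    qed
    have Slarge: "\<beta> * l - (2 * s * l + 1) - real t - 1 \<le> real (card S)"
    proof -
      have "2 powr (real k * \<beta>) \<le> real (card B)" using cB by (simp add: \<delta>2 powr_powr)
      also have "\<dots> \<le> real (4 * D ^ Suc t * 4 ^ N * D ^ card S)" using cS by (simp only: of_nat_le_iff)
      also have "\<dots> = 4 * real D ^ Suc t * 4 ^ N * real D ^ card S" by simp
      also have "\<dots> = 2 powr 2 * 2 powr (real d * real (Suc t)) * 2 powr (2 * real N) * 2 powr (real d * real (card S))"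
        by (simp only: Dpow p4(3)) (simp only: p4(1))
      also have "\<dots> = 2 powr (2 + real d * real (Suc t) + 2 * real N + real d * real (card S))" by (simp only: powr_add)
      finally have "2 powr (real k * \<beta>) \<le> 2 powr (2 + real d * real (Suc t) + 2 * real N + real d * real (card S))" .
      hence "real k * \<beta> \<le> 2 + real d * real (Suc t) + 2 * real N + real d * real (card S)"
        by (subst (asm) powr_le_cancel_iff) auto
      hence "real d * (\<beta> * l) \<le> (2 + 2 * l) + real d * (real t + 1 + real (card S))"
        using N(1) unfolding kl by (simp add: algebra_simps)
      also have "2 + 2 * l \<le> (real d * s) * (2 + 2 * l)" using ds(1) l(1) mult_right_mono[of 1 "real d * s" "2 + 2 * l"] by simp
      also have "\<dots> = real d * (2 * s + 2 * s * l)" by (simp add: algebra_simps)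
      finally have "real d * (\<beta> * l) \<le> real d * (2 * s + 2 * s * l + (real t + 1 + real (card S)))" by (simp add: distrib_left)
      hence "\<beta> * l \<le> 2 * s + 2 * s * l + (real t + 1 + real (card S))" using d(1) by simp
      thus ?thesis using s by linarith
    qed
    obtain t0 where t0: "forward_dense Q N (R \<union> S) t0" "Q * card ((R \<union> S) \<inter> {0..<t0}) \<le> t0 - 0"
      by (rule next_forward_dense[of 0 N Q "R \<union> S"]) auto
    have t0N: "t0 \<le> N" using t0(1) by (simp add: forward_dense_def)
    \<comment> \<open>Otherwise all of \<open>R\<close> would lie in a stretch of density at most
      \<open>1 / Q\<close>, against \<open>Rlarge\<close>. Thus fewer than \<open>t\<close> scales
      are lost before the first window, and no element of \<open>S\<close>.\<close>
    have t0t: "t0 < t"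
    proof (rule ccontr)
      assume "\<not> t0 < t"
      hence "R \<subseteq> (R \<union> S) \<inter> {0..<t0}" using RS(1) by auto
      hence "card R \<le> card ((R \<union> S) \<inter> {0..<t0})" by (intro card_mono) auto
      hence "Q * card R \<le> N" using t0(2) t0N by (meson diff_le_self le_trans mult_le_mono2)
      hence "real (Q * card R) \<le> real N" by (simp only: of_nat_le_iff)
      hence "real Q * real (card R) \<le> l" using N(1) by simp
      moreover have "real Q * (\<kappa> * s * l / 2) \<le> real Q * real (card R)" using Rlarge by (intro mult_left_mono) auto
      moreover have "4 * l \<le> (real Q * (\<kappa> * s)) * l" using Qs(2) l(1) by (intro mult_right_mono) auto
      hence "2 * l \<le> real Q * (\<kappa> * s * l / 2)" by (simp add: mult_ac)
      ultimately show False using l(1) by linarith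
    qed
    obtain P and \<tau> :: "nat \<Rightarrow> nat" where \<tau>: "\<tau> 0 = t0" "\<And>p. p \<le> P \<Longrightarrow> forward_dense Q N (R \<union> S) (\<tau> p)"
      "\<And>p. p < P \<Longrightarrow> \<tau> p + K \<le> \<tau> (Suc p)"
      "\<And>p. p < P \<Longrightarrow> Q * card ((R \<union> S) \<inter> {\<tau> p..<\<tau> (Suc p)}) \<le> Q * K + (\<tau> (Suc p) - \<tau> p)"
      "N < \<tau> P + K"
      using exists_windows[OF K(1) t0(1)] by metis
    obtain C w where C: "finite C" "C \<subseteq> spt \<nu>" "\<And>c. c \<in> C \<Longrightarrow> (w c :: real) \<ge> 0" "sum w C = 1"
      "\<And>x r. r \<ge> \<delta> \<Longrightarrow> sum w {c\<in>C. \<bar>c - x\<bar> \<le> r} \<le> 40 * r powr \<gamma>"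
      by (rule frostman_discretization[OF prob sets spt \<delta>0 \<gamma>]) (use fr in auto)
    have "\<exists>c\<in>C. \<eta> \<le> \<bar>c\<bar>"
    proof (rule ccontr)
      assume "\<not> ?thesis"
      hence "{c\<in>C. \<bar>c - 0\<bar> \<le> \<eta>} = C" by (auto simp: not_le less_imp_le)
      moreover have "sum w {c\<in>C. \<bar>c - 0\<bar> \<le> \<eta>} \<le> 40 * \<eta> powr \<gamma>" using \<delta>le by (intro C(5)) (simp add: \<delta>\<^sub>0_def)
      ultimately show False using C(4) \<eta>(2) by simp
    qed
    then obtain c0 where c0: "c0 \<in> C" "\<eta> \<le> \<bar>c0\<bar>" by blast
    have C1: "C \<subseteq> {-1..1}" using C(2) spt by blast
    have c01: "\<bar>c0\<bar> \<le> 1" using c0(1) C1 by (auto simp: abs_le_iff dest!: subsetD)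
    have \<delta>N: "\<delta> \<le> 1 / real D ^ N"
    proof -
      have "real (d * N) \<le> real k" using dN by (simp only: of_nat_le_iff)
      thus ?thesis unfolding \<delta>2 Dpow powr_minus_divide[symmetric] by simp
    qed
    have RSN: "R \<union> S \<subseteq> {..<N}" using RS tN by auto
    interpret cw: coded_windows D N Q K n "D ^ K" P "R \<union> S" b \<tau> C w \<gamma> \<delta> c0 \<eta>
      by unfold_locales (fact D2 RSN b_near b_far \<tau>(2) \<tau>(3) K(1) n nm refl C(1) C1 C(3) C(4) C(5) \<gamma> \<delta>0 \<delta>N \<eta>(1) c0(2) c01)+
    obtain c where c: "c \<in> PiE {..<n} (\<lambda>_. C)"
      "(\<Prod>p<P. 1 / cw.loss p) \<le> card (\<Sum>i<n + D ^ K. (\<lambda>x. \<lfloor>(if i < n then c i else c0) * x / \<delta>\<rfloor>) ` B)"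
      by (rule cw.exists_large_sumset[OF finB bB])
    define e where "e i = (if i < n then c i else c0)" for i
    define X where "X = real (\<tau> P) - real (\<tau> 0)"
    define Z where "Z = real (card ((R \<union> S) \<inter> {\<tau> 0..<\<tau> P}))"
    have X: "l - 1 - real K - real t \<le> X" "X \<le> l"
    proof -
      have "real N \<le> real (\<tau> P) + real K" using \<tau>(5) by linarith
      thus "l - 1 - real K - real t \<le> X" using N(2) t0t \<tau>(1) by (simp add: X_def)
      have "\<tau> P \<le> N" using \<tau>(2)[of P] by (simp add: forward_dense_def)
      thus "X \<le> l" using N(1) by (simp add: X_def)
    qed
    have Z: "real (card S) - real K \<le> Z"
    proof -
      have "S \<subseteq> ((R \<union> S) \<inter> {\<tau> 0..<\<tau> P}) \<union> {\<tau> P..<N}" using RS(2) t0t \<tau>(1) by auto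
      hence "card S \<le> card (((R \<union> S) \<inter> {\<tau> 0..<\<tau> P}) \<union> {\<tau> P..<N})" by (intro card_mono) auto
      also have "\<dots> \<le> card ((R \<union> S) \<inter> {\<tau> 0..<\<tau> P}) + card {\<tau> P..<N}" by (rule card_Un_le)
      also have "\<dots> \<le> card ((R \<union> S) \<inter> {\<tau> 0..<\<tau> P}) + K" using \<tau>(5) by simp
      finally have "real (card S) \<le> real (card ((R \<union> S) \<inter> {\<tau> 0..<\<tau> P}) + K)" by (simp only: of_nat_le_iff)
      thus ?thesis by (simp add: Z_def)
    qed
    \<comment> \<open>\<open>J\<close> bounds the losses both in the number of branching levels and
      in the length covered by windows. The main terms combine through \<open>(1 - \<gamma>) *
      \<beta> + \<gamma> = \<beta> + \<gamma> * (1 - \<beta>)\<close>.\<close>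
    have expo: "(\<beta> + \<gamma> * (1 - \<beta>) - \<sigma> / 2) * l \<le> (1 - \<gamma>) * Z + (\<gamma> - 3 * s) * X"
    proof -
      define J where "J = 2 * s * l + 2 + real t + real K"
      have "(1 - \<gamma>) * (\<beta> * l - J) \<le> (1 - \<gamma>) * Z"
        using Z Slarge \<gamma> by (intro mult_left_mono) (auto simp: J_def)
      moreover have "\<gamma> * (l - J) \<le> \<gamma> * X"
      proof (rule mult_left_mono)
        have "0 \<le> 2 * s * l" using s l by simp
        thus "l - J \<le> X" using X(1) unfolding J_def by linarith
      qed (use \<gamma> in simp)
      moreover have "3 * s * X \<le> 3 * s * l" using X(2) s by (intro mult_left_mono) auto
      moreover have "J + 3 * s * l \<le> \<sigma> / 2 * l"
      proof -
        have "\<sigma> / 2 * l = 16 * (s * l)" by (simp add: s_def)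
        thus ?thesis using t(2) l(2) unfolding J_def by linarith
      qed
      moreover have "(1 - \<gamma>) * (\<beta> * l - J) + \<gamma> * (l - J) = (\<beta> + \<gamma> * (1 - \<beta>)) * l - J" by (simp add: algebra_simps)
      moreover have "(\<gamma> - 3 * s) * X = \<gamma> * X - 3 * s * X" "(\<beta> + \<gamma> * (1 - \<beta>) - \<sigma> / 2) * l = (\<beta> + \<gamma> * (1 - \<beta>)) * l - \<sigma> / 2 * l"
        by (simp_all only: left_diff_distrib)
      ultimately show ?thesis by linarith
    qed
    show "\<exists>e. (\<forall>i<h. e i \<in> spt \<nu>) \<and>
        \<delta> powr (- (\<beta> + \<gamma> * (1 - \<beta>) - \<sigma> / 2)) \<le> card (\<Sum>i<h. (\<lambda>b. \<lfloor>e i * b / \<delta>\<rfloor>) ` B)"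
    proof (intro exI[of _ e] conjI allI impI)
      fix i
      have "e i \<in> C" using c(1) c0(1) by (auto simp: e_def dest: PiE_mem)
      thus "e i \<in> spt \<nu>" using C(2) by blast
    next
      have "\<delta> powr (- (\<beta> + \<gamma> * (1 - \<beta>) - \<sigma> / 2)) = real D powr ((\<beta> + \<gamma> * (1 - \<beta>) - \<sigma> / 2) * l)"
        unfolding \<delta>2 powr_powr Dpowr kl by (simp only: minus_mult_minus mult_ac)
      also have "\<dots> \<le> real D powr ((1 - \<gamma>) * Z + (\<gamma> - 3 * s) * X)" using expo D2 by (intro powr_mono) auto
      also have "\<dots> \<le> (\<Prod>p<P. 1 / cw.loss p)"
        unfolding Z_def X_def
      proof (rule cw.prod_inverse_loss_ge)
        show "(2 * cw.radius + 1) * (320 * real D) \<le> real D powr (s * real K)"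
          using E0 by (simp only: cw.radius_def E0_def)
        show "Q * card ((R \<union> S) \<inter> cw.win p) \<le> Q * K + (\<tau> (Suc p) - \<tau> p)" if "p < P" for p
          unfolding cw.win_def by (rule \<tau>(4)[OF that])
      qed (use s Ds Qs in auto)
      also note c(2)
      finally show "\<delta> powr (- (\<beta> + \<gamma> * (1 - \<beta>) - \<sigma> / 2)) \<le> card (\<Sum>i<h. (\<lambda>b. \<lfloor>e i * b / \<delta>\<rfloor>) ` B)"
        by (simp only: e_def h_def)
    qed
  qed
qed

section \<open>Deduction of the theorem\<close>

lemma finite_grid:
  fixes \<delta> :: real
  assumes "0 < \<delta>" "A \<subseteq> (\<lambda>x. \<delta> * x) ` \<int> \<inter> {0..1}"
  shows "finite A"
proof (rule finite_subset)
  show "A \<subseteq> (\<lambda>i. \<delta> * real_of_int i) ` {0..\<lfloor>1 / \<delta>\<rfloor>}"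
  proof
    fix x assume "x \<in> A"
    hence "x \<in> (\<lambda>x. \<delta> * x) ` \<int> \<inter> {0..1}" using assms(2) by blast
    then obtain z where z: "x = \<delta> * z" "z \<in> \<int>" "0 \<le> x" "x \<le> 1" by auto
    then obtain i :: int where i: "z = of_int i" by (auto elim: Ints_cases)
    have "0 \<le> i" using z(1,3) i assms(1) by (simp add: zero_le_mult_iff)
    moreover have "real_of_int i \<le> 1 / \<delta>" using z(1,4) i assms(1) by (simp add: field_simps)
    hence "i \<le> \<lfloor>1 / \<delta>\<rfloor>" by (simp only: le_floor_iff)
    ultimately show "x \<in> (\<lambda>i. \<delta> * real_of_int i) ` {0..\<lfloor>1 / \<delta>\<rfloor>}" using z(1) i by auto
  qed
qed simp

theorem theorem3p3:
  fixes \<alpha> \<beta> \<gamma> \<kappa> :: real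
  assumes "0 < \<beta>" and "\<beta> \<le> \<alpha>" and "\<alpha> < 1" and "\<kappa> > 0"
    and "\<gamma> \<in> {(\<alpha> - \<beta>) / (1 - \<beta>) <.. 1}"
  shows "\<exists>\<epsilon> \<epsilon>\<^sub>0 \<epsilon>\<^sub>B \<delta>\<^sub>0 \<rho> :: real.
    \<epsilon> \<in> {0 <.. 1/2} \<and> \<epsilon>\<^sub>0 \<in> {0 <.. 1/2} \<and> \<epsilon>\<^sub>B \<in> {0 <.. 1/2} \<and> \<delta>\<^sub>0 \<in> {0 <.. 1/2} \<and> \<rho> \<in> {0 <.. 1/2} \<and>
    (\<forall>(\<delta>::real) (A::real set) (B::real set) (\<nu>::real measure).
       (\<exists>n::nat. \<delta> = 2 powr (- real n)) \<and> \<delta> \<in> {0 <.. \<delta>\<^sub>0} \<and>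
       A \<subseteq> (\<lambda>x. \<delta> * x) ` \<int> \<inter> {0..1} \<and> B \<subseteq> (\<lambda>x. \<delta> * x) ` \<int> \<inter> {0..1} \<and>
       real (card A) \<le> \<delta> powr (- \<alpha>) \<and>
       real (card B) \<ge> \<delta> powr (- \<beta>) \<and>
       (\<forall>x r. \<delta> \<le> r \<and> r \<le> \<delta> powr \<epsilon>\<^sub>0 \<longrightarrow>
          real (card (B \<inter> ball x r)) \<le> r powr \<kappa> * real (card B)) \<and>
       real (card (B + B)) \<le> \<delta> powr (- \<epsilon>\<^sub>B) * real (card B) \<and>
       prob_space \<nu> \<and> sets \<nu> = sets borel \<and> spt \<nu> \<subseteq> {-1..1} \<and>
       (\<forall>x r. r \<ge> \<delta> \<longrightarrow> measure \<nu> (ball x r) \<le> 20 * r powr \<gamma>)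
       \<longrightarrow> (\<exists>c \<in> spt \<nu>. \<forall>A' \<subseteq> A. real (card A') \<ge> (1 - \<rho>) * real (card A) \<longrightarrow>
              real (dyadic_covering_number \<delta> (A' + (\<lambda>b. c * b) ` B)) \<ge> \<delta> powr (- \<epsilon>) * real (card A')))"
proof -
  \<comment> \<open>The surplus of the dimension of the long sum over \<alpha>. It is positive
    exactly by the lower bound on \<gamma>.\<close>
  define \<sigma> where "\<sigma> = \<beta> + \<gamma> * (1 - \<beta>) - \<alpha>"
  have \<beta>1: "0 < 1 - \<beta>" using assms by simp
  have \<gamma>: "(\<alpha> - \<beta>) / (1 - \<beta>) < \<gamma>" "\<gamma> \<le> 1" using assms(5) by auto
  have "0 \<le> (\<alpha> - \<beta>) / (1 - \<beta>)" using assms(2) \<beta>1 by simp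
  hence \<gamma>0: "0 < \<gamma>" using \<gamma>(1) by linarith
  have \<sigma>: "0 < \<sigma>" "\<sigma> \<le> 1"
  proof -
    have "\<alpha> - \<beta> < \<gamma> * (1 - \<beta>)" using \<gamma>(1) \<beta>1 by (simp only: pos_divide_less_eq)
    thus "0 < \<sigma>" by (simp add: \<sigma>_def)
    have "\<gamma> * (1 - \<beta>) \<le> 1 * (1 - \<beta>)" using \<gamma>(2) \<beta>1 by (intro mult_right_mono) auto
    thus "\<sigma> \<le> 1" using assms(1,2) by (simp add: \<sigma>_def)
  qed
  have target: "\<beta> + \<gamma> * (1 - \<beta>) - \<sigma> / 2 = \<alpha> + \<sigma> / 2"
  proof -
    have "\<beta> + \<gamma> * (1 - \<beta>) = \<alpha> + \<sigma>" by (simp add: \<sigma>_def)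
    thus ?thesis by simp
  qed
  obtain \<epsilon>\<^sub>0 \<delta>\<^sub>1 h where ls: "0 < \<epsilon>\<^sub>0" "\<epsilon>\<^sub>0 \<le> 1 / 2" "0 < \<delta>\<^sub>1" "0 < h"
    "\<forall>(k::nat) \<delta> (B :: real set) (\<nu> :: real measure).
      \<delta> = 1 / 2 ^ k \<longrightarrow> \<delta> \<le> \<delta>\<^sub>1 \<longrightarrow> B \<subseteq> (\<lambda>x. \<delta> * x) ` \<int> \<inter> {0..1} \<longrightarrow> finite B \<longrightarrow>
      \<delta> powr (- \<beta>) \<le> card B \<longrightarrow>
      (\<forall>x r. \<delta> \<le> r \<and> r \<le> \<delta> powr \<epsilon>\<^sub>0 \<longrightarrow> card (B \<inter> ball x r) \<le> r powr \<kappa> * card B) \<longrightarrow>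
      prob_space \<nu> \<longrightarrow> sets \<nu> = sets borel \<longrightarrow> spt \<nu> \<subseteq> {-1..1} \<longrightarrow>
      (\<forall>x r. \<delta> \<le> r \<longrightarrow> measure \<nu> (ball x r) \<le> 20 * r powr \<gamma>) \<longrightarrow>
      (\<exists>e. (\<forall>i<h. e i \<in> spt \<nu>) \<and>
        \<delta> powr (- (\<alpha> + \<sigma> / 2)) \<le> card (\<Sum>i<(h::nat). (\<lambda>b. \<lfloor>e i * b / \<delta>\<rfloor>) ` B))"
    using long_sums[OF \<gamma>0 \<gamma>(2) assms(4) \<sigma>, of \<beta>] unfolding target by blast
  define H where "H = (2 * real h) ^ h"
  have H: "0 < H" using ls(4) by (simp add: H_def)
  \<comment> \<open>The Pluennecke inequality raises \<open>\<delta> powr (- \<epsilon>)\<close> to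
    the power \<open>h\<close>; this uses at most \<open>\<sigma> / 4\<close> of the surplus
    \<open>\<sigma> / 2\<close>.\<close>
  define \<epsilon> where "\<epsilon> = min (1 / 2) (\<sigma> / (4 * real h))"
  have \<epsilon>: "0 < \<epsilon>" "\<epsilon> \<le> 1 / 2" "\<epsilon> * real h \<le> \<sigma> / 4"
  proof -
    show "0 < \<epsilon>" "\<epsilon> \<le> 1 / 2" using \<sigma> ls(4) by (auto simp: \<epsilon>_def)
    have "\<epsilon> * real h \<le> \<sigma> / (4 * real h) * real h" by (intro mult_right_mono) (auto simp: \<epsilon>_def)
    thus "\<epsilon> * real h \<le> \<sigma> / 4" using ls(4) by simp
  qed
  \<comment> \<open>The remaining \<open>\<sigma> / 4\<close> has to beat the constant
    \<open>H\<close>: the last bound gives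
    \<open>2 * H \<le> \<delta> powr (- (\<sigma> / 4))\<close>.\<close>
  define \<delta>\<^sub>0 where "\<delta>\<^sub>0 = min (1 / 2) (min \<delta>\<^sub>1 ((2 * H) powr (- (4 / \<sigma>))))"
  \<comment> \<open>The complements of \<open>h\<close> bad subsets then cover at most half of
    \<open>A\<close>.\<close>
  define \<rho> where "\<rho> = 1 / (2 * real h)"
  show ?thesis
  proof (rule exI[of _ \<epsilon>], rule exI[of _ \<epsilon>\<^sub>0], rule exI[of _ "1/2"], rule exI[of _ \<delta>\<^sub>0], rule exI[of _ \<rho>],
      intro conjI allI impI)
    show "\<epsilon> \<in> {0<..1/2}" "\<epsilon>\<^sub>0 \<in> {0<..1/2}" "(1/2::real) \<in> {0<..1/2}" using \<epsilon> ls by auto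
    show "\<delta>\<^sub>0 \<in> {0<..1/2}" using ls(3) H by (auto simp: \<delta>\<^sub>0_def)
    show "\<rho> \<in> {0<..1/2}" using ls(4) by (auto simp: \<rho>_def field_simps)
    fix \<delta> :: real and A B :: "real set" and \<nu> :: "real measure"
    assume hyp: "(\<exists>n::nat. \<delta> = 2 powr (- real n)) \<and> \<delta> \<in> {0 <.. \<delta>\<^sub>0} \<and>
       A \<subseteq> (\<lambda>x. \<delta> * x) ` \<int> \<inter> {0..1} \<and> B \<subseteq> (\<lambda>x. \<delta> * x) ` \<int> \<inter> {0..1} \<and>
       real (card A) \<le> \<delta> powr (- \<alpha>) \<and>
       real (card B) \<ge> \<delta> powr (- \<beta>) \<and>
       (\<forall>x r. \<delta> \<le> r \<and> r \<le> \<delta> powr \<epsilon>\<^sub>0 \<longrightarrow>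
          real (card (B \<inter> ball x r)) \<le> r powr \<kappa> * real (card B)) \<and>
       real (card (B + B)) \<le> \<delta> powr (- (1/2)) * real (card B) \<and>
       prob_space \<nu> \<and> sets \<nu> = sets borel \<and> spt \<nu> \<subseteq> {-1..1} \<and>
       (\<forall>x r. r \<ge> \<delta> \<longrightarrow> measure \<nu> (ball x r) \<le> 20 * r powr \<gamma>)"
    from hyp obtain k :: nat where k: "\<delta> = 2 powr (- real k)" by blast
    hence \<delta>k: "\<delta> = 1 / 2 ^ k" by (simp add: powr_minus_divide powr_realpow)
    have \<delta>: "0 < \<delta>" "\<delta> \<le> \<delta>\<^sub>0" and A: "A \<subseteq> (\<lambda>x. \<delta> * x) ` \<int> \<inter> {0..1}" and B: "B \<subseteq> (\<lambda>x. \<delta> * x) ` \<int> \<inter> {0..1}"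
      and cA: "real (card A) \<le> \<delta> powr (- \<alpha>)" using hyp by auto
    have finA: "finite A" and finB: "finite B" using finite_grid \<delta>(1) A B by blast+
    have \<delta>1: "\<delta> \<le> \<delta>\<^sub>1" using \<delta>(2) by (simp add: \<delta>\<^sub>0_def)
    have "\<exists>e. (\<forall>i<h. e i \<in> spt \<nu>) \<and>
        \<delta> powr (- (\<alpha> + \<sigma> / 2)) \<le> card (\<Sum>i<h. (\<lambda>b. \<lfloor>e i * b / \<delta>\<rfloor>) ` B)"
      using hyp by (intro ls(5)[rule_format, OF \<delta>k \<delta>1 B finB]) auto
    then obtain e where e: "\<And>i. i < h \<Longrightarrow> e i \<in> spt \<nu>"
      "\<delta> powr (- (\<alpha> + \<sigma> / 2)) \<le> card (\<Sum>i<h. (\<lambda>b. \<lfloor>e i * b / \<delta>\<rfloor>) ` B)" by blast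
    show "\<exists>c \<in> spt \<nu>. \<forall>A' \<subseteq> A. real (card A') \<ge> (1 - \<rho>) * real (card A) \<longrightarrow>
              real (dyadic_covering_number \<delta> (A' + (\<lambda>b. c * b) ` B)) \<ge> \<delta> powr (- \<epsilon>) * real (card A')"
    proof (rule ccontr)
      assume "\<not> ?thesis"
      hence "\<forall>c\<in>spt \<nu>. \<exists>A'\<subseteq>A. (1 - \<rho>) * real (card A) \<le> real (card A') \<and>
          real (dyadic_covering_number \<delta> (A' + (\<lambda>b. c * b) ` B)) < \<delta> powr (- \<epsilon>) * real (card A')"
        unfolding not_le[symmetric] by blast
      then obtain bad where bad: "\<And>c. c \<in> spt \<nu> \<Longrightarrow> bad c \<subseteq> A"
        "\<And>c. c \<in> spt \<nu> \<Longrightarrow> (1 - \<rho>) * real (card A) \<le> real (card (bad c))"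
        "\<And>c. c \<in> spt \<nu> \<Longrightarrow> real (dyadic_covering_number \<delta> (bad c + (\<lambda>b. c * b) ` B)) < \<delta> powr (- \<epsilon>) * real (card (bad c))"
        by metis
      \<comment> \<open>For empty \<open>A\<close> the bad subset would be empty, and the strict
        inequality in \<open>bad\<close> would put a covering number below 0.\<close>
      have Ane: "A \<noteq> {}"
      proof
        assume "A = {}"
        hence "bad (e 0) = {}" using bad(1)[OF e(1)[OF ls(4)]] by simp
        thus False using bad(3)[OF e(1)[OF ls(4)]] by simp
      qed
      have "real (card (\<Sum>i<h. (\<lambda>b. \<lfloor>e i * b / \<delta>\<rfloor>) ` B)) \<le> (2 * real h * \<delta> powr (- \<epsilon>)) ^ h * card A"
      proof (rule card_long_sum_le[where A' = "\<lambda>i. bad (e i)"])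
        show "A \<subseteq> (\<lambda>x. \<delta> * x) ` \<int>" using A by blast
        fix i assume i: "i < h"
        show "bad (e i) \<subseteq> A" using bad(1) e(1)[OF i] by blast
        show "(1 - 1 / (2 * real h)) * card A \<le> card (bad (e i))" using bad(2)[OF e(1)[OF i]] by (simp only: \<rho>_def)
        have "real (dyadic_covering_number \<delta> (bad (e i) + (\<lambda>b. e i * b) ` B)) \<le> \<delta> powr (- \<epsilon>) * real (card (bad (e i)))"
          using bad(3)[OF e(1)[OF i]] by simp
        also have "\<dots> \<le> \<delta> powr (- \<epsilon>) * card A"
          using card_mono[OF finA bad(1)[OF e(1)[OF i]]] by (intro mult_left_mono) auto
        finally show "real (dyadic_covering_number \<delta> (bad (e i) + (\<lambda>b. e i * b) ` B)) \<le> \<delta> powr (- \<epsilon>) * card A" .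
      qed (use \<delta>(1) finA finB Ane ls(4) in auto)
      also have "\<dots> \<le> (2 * real h * \<delta> powr (- \<epsilon>)) ^ h * \<delta> powr (- \<alpha>)" by (intro mult_left_mono cA) simp
      also have "\<dots> = H * (\<delta> powr (- (\<epsilon> * real h)) * \<delta> powr (- \<alpha>))"
        using \<delta>(1) by (simp add: H_def power_mult_distrib powr_realpow[symmetric] powr_powr)
      also have "\<dots> = H * \<delta> powr (- (\<epsilon> * real h) + (- \<alpha>))" by (simp only: powr_add)
      also have "\<dots> \<le> H * \<delta> powr (- (\<sigma> / 4) + (- \<alpha>))"
      proof (intro mult_left_mono powr_mono')
        show "\<delta> \<le> 1" using \<delta>(2) by (simp add: \<delta>\<^sub>0_def)
      qed (use \<delta>(1) H \<epsilon>(3) in auto)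
      finally have up: "\<delta> powr (- (\<alpha> + \<sigma> / 2)) \<le> H * \<delta> powr (- (\<sigma> / 4) + (- \<alpha>))" using e(2) by linarith
      have "- (\<alpha> + \<sigma> / 2) = - (\<sigma> / 4) + (- (\<sigma> / 4) + (- \<alpha>))" by simp
      hence "\<delta> powr (- (\<alpha> + \<sigma> / 2)) = \<delta> powr (- (\<sigma> / 4)) * \<delta> powr (- (\<sigma> / 4) + (- \<alpha>))"
        by (simp only: powr_add)
      hence "\<delta> powr (- (\<sigma> / 4)) * \<delta> powr (- (\<sigma> / 4) + (- \<alpha>)) \<le> H * \<delta> powr (- (\<sigma> / 4) + (- \<alpha>))" using up by metis
      hence small: "\<delta> powr (- (\<sigma> / 4)) \<le> H" using \<delta>(1) by (simp only: mult_le_cancel_right_pos powr_gt_zero less_imp_neq[symmetric] not_False_eq_True)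
      have "2 * H = ((2 * H) powr (- (4 / \<sigma>))) powr (- (\<sigma> / 4))" using \<sigma>(1) H by (simp add: powr_powr)
      also have "\<dots> \<le> \<delta> powr (- (\<sigma> / 4))"
        using \<delta> \<sigma>(1) by (intro powr_mono2') (auto simp: \<delta>\<^sub>0_def)
      finally show False using small H by linarith
    qed
  qed
qed

end
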